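(* (Reduction Theorem) Let $G$ be a connected negative definite plumbing graph (a tree with zero genus decorations) and let $k_r$ be the distinguished representative of a class $[k]$ of characteristic elements. Let $\overline{\mathcal J}=\{j_k\}_{k=1}^{\nu}\subseteq\mathcal J$ be a (not necessarily minimal) set of bad vertices of $G$, and let $(\overline L,\overline w[k])$ be the weighted first quadrant $\overline L=(\mathbb Z_{\ge 0})^{\nu}$ with weights determined by $\overline w_0(\mathbf i)=\chi_{k_r}(x(\mathbf i))$. Then there is an isomorphism of graded $\mathbb Z[U]$-modules $$\mathbb H^*(G,k_r)\;\cong\;\mathbb H^*(\overline L,\overline w[k]).$$
   Context: Graph and lattice. $G$ is a connected negative definite plumbing graph, a tree with all genus decorations zero (equivalently, the associated plumbed 3-manifold is a rational homology sphere), with vertex set $\mathcal J$, $s=|\mathcal J|$. $L=\bigoplus_{j\in\mathcal J}\mathbb Z E_j$ carries the negative definite form with $(E_j,E_j)=e_j$ the Euler decoration, $(E_i,E_j)=1$ if $i\neq j$ are adjacent and $0$ otherwise. $L'=\{l'\in L\otimes\mathbb Q:(l',L)\subseteq\mathbb Z\}$. For rational cycles, $x=\sum_j m_j(x)E_j$, and $\le$ is the coefficientwise order. $\mathrm{Char}=\{k\in L':(k,x)+(x,x)\in2\mathbb Z\ \forall x\in L\}$. $k_{can}\in L'$ is defined by $(k_{can},E_j)=-(E_j,E_j)-2$ for all $j$; then $\mathrm{Char}=k_{can}+2L'$. For $k\in\mathrm{Char}$, $[k]=k+2L$ and $\chi_k(l)=-(l,l+k)/2$ for $l\in L$; $\chi_{can}:=\chi_{k_{can}}$.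 $\mathcal S'=\{l'\in L':(l',E_j)\le0\ \forall j\in\mathcal J\}$. If $k=k_{can}+2l'$, then $l'_{[k]}$ is the unique minimal element of $(l'+L)\cap\mathcal S'$, and $k_r:=k_{can}+2l'_{[k]}$ is the distinguished representative of $[k]$. Bad vertices. A connected negative definite graph is rational if $\chi_{can}(l)>0$ for every $l\in L$, $l>0$. A subset $\overline{\mathcal J}=\{j_k\}_{k=1}^\nu\subseteq\mathcal J$ is a set of bad vertices if replacing the decorations $e_j$, $j\in\overline{\mathcal J}$, by some integers $e'_j\le e_j$ gives a rational graph. Put $\mathcal J^*=\mathcal J\setminus\overline{\mathcal J}$. The cycles $x(\mathbf i)$. For $\mathbf i=(i_j)_{j\in\overline{\mathcal J}}\in(\mathbb Z_{\ge0})^\nu$, $x(\mathbf i)\in L$ is the unique minimal cycle with $m_j(x(\mathbf i))=i_j$ for $j\in\overline{\mathcal J}$ and $(x(\mathbf i)+l'_{[k]},E_j)\le0$ for all $j\in\mathcal J^*$. Lattice cohomology. $\mathcal T_0^+=\mathbb Z[U,U^{-1}]/U\mathbb Z[U]$, graded by $\deg U^{-d}=2d$. Consider the decomposition of $\mathbb R^n$ (or of $[0,\infty)^n$) into unit cubes with integral vertices: the cube $(l,I)$, $I\subseteq\{1,\dots,n\}$, $|I|=q$, is the $q$-cube with vertices $l+\sum_{j\in I'}E_j$, $I'\subseteq I$, oriented by a fixed order of the basis $\{E_j\}$. $\mathcal C_q$ is the free $\mathbb Z$-module on oriented $q$-cubes. Given $w_0:\mathbb Z^n\to\mathbb Z$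 (or on $(\mathbb Z_{\ge0})^n$) with finite sublevel sets $w_0^{-1}((-\infty,N])$, put $w(\square)=\max\{w_0(v): v \text{ vertex of }\square\}$. Let $\mathcal F^q=\mathrm{Hom}_{\mathbb Z}(\mathcal C_q,\mathcal T_0^+)$, a $\mathbb Z[U]$-module by $(p*\phi)(\square)=p(\phi(\square))$, graded so that $\phi$ is homogeneous of degree $d$ if every nonzero $\phi(\square)$ is homogeneous of degree $d-2w(\square)$. If $\partial\square_{q+1}=\sum_m\varepsilon_m\square_q^m$, set $(\delta_w\phi)(\square_{q+1})=\sum_m\varepsilon_m U^{w(\square_{q+1})-w(\square_q^m)}\phi(\square_q^m)$. The lattice cohomology is the cohomology of $(\mathcal F^*,\delta_w)$, a graded $\mathbb Z[U]$-module. $\mathbb H^*(G,k)$ denotes the lattice cohomology of $L=\mathbb Z^s$ (all cubes of $\mathbb R^s$) with $w_0=\chi_k$. $\mathbb H^*(\overline L,\overline w[k])$ denotes the lattice cohomology of $[0,\infty)^\nu$ (all cubes with vertices in $(\mathbb Z_{\ge0})^\nu$) with $w_0=\overline w_0$, $\overline w_0(\mathbf i):=\chi_{k_r}(x(\mathbf i))$. *)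

theory Defs
  imports
    Complex_Main
    "HOL-Library.Poly_Mapping"
    "HOL-Library.Function_Algebras"
    "HOL-Library.Set_Algebras"
    "HOL-Computational_Algebra.Polynomial"
begin

section \<open>The module $T_0^+ = Z[U,U^{-1}] / U Z[U]$\<close>

type_synonym laurent = "int \<Rightarrow>\<^sub>0 int"

definition laurent_of_poly :: "int poly \<Rightarrow> laurent" where
  "laurent_of_poly p = (\<Sum>i\<le>degree p. Poly_Mapping.single (int i) (coeff p i))"

text \<open>The subgroup $U Z[U]$: only positive powers of $U$ occur.\<close>

definition U_ZU :: "laurent set" where
  "U_ZU = {f. Poly_Mapping.keys f \<subseteq> {1..}}"

lemma lookup_laurent_of_poly:
  "Poly_Mapping.lookup (laurent_of_poly p) n = (if 0 \<le> n then coeff p (nat n) else 0)"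
proof -
  have "Poly_Mapping.lookup (laurent_of_poly p) n =
      (\<Sum>i\<le>degree p. if int i = n then coeff p i else 0)"
    by (simp add: laurent_of_poly_def lookup_sum lookup_single when_def)
  also have "\<dots> = (if 0 \<le> n then coeff p (nat n) else 0)"
  proof (cases "0 \<le> n")
    case True
    then have "(\<Sum>i\<le>degree p. if int i = n then coeff p i else 0)
        = (\<Sum>i\<le>degree p. if i = nat n then coeff p i else 0)"
      by (intro sum.cong) auto
    then show ?thesis using True by (auto simp: coeff_eq_0)
  next
    case False
    then show ?thesis by (auto intro!: sum.neutral)
  qed
  finally show ?thesis .
qed

lemma U_ZU_eq: "U_ZU = range (\<lambda>p. Poly_Mapping.single 1 1 * laurent_of_poly p)"
proof -
  have lookup_U: "Poly_Mapping.lookup (Poly_Mapping.single 1 1 * f) n = Poly_Mapping.lookup f (n - 1)"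
    for f :: laurent and n :: int
    using subset_refl
  proof (induction f rule: frag_induction)
    case (one k)
    then show ?case by (auto simp: mult_single lookup_single when_def)
  next
    case (diff f g)
    then show ?case by (simp add: right_diff_distrib lookup_minus)
  qed simp
  show ?thesis
  proof (intro equalityI subsetI)
    fix f assume "f \<in> U_ZU"
    then have f: "Poly_Mapping.lookup f n = 0" if "n < 1" for n
      using that by (auto simp: U_ZU_def subset_iff in_keys_iff)
    let ?c = "\<lambda>n. Poly_Mapping.lookup f (int n + 1)"
    have "finite ((\<lambda>k. nat (k - 1)) ` Poly_Mapping.keys f)" by simp
    then have "finite {n. ?c n \<noteq> 0}"
      by (rule rev_finite_subset) (force simp: in_keys_iff image_iff)
    then have c: "coeff (Abs_poly ?c) = ?c"
      by (intro Abs_poly_inverse) (simp add: cofinite_eq_sequentially [symmetric] eventually_cofinite)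
    have "f = Poly_Mapping.single 1 1 * laurent_of_poly (Abs_poly ?c)"
      by (rule poly_mapping_eqI) (auto simp: lookup_U lookup_laurent_of_poly c f)
    then show "f \<in> range (\<lambda>p. Poly_Mapping.single 1 1 * laurent_of_poly p)" by blast
  next
    fix f assume "f \<in> range (\<lambda>p. Poly_Mapping.single 1 1 * laurent_of_poly p)"
    then show "f \<in> U_ZU"
      by (auto simp: U_ZU_def in_keys_iff lookup_U lookup_laurent_of_poly split: if_splits)
  qed
qed

lemma U_ZU_zero: "0 \<in> U_ZU"
  by (simp add: U_ZU_def)

lemma U_ZU_add: "f \<in> U_ZU \<Longrightarrow> g \<in> U_ZU \<Longrightarrow> f + g \<in> U_ZU"
  using keys_add [of f g] by (auto simp: U_ZU_def)

lemma U_ZU_uminus: "f \<in> U_ZU \<Longrightarrow> - f \<in> U_ZU"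
  by (simp add: U_ZU_def)

lemma U_ZU_diff_commute: "f - g \<in> U_ZU \<Longrightarrow> g - f \<in> U_ZU"
  using U_ZU_uminus [of "f - g"] by simp

lemma U_ZU_mult: "f \<in> U_ZU \<Longrightarrow> laurent_of_poly p * f \<in> U_ZU"
proof -
  assume f: "f \<in> U_ZU"
  have "Poly_Mapping.keys (laurent_of_poly p) \<subseteq> {0..}"
    by (auto simp: in_keys_iff lookup_laurent_of_poly split: if_splits)
  with f keys_mult [of "laurent_of_poly p" f] show ?thesis
    by (fastforce simp: U_ZU_def)
qed

definition laurent_rel :: "laurent \<Rightarrow> laurent \<Rightarrow> bool" where
  "laurent_rel f g \<longleftrightarrow> f - g \<in> U_ZU"

quotient_type T0 = laurent / laurent_rel
proof (rule equivpI)
  show "reflp laurent_rel" by (simp add: reflp_def laurent_rel_def U_ZU_zero)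
  show "symp laurent_rel" using U_ZU_diff_commute by (simp add: symp_def laurent_rel_def)
  show "transp laurent_rel"
  proof (rule transpI)
    fix f g h assume "laurent_rel f g" "laurent_rel g h"
    then show "laurent_rel f h"
      using U_ZU_add [of "f - g" "g - h"] by (simp add: laurent_rel_def)
  qed
qed

instantiation T0 :: ab_group_add
begin

lift_definition zero_T0 :: T0 is 0 .

lift_definition plus_T0 :: "T0 \<Rightarrow> T0 \<Rightarrow> T0" is "(+)"
  by (simp only: laurent_rel_def add_diff_add U_ZU_add)

lift_definition uminus_T0 :: "T0 \<Rightarrow> T0" is uminus
  by (simp only: laurent_rel_def minus_diff_minus U_ZU_uminus)

lift_definition minus_T0 :: "T0 \<Rightarrow> T0 \<Rightarrow> T0" is "(-)"
proof -
  fix f f' g g' :: laurent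
  assume "laurent_rel f f'" "laurent_rel g g'"
  then have "(f - f') + - (g - g') \<in> U_ZU"
    unfolding laurent_rel_def by (intro U_ZU_add U_ZU_uminus)
  then show "laurent_rel (f - g) (f' - g')"
    by (simp add: laurent_rel_def algebra_simps)
qed

instance
  by standard (transfer; simp add: laurent_rel_def U_ZU_zero)+

end

text \<open>The action of $Z[U]$ on $T_0^+$; \<^typ>\<open>int poly\<close> plays the role of $Z[U]$.\<close>

lift_definition T0_smult :: "int poly \<Rightarrow> T0 \<Rightarrow> T0" is "\<lambda>p f. laurent_of_poly p * f"
  by (simp only: laurent_rel_def right_diff_distrib [symmetric] U_ZU_mult)

lemma laurent_of_poly_add: "laurent_of_poly (p + q) = laurent_of_poly p + laurent_of_poly q"
  by (rule poly_mapping_eqI) (simp add: lookup_laurent_of_poly lookup_add)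

lemma laurent_of_poly_pCons:
  "laurent_of_poly (pCons a p) =
    Poly_Mapping.single 0 a + Poly_Mapping.single 1 1 * laurent_of_poly p"
proof (cases "p = 0")
  case True
  then show ?thesis by (simp add: laurent_of_poly_def)
next
  case False
  then show ?thesis
    by (simp add: laurent_of_poly_def sum.atMost_Suc_shift sum_distrib_left mult_single add.commute
        del: sum.atMost_Suc)
qed

lemma laurent_of_poly_mult: "laurent_of_poly (p * q) = laurent_of_poly p * laurent_of_poly q"
proof -
  have smult: "laurent_of_poly (Polynomial.smult a q) = Poly_Mapping.single 0 a * laurent_of_poly q" for a q
  proof (induction q)
    case 0
    then show ?case by (simp add: laurent_of_poly_def)
  next
    case (pCons b q)
    then show ?case
      by (simp add: laurent_of_poly_pCons distrib_left mult_single mult.left_commute)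
  qed
  show ?thesis
  proof (induction p)
    case 0
    then show ?case by (simp add: laurent_of_poly_def)
  next
    case (pCons a p)
    then show ?case
      by (simp add: laurent_of_poly_pCons laurent_of_poly_add smult distrib_right mult.assoc)
  qed
qed

lemma module_T0: "module T0_smult"
proof
  fix p q :: "int poly" and x y :: T0
  show "T0_smult p (x + y) = T0_smult p x + T0_smult p y"
    by transfer (simp add: laurent_rel_def U_ZU_zero distrib_left)
  show "T0_smult (p + q) x = T0_smult p x + T0_smult q x"
    by transfer (simp add: laurent_rel_def U_ZU_zero distrib_right laurent_of_poly_add)
  show "T0_smult p (T0_smult q x) = T0_smult (p * q) x"
    by transfer (simp add: laurent_rel_def U_ZU_zero laurent_of_poly_mult mult.assoc)
  show "T0_smult 1 x = x"
    by transfer (simp add: laurent_rel_def U_ZU_zero laurent_of_poly_def)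
qed

text \<open>The grading is $\deg U^{-m} = 2m$; zero is homogeneous of every even degree here, which is
  harmless since degrees are only imposed on nonzero values below.\<close>

definition T0_homogeneous :: "int \<Rightarrow> T0 \<Rightarrow> bool" where
  "T0_homogeneous d x \<longleftrightarrow>
    (\<exists>m c. d = 2 * m \<and> x = abs_T0 (Poly_Mapping.single (- m) c))"


section \<open>Graded $Z[U]$-modules\<close>

record 'm graded_module =
  gm_carrier :: "'m set"
  gm_add :: "'m \<Rightarrow> 'm \<Rightarrow> 'm"
  gm_smult :: "int poly \<Rightarrow> 'm \<Rightarrow> 'm"
  gm_degree :: "int \<Rightarrow> 'm set"  \<comment> \<open>the homogeneous elements of a given degree\<close>

definition graded_module_iso :: "'m graded_module \<Rightarrow> 'n graded_module \<Rightarrow> bool" where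
  "graded_module_iso M N \<longleftrightarrow> (\<exists>f.
     bij_betw f (gm_carrier M) (gm_carrier N) \<and>
     (\<forall>x\<in>gm_carrier M. \<forall>y\<in>gm_carrier M. f (gm_add M x y) = gm_add N (f x) (f y)) \<and>
     (\<forall>p. \<forall>x\<in>gm_carrier M. f (gm_smult M p x) = gm_smult N p (f x)) \<and>
     (\<forall>d. f ` gm_degree M d = gm_degree N d))"


section \<open>Lattice cohomology\<close>

text \<open>Lattice points are functions into \<^typ>\<open>int\<close> vanishing outside the finite index set \<open>A\<close>. The
  cube $(l, I)$ is oriented by the linear order of the index type.\<close>

type_synonym 'v cube = "('v \<Rightarrow> int) \<times> 'v set"

definition lattice :: "'v set \<Rightarrow> ('v \<Rightarrow> int) set" where
  "lattice A = {l. \<forall>v. v \<notin> A \<longrightarrow> l v = 0}"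

definition quadrant :: "'v set \<Rightarrow> ('v \<Rightarrow> int) set" where
  "quadrant A = {l \<in> lattice A. \<forall>v. 0 \<le> l v}"

definition unit_vec :: "'v \<Rightarrow> 'v \<Rightarrow> 'a::zero_neq_one" where
  "unit_vec j = (\<lambda>v. if v = j then 1 else 0)"

definition cube_vertices :: "'v cube \<Rightarrow> ('v \<Rightarrow> int) set" where
  "cube_vertices c = (case c of (l, I) \<Rightarrow> {l + (\<Sum>j\<in>I'. unit_vec j) | I'. I' \<subseteq> I})"

definition cubes :: "('v \<Rightarrow> int) set \<Rightarrow> nat \<Rightarrow> 'v cube set" where
  "cubes P q = {(l, I). finite I \<and> card I = q \<and> cube_vertices (l, I) \<subseteq> P}"

definition cube_weight :: "(('v \<Rightarrow> int) \<Rightarrow> int) \<Rightarrow> 'v cube \<Rightarrow> int" where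
  "cube_weight w0 c = Max (w0 ` cube_vertices c)"

text \<open>The boundary in the free abelian group on cubes: for the direction of rank $r$ (counted from $0$)
  in $I$, the front face minus the back face occurs with sign $(-1)^r$.\<close>

definition cube_boundary :: "'v::linorder cube \<Rightarrow> 'v cube \<Rightarrow>\<^sub>0 int" where
  "cube_boundary c = (case c of (l, I) \<Rightarrow>
     \<Sum>i\<in>I. frag_cmul ((- 1) ^ card {j \<in> I. j < i})
       (frag_of (l + unit_vec i, I - {i}) - frag_of (l, I - {i})))"

text \<open>A homomorphism from the free module on the $q$-cubes is given by its values on these cubes;
  as a function on all cubes it is normalised to vanish elsewhere.\<close>

definition cochains :: "('v \<Rightarrow> int) set \<Rightarrow> nat \<Rightarrow> ('v cube \<Rightarrow> T0) set" where
  "cochains P q = {\<phi>. \<forall>c. c \<notin> cubes P q \<longrightarrow> \<phi> c = 0}"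

definition cochain_smult :: "int poly \<Rightarrow> ('v cube \<Rightarrow> T0) \<Rightarrow> 'v cube \<Rightarrow> T0" where
  "cochain_smult p \<phi> = (\<lambda>c. T0_smult p (\<phi> c))"

definition homogeneous_cochains ::
    "('v \<Rightarrow> int) set \<Rightarrow> (('v \<Rightarrow> int) \<Rightarrow> int) \<Rightarrow> nat \<Rightarrow> int \<Rightarrow> ('v cube \<Rightarrow> T0) set" where
  "homogeneous_cochains P w0 q d =
     {\<phi> \<in> cochains P q. \<forall>c\<in>cubes P q. \<phi> c \<noteq> 0 \<longrightarrow> T0_homogeneous (d - 2 * cube_weight w0 c) (\<phi> c)}"

text \<open>Faces of a cube have at most the weight of the cube, so the exponent of $U$ is nonnegative.\<close>

definition coboundary ::
    "('v::linorder \<Rightarrow> int) set \<Rightarrow> (('v \<Rightarrow> int) \<Rightarrow> int) \<Rightarrow> nat \<Rightarrow> ('v cube \<Rightarrow> T0) \<Rightarrow> 'v cube \<Rightarrow> T0" where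
  "coboundary P w0 q \<phi> = (\<lambda>c. if c \<in> cubes P (Suc q) then
     \<Sum>c'\<in>Poly_Mapping.keys (cube_boundary c).
       T0_smult (monom (Poly_Mapping.lookup (cube_boundary c) c') (nat (cube_weight w0 c - cube_weight w0 c')))
         (\<phi> c')
     else 0)"

definition cocycles ::
    "('v::linorder \<Rightarrow> int) set \<Rightarrow> (('v \<Rightarrow> int) \<Rightarrow> int) \<Rightarrow> nat \<Rightarrow> ('v cube \<Rightarrow> T0) set" where
  "cocycles P w0 q = {\<phi> \<in> cochains P q. coboundary P w0 q \<phi> = 0}"

definition coboundaries ::
    "('v::linorder \<Rightarrow> int) set \<Rightarrow> (('v \<Rightarrow> int) \<Rightarrow> int) \<Rightarrow> nat \<Rightarrow> ('v cube \<Rightarrow> T0) set" where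
  "coboundaries P w0 q = (case q of 0 \<Rightarrow> {0} | Suc r \<Rightarrow> coboundary P w0 r ` cochains P r)"

text \<open>The $q$-th cohomology. Its elements are the cosets \<^term>\<open>\<phi> +o B\<close> of the coboundaries \<open>B\<close>. Adding
  \<open>B\<close> in the scalar multiplication is needed because $p * B$ may be a proper subset of \<open>B\<close>.\<close>

definition lattice_cohomology ::
    "('v::linorder \<Rightarrow> int) set \<Rightarrow> (('v \<Rightarrow> int) \<Rightarrow> int) \<Rightarrow> nat \<Rightarrow> ('v cube \<Rightarrow> T0) set graded_module" where
  "lattice_cohomology P w0 q =
     (let B = coboundaries P w0 q in
      \<lparr> gm_carrier = (\<lambda>\<phi>. \<phi> +o B) ` cocycles P w0 q,
        gm_add = (+),
        gm_smult = (\<lambda>p X. cochain_smult p ` X + B),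
        gm_degree = (\<lambda>d. (\<lambda>\<phi>. \<phi> +o B) ` (cocycles P w0 q \<inter> homogeneous_cochains P w0 q d)) \<rparr>)"


section \<open>Plumbing graphs\<close>

text \<open>All genus decorations are zero, so only the Euler decorations are recorded.\<close>

record 'v plumbing_graph =
  verts :: "'v set"
  adj :: "('v \<times> 'v) set"
  euler :: "'v \<Rightarrow> int"

definition connected_graph :: "'v plumbing_graph \<Rightarrow> bool" where
  "connected_graph G \<longleftrightarrow> verts G \<noteq> {} \<and> (\<forall>u\<in>verts G. \<forall>v\<in>verts G. (u, v) \<in> (adj G)\<^sup>*)"

definition is_cycle :: "'v plumbing_graph \<Rightarrow> 'v list \<Rightarrow> bool" where
  "is_cycle G vs \<longleftrightarrow> 3 \<le> length vs \<and> distinct vs \<and> (last vs, hd vs) \<in> adj G \<and>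
     (\<forall>i. Suc i < length vs \<longrightarrow> (vs ! i, vs ! Suc i) \<in> adj G)"

definition plumbing_tree :: "'v plumbing_graph \<Rightarrow> bool" where
  "plumbing_tree G \<longleftrightarrow> finite (verts G) \<and> adj G \<subseteq> verts G \<times> verts G \<and> sym (adj G) \<and> irrefl (adj G) \<and>
     connected_graph G \<and> (\<nexists>vs. is_cycle G vs)"

text \<open>Elements of $L$ are integer valued, elements of $L \otimes Q$ rational valued functions.\<close>

abbreviation cycle_lattice :: "'v plumbing_graph \<Rightarrow> ('v \<Rightarrow> int) set" where
  "cycle_lattice G \<equiv> lattice (verts G)"

definition rational_cycles :: "'v plumbing_graph \<Rightarrow> ('v \<Rightarrow> rat) set" where
  "rational_cycles G = {x. \<forall>v. v \<notin> verts G \<longrightarrow> x v = 0}"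

definition rat_cycle :: "('v \<Rightarrow> int) \<Rightarrow> 'v \<Rightarrow> rat" where
  "rat_cycle l = (\<lambda>v. of_int (l v))"

definition intersection_number :: "'v plumbing_graph \<Rightarrow> 'v \<Rightarrow> 'v \<Rightarrow> int" where
  "intersection_number G i j = (if i = j then euler G i else if (i, j) \<in> adj G then 1 else 0)"

definition form :: "'v plumbing_graph \<Rightarrow> ('v \<Rightarrow> rat) \<Rightarrow> ('v \<Rightarrow> rat) \<Rightarrow> rat" where
  "form G x y = (\<Sum>i\<in>verts G. \<Sum>j\<in>verts G. x i * y j * of_int (intersection_number G i j))"

definition negative_definite :: "'v plumbing_graph \<Rightarrow> bool" where
  "negative_definite G \<longleftrightarrow> (\<forall>l\<in>cycle_lattice G. l \<noteq> 0 \<longrightarrow> form G (rat_cycle l) (rat_cycle l) < 0)"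

definition dual_lattice :: "'v plumbing_graph \<Rightarrow> ('v \<Rightarrow> rat) set" where
  "dual_lattice G = {x \<in> rational_cycles G. \<forall>l\<in>cycle_lattice G. form G x (rat_cycle l) \<in> \<int>}"

definition characteristic_elements :: "'v plumbing_graph \<Rightarrow> ('v \<Rightarrow> rat) set" where
  "characteristic_elements G = {k \<in> dual_lattice G. \<forall>l\<in>cycle_lattice G.
     \<exists>n::int. form G k (rat_cycle l) + form G (rat_cycle l) (rat_cycle l) = of_int (2 * n)}"

definition k_can :: "'v plumbing_graph \<Rightarrow> 'v \<Rightarrow> rat" where
  "k_can G = (THE k. k \<in> dual_lattice G \<and>
     (\<forall>j\<in>verts G. form G k (unit_vec j) = - form G (unit_vec j) (unit_vec j) - 2))"

definition chi :: "'v plumbing_graph \<Rightarrow> ('v \<Rightarrow> rat) \<Rightarrow> ('v \<Rightarrow> int) \<Rightarrow> rat" where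
  "chi G k l = - form G (rat_cycle l) (rat_cycle l + k) / 2"

text \<open>The integer valued weight; no rounding takes place for characteristic \<open>k\<close>.\<close>

definition chi_weight :: "'v plumbing_graph \<Rightarrow> ('v \<Rightarrow> rat) \<Rightarrow> ('v \<Rightarrow> int) \<Rightarrow> int" where
  "chi_weight G k l = \<lfloor>chi G k l\<rfloor>"

lemma form_add_right: "form G x (y + z) = form G x y + form G x z"
  by (simp add: form_def distrib_left distrib_right sum.distrib)

lemma form_commute:
  assumes "sym (adj G)"
  shows "form G x y = form G y x"
proof -
  have "intersection_number G i j = intersection_number G j i" for i j
    using assms by (auto simp: intersection_number_def sym_def)
  then show ?thesis
    unfolding form_def by (subst sum.swap) (simp add: mult.commute mult.left_commute)
qed

lemma of_int_chi_weight:
  assumes "plumbing_tree G" "k \<in> characteristic_elements G" "l \<in> cycle_lattice G"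
  shows "of_int (chi_weight G k l) = chi G k l"
proof -
  have "sym (adj G)" using assms(1) by (simp add: plumbing_tree_def)
  moreover obtain n :: int where
    "form G k (rat_cycle l) + form G (rat_cycle l) (rat_cycle l) = of_int (2 * n)"
    using assms(2,3) by (auto simp: characteristic_elements_def)
  ultimately have "chi G k l = of_int (- n)"
    by (simp add: chi_def form_add_right form_commute [of G "rat_cycle l" k])
  then show ?thesis by (simp add: chi_weight_def)
qed


section \<open>Distinguished representatives\<close>

definition anti_nef_cone :: "'v plumbing_graph \<Rightarrow> ('v \<Rightarrow> rat) set" where
  "anti_nef_cone G = {x \<in> dual_lattice G. \<forall>j\<in>verts G. form G x (unit_vec j) \<le> 0}"

definition the_minimal :: "'a::order set \<Rightarrow> 'a" where
  "the_minimal A = (THE x. x \<in> A \<and> (\<forall>y\<in>A. y \<le> x \<longrightarrow> y = x))"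

text \<open>\<open>l_class G k\<close> is $l'_{[k]}$: it is the minimal element of $(l' + L) \cap S'$ where
  $k = k_{can} + 2 l'$.\<close>

definition l_class :: "'v plumbing_graph \<Rightarrow> ('v \<Rightarrow> rat) \<Rightarrow> 'v \<Rightarrow> rat" where
  "l_class G k = (let l' = (\<lambda>v. (k v - k_can G v) / 2) in
     the_minimal ((l' +o rat_cycle ` cycle_lattice G) \<inter> anti_nef_cone G))"

definition dist_rep :: "'v plumbing_graph \<Rightarrow> ('v \<Rightarrow> rat) \<Rightarrow> 'v \<Rightarrow> rat" where
  "dist_rep G k = (\<lambda>v. k_can G v + 2 * l_class G k v)"


section \<open>Bad vertices and the reduced weights\<close>

definition rational_graph :: "'v plumbing_graph \<Rightarrow> bool" where
  "rational_graph G \<longleftrightarrow> plumbing_tree G \<and> negative_definite G \<and>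
     (\<forall>l\<in>cycle_lattice G. 0 < l \<longrightarrow> 0 < chi G (k_can G) l)"

definition bad_vertices :: "'v plumbing_graph \<Rightarrow> 'v set \<Rightarrow> bool" where
  "bad_vertices G B \<longleftrightarrow> B \<subseteq> verts G \<and>
     (\<exists>e'. (\<forall>j\<in>B. e' j \<le> euler G j) \<and> (\<forall>j. j \<notin> B \<longrightarrow> e' j = euler G j) \<and>
           rational_graph (G\<lparr>euler := e'\<rparr>))"

definition x_cycle ::
    "'v plumbing_graph \<Rightarrow> ('v \<Rightarrow> rat) \<Rightarrow> 'v set \<Rightarrow> ('v \<Rightarrow> int) \<Rightarrow> 'v \<Rightarrow> int" where
  "x_cycle G k B i = the_minimal {x \<in> cycle_lattice G.
     (\<forall>j\<in>B. x j = i j) \<and>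
     (\<forall>j\<in>verts G - B. form G (rat_cycle x + l_class G k) (unit_vec j) \<le> 0)}"

definition reduced_weight ::
    "'v plumbing_graph \<Rightarrow> ('v \<Rightarrow> rat) \<Rightarrow> 'v set \<Rightarrow> ('v \<Rightarrow> int) \<Rightarrow> int" where
  "reduced_weight G k B i = chi_weight G (dist_rep G k) (x_cycle G k B i)"

definition HH :: "'v::linorder plumbing_graph \<Rightarrow> ('v \<Rightarrow> rat) \<Rightarrow> nat \<Rightarrow> ('v cube \<Rightarrow> T0) set graded_module" where
  "HH G k = lattice_cohomology (cycle_lattice G) (chi_weight G k)"

definition HH_reduced ::
    "'v::linorder plumbing_graph \<Rightarrow> ('v \<Rightarrow> rat) \<Rightarrow> 'v set \<Rightarrow> nat \<Rightarrow> ('v cube \<Rightarrow> T0) set graded_module" where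
  "HH_reduced G k B = lattice_cohomology (quadrant B) (reduced_weight G k B)"

end

theory Submission
  imports Defs
begin

text \<open>
  The vertices outside \<open>B\<close> are eliminated one at a time. For \<open>A \<supseteq> B\<close> the point \<open>i\<close> of the quadrant of
  \<open>A\<close> gets as weight the minimum of \<open>\<chi>\<close> over all cycles with coordinates \<open>i\<close> on \<open>A\<close>; by Laufer's
  algorithm and rationality it is attained at the cycle \<open>x(i)\<close>. As a function of the coordinate of the
  vertex \<open>v\<close> to be eliminated the weight first decreases and then increases. Hence the projection along
  \<open>v\<close> induces an isomorphism as soon as, for every cube of the base, the sublevel intervals over its
  corners have a common point. This follows by descent from the top corner: over an anti-nef base
  point rationality yields a direction, \<open>v\<close> or one of the cube, in which the weight does not increase
  at that corner, and since \<open>\<chi>\<close> is submodular the same direction is good below it.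

  The passage from the full lattice to the quadrant uses that \<open>l'\<close> is minimal in its class: at every
  lattice point with a negative coordinate, some negative coordinate can be raised without increasing
  the weight.\<close>

section \<open>Weighted cubical cochains\<close>

text \<open>The obstacle is that \<open>U\<close> is not invertible and kills nonzero elements of
  \<open>T0\<close>. Matching cochains of the base with cochains upstairs by powers of
  \<open>U\<close> works only if over every base cube some lift has exactly the weight of that cube:
  there the value reappears without a power of \<open>U\<close>. Along a fibre an equation must be
  solved for the end of larger weight, whose coefficient is \<open>U^0\<close>. This is why the
  weight of each cube, not only of each vertex, has to fall and then rise. The bottom may vary from
  cube to cube, and no compatibility with faces is asked for. Explicit primitives on cochains,
  instead of homotopies of sublevel sets, allow every choice to be homogeneous, so the grading is
  carried along. Rationality enters twice: cycles vanishing on \<open>A\<close> show that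
  \<open>x(i)\<close> attains the minimum, and cycles with coefficients at most 1 on
  \<open>A\<close> give the descent across a cube. The quadrant is entered before any elimination:
  minimality of the class makes \<open>x(i)\<close> nonnegative for nonnegative \<open>i\<close>,
  and the bottoms have to lie over nonnegative coordinates.\<close>

interpretation T0: module T0_smult
  by (rule module_T0)

section \<open>Powers of \<open>U\<close>, signs and degrees on \<open>T0\<close>\<close>

definition U_act :: "nat \<Rightarrow> T0 \<Rightarrow> T0" where
  "U_act n x = T0_smult (monom 1 n) x"

definition sgn_act :: "nat \<Rightarrow> T0 \<Rightarrow> T0" where
  "sgn_act n x = (if even n then x else - x)"

lemma U_act_0 [simp]: "U_act 0 x = x"
  by (simp add: U_act_def monom_0 flip: one_pCons)

lemma U_act_U_act [simp]: "U_act m (U_act n x) = U_act (m + n) x"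
  by (simp add: U_act_def mult_monom)

lemma U_act_zero [simp]: "U_act n 0 = 0"
  by (simp add: U_act_def)

lemma U_act_add: "U_act n (x + y) = U_act n x + U_act n y"
  by (simp add: U_act_def T0.scale_right_distrib)

lemma U_act_minus: "U_act n (- x) = - U_act n x"
  by (simp add: U_act_def)

lemma U_act_diff: "U_act n (x - y) = U_act n x - U_act n y"
  by (simp add: U_act_def T0.scale_right_diff_distrib)

lemma U_act_sum: "U_act n (sum f A) = (\<Sum>a\<in>A. U_act n (f a))"
  by (simp add: U_act_def T0.scale_sum_right)

lemma T0_smult_U_act: "T0_smult p (U_act n x) = U_act n (T0_smult p x)"
  by (simp only: U_act_def T0.scale_scale mult.commute [of p])

lemma sgn_act_zero [simp]: "sgn_act n 0 = 0"
  by (simp add: sgn_act_def)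

lemma sgn_act_eq_0_iff [simp]: "sgn_act n x = 0 \<longleftrightarrow> x = 0"
  by (simp add: sgn_act_def)

lemma sgn_act_sgn_act [simp]: "sgn_act n (sgn_act n x) = x"
  by (simp add: sgn_act_def)

lemma sgn_act_add: "sgn_act n (x + y) = sgn_act n x + sgn_act n y"
  by (simp add: sgn_act_def)

lemma sgn_act_diff: "sgn_act n (x - y) = sgn_act n x - sgn_act n y"
  by (simp add: sgn_act_def)

lemma sgn_act_sum: "sgn_act n (sum f A) = (\<Sum>a\<in>A. sgn_act n (f a))"
  by (simp add: sgn_act_def sum_negf)

lemma U_act_sgn_act: "U_act n (sgn_act m x) = sgn_act m (U_act n x)"
  by (simp add: sgn_act_def U_act_minus)

lemma T0_smult_sgn_act: "T0_smult p (sgn_act m x) = sgn_act m (T0_smult p x)"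
  by (simp add: sgn_act_def)

lemma T0_smult_monom: "T0_smult (monom ((-1) ^ k) n) x = sgn_act k (U_act n x)"
proof -
  have "monom (- 1 :: int) n = - monom 1 n"
    by (simp add: minus_monom)
  then show ?thesis
    by (cases "even k") (simp_all add: sgn_act_def U_act_def)
qed

text \<open>Zero counts as homogeneous in every degree, odd ones included, which makes the elements
  of a given degree a subgroup.\<close>

definition T0_degree :: "int \<Rightarrow> T0 \<Rightarrow> bool" where
  "T0_degree d x \<longleftrightarrow> (x \<noteq> 0 \<longrightarrow> T0_homogeneous d x)"

lemma T0_degree_0 [simp]: "T0_degree d 0"
  by (simp add: T0_degree_def)

lemma T0_homogeneous_add:
  assumes "T0_homogeneous d x" "T0_homogeneous d y"
  shows "T0_homogeneous d (x + y)"
proof -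
  from assms obtain m c c' where "d = 2 * m" "x = abs_T0 (Poly_Mapping.single (- m) c)"
    "y = abs_T0 (Poly_Mapping.single (- m) c')"
    unfolding T0_homogeneous_def by fastforce
  then show ?thesis
    unfolding T0_homogeneous_def
    by (intro exI [of _ m] exI [of _ "c + c'"]) (simp add: plus_T0.abs_eq single_add)
qed

lemma T0_homogeneous_minus: "T0_homogeneous d x \<Longrightarrow> T0_homogeneous d (- x)"
  unfolding T0_homogeneous_def by (metis uminus_T0.abs_eq single_uminus)

lemma laurent_of_poly_monom: "laurent_of_poly (monom 1 n) = Poly_Mapping.single (int n) 1"
  by (rule poly_mapping_eqI) (auto simp: lookup_laurent_of_poly lookup_single when_def)

lemma T0_homogeneous_U_act: "T0_homogeneous d x \<Longrightarrow> T0_homogeneous (d - 2 * int n) (U_act n x)"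
  unfolding T0_homogeneous_def
proof (elim exE conjE)
  fix m c assume "d = 2 * m" "x = abs_T0 (Poly_Mapping.single (- m) c)"
  then show "\<exists>m c. d - 2 * int n = 2 * m \<and> U_act n x = abs_T0 (Poly_Mapping.single (- m) c)"
    by (intro exI [of _ "m - int n"] exI [of _ c])
      (simp add: U_act_def T0_smult.abs_eq laurent_of_poly_monom mult_single)
qed

lemma T0_degree_add: "T0_degree d x \<Longrightarrow> T0_degree d y \<Longrightarrow> T0_degree d (x + y)"
  using T0_homogeneous_add by (cases "x = 0"; cases "y = 0") (auto simp: T0_degree_def)

lemma T0_degree_minus: "T0_degree d x \<Longrightarrow> T0_degree d (- x)"
  by (simp add: T0_degree_def T0_homogeneous_minus)

lemma T0_degree_diff: "T0_degree d x \<Longrightarrow> T0_degree d y \<Longrightarrow> T0_degree d (x - y)"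
  using T0_degree_add [of d x "- y"] by (simp add: T0_degree_minus)

lemma T0_degree_sgn_act: "T0_degree d x \<Longrightarrow> T0_degree d (sgn_act n x)"
  by (simp add: sgn_act_def T0_degree_minus)

lemma T0_degree_sum: "(\<And>a. a \<in> A \<Longrightarrow> T0_degree d (f a)) \<Longrightarrow> T0_degree d (sum f A)"
  by (induction A rule: infinite_finite_induct) (auto simp: T0_degree_add)

lemma T0_degree_U_act: "T0_degree d x \<Longrightarrow> d' = d - 2 * int n \<Longrightarrow> T0_degree d' (U_act n x)"
  using T0_homogeneous_U_act by (cases "x = 0") (auto simp: T0_degree_def)

section \<open>Cubes, their weights and the coboundary\<close>

definition cube_vec :: "'v set \<Rightarrow> 'v \<Rightarrow> int" where
  "cube_vec K = (\<lambda>v. of_bool (v \<in> K))"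

lemma sum_unit_vec: "finite K \<Longrightarrow> (\<Sum>j\<in>K. unit_vec j) = cube_vec K"
proof (induction K rule: finite_induct)
  case (insert a K)
  then show ?case by (auto simp: cube_vec_def unit_vec_def fun_eq_iff)
qed (simp add: cube_vec_def fun_eq_iff)

lemma cube_vertices_eq: "finite I \<Longrightarrow> cube_vertices (l, I) = (\<lambda>K. l + cube_vec K) ` Pow I"
  by (auto simp: cube_vertices_def image_iff sum_unit_vec finite_subset; metis sum_unit_vec finite_subset)

lemma cube_vec_empty [simp]: "cube_vec {} = 0"
  by (simp add: cube_vec_def fun_eq_iff)

lemma cube_vec_insert: "i \<notin> K \<Longrightarrow> cube_vec (insert i K) = unit_vec i + cube_vec K"
  by (auto simp: cube_vec_def unit_vec_def fun_eq_iff)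

lemma cube_vertices_face:
  assumes "finite I" "i \<in> I"
  shows "cube_vertices (l, I) = cube_vertices (l, I - {i}) \<union> cube_vertices (l + unit_vec i, I - {i})"
proof -
  have "Pow I = Pow (I - {i}) \<union> insert i ` Pow (I - {i})"
    using assms Pow_insert [of i "I - {i}"] by (simp add: insert_absorb)
  moreover have "(\<lambda>K. l + cube_vec K) ` insert i ` Pow (I - {i}) =
      (\<lambda>K. (l + unit_vec i) + cube_vec K) ` Pow (I - {i})"
    unfolding image_image
  proof (rule image_cong)
    fix K assume "K \<in> Pow (I - {i})"
    then have "i \<notin> K" by auto
    then show "l + cube_vec (insert i K) = l + unit_vec i + cube_vec K"
      by (simp add: cube_vec_insert add.assoc)
  qed simp
  ultimately show ?thesis
    using assms by (simp add: cube_vertices_eq image_Un)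
qed

lemma finite_cube_vertices: "finite I \<Longrightarrow> finite (cube_vertices (l, I))"
  by (simp add: cube_vertices_eq)

lemma cube_vertices_nonempty: "finite I \<Longrightarrow> cube_vertices (l, I) \<noteq> {}"
  by (auto simp: cube_vertices_eq)

lemma base_in_cube_vertices: "finite I \<Longrightarrow> l \<in> cube_vertices (l, I)"
  by (auto simp: cube_vertices_eq image_iff intro!: bexI [of _ "{}"])

lemma cube_weight_le_iff:
  "finite I \<Longrightarrow> cube_weight w (l, I) \<le> N \<longleftrightarrow> (\<forall>K\<subseteq>I. w (l + cube_vec K) \<le> N)"
  unfolding cube_weight_def cube_vertices_eq by (subst Max_le_iff) auto

lemma cube_weight_ge: "finite I \<Longrightarrow> K \<subseteq> I \<Longrightarrow> w (l + cube_vec K) \<le> cube_weight w (l, I)"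
  using cube_weight_le_iff by blast

lemma cube_weight_face:
  assumes "finite I" "i \<in> I"
  shows "cube_weight w (l, I) =
    max (cube_weight w (l, I - {i})) (cube_weight w (l + unit_vec i, I - {i}))"
  using assms unfolding cube_weight_def cube_vertices_face [OF assms] image_Un
  by (intro Max_Un) (auto simp: finite_cube_vertices cube_vertices_nonempty)

lemma cubes_face:
  assumes "(l, I) \<in> cubes P (Suc q)" "i \<in> I"
  shows "(l, I - {i}) \<in> cubes P q" "(l + unit_vec i, I - {i}) \<in> cubes P q"
  using assms cube_vertices_face [of I i l] by (auto simp: cubes_def)

text \<open>The power of \<open>U\<close> with which the value on a face \<open>c'\<close> enters
  the coboundary on \<open>c\<close>. Truncation by \<open>nat\<close> is harmless when
  \<open>c'\<close> weighs no more than \<open>c\<close>.\<close>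

definition transport :: "(('v \<Rightarrow> int) \<Rightarrow> int) \<Rightarrow> 'v cube \<Rightarrow> 'v cube \<Rightarrow> T0 \<Rightarrow> T0" where
  "transport w c c' x = U_act (nat (cube_weight w c - cube_weight w c')) x"

definition face_index :: "'v::linorder set \<Rightarrow> 'v \<Rightarrow> nat" where
  "face_index I i = card {j \<in> I. j < i}"

text \<open>The contribution of the two opposite faces in direction \<open>i\<close>, still without
  its sign.\<close>

definition face_diff :: "(('v \<Rightarrow> int) \<Rightarrow> int) \<Rightarrow> ('v cube \<Rightarrow> T0) \<Rightarrow> 'v cube \<Rightarrow> 'v \<Rightarrow> T0" where
  "face_diff w \<phi> c i = (case c of (l, I) \<Rightarrow>
     transport w c (l + unit_vec i, I - {i}) (\<phi> (l + unit_vec i, I - {i})) -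
     transport w c (l, I - {i}) (\<phi> (l, I - {i})))"

lemma coboundary_eq:
  assumes "(l, I) \<in> cubes P (Suc q)"
  shows "coboundary P w q \<phi> (l, I) = (\<Sum>i\<in>I. sgn_act (face_index I i) (face_diff w \<phi> (l, I) i))"
proof -
  let ?n = "\<lambda>c'. nat (cube_weight w (l, I) - cube_weight w c')"
  \<comment> \<open>\<open>ev\<close> extends the formula for the coboundary additively to all
    chains. Additivity turns the sum over the support of the boundary into a sum over directions,
    without any check that the faces are distinct.\<close>
  define ev where "ev x = (\<Sum>c'\<in>Poly_Mapping.keys x.
    T0_smult (monom (Poly_Mapping.lookup x c') (?n c')) (\<phi> c'))" for x :: "'a cube \<Rightarrow>\<^sub>0 int"
  have ev_superset: "ev x = (\<Sum>c'\<in>S. T0_smult (monom (Poly_Mapping.lookup x c') (?n c')) (\<phi> c'))"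
    if "finite S" "Poly_Mapping.keys x \<subseteq> S" for x S
    unfolding ev_def using that by (intro sum.mono_neutral_left) (auto simp: in_keys_iff)
  have ev_add: "ev (x + y) = ev x + ev y" for x y
    using keys_add [of x y]
    by (simp add: ev_superset [of "Poly_Mapping.keys x \<union> Poly_Mapping.keys y"]
        lookup_add add_monom [symmetric] T0.scale_left_distrib sum.distrib)
  have ev_0: "ev 0 = 0" by (simp add: ev_def)
  have ev_sum: "ev (sum f A) = (\<Sum>a\<in>A. ev (f a))" for f and A :: "'a set"
    by (induction A rule: infinite_finite_induct) (auto simp: ev_0 ev_add)
  have ev_single: "ev (Poly_Mapping.single c a) = T0_smult (monom a (?n c)) (\<phi> c)" for c a
    by (cases "a = 0") (auto simp: ev_def)
  have cmul: "frag_cmul a (frag_of c - frag_of c') =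
      Poly_Mapping.single c a + Poly_Mapping.single c' (- a)" for a and c c' :: "'a cube"
    by (rule poly_mapping_eqI) (auto simp: lookup_add lookup_minus lookup_single when_def)
  have neg: "T0_smult (monom (- a) n) x = - T0_smult (monom a n) x" for a n x
    by (simp flip: minus_monom)
  have "coboundary P w q \<phi> (l, I) = ev (cube_boundary (l, I))"
    using assms by (simp add: coboundary_def ev_def)
  also have "\<dots> = (\<Sum>i\<in>I. sgn_act (face_index I i) (face_diff w \<phi> (l, I) i))"
    unfolding cube_boundary_def prod.case ev_sum
    by (intro sum.cong refl)
      (simp add: cmul ev_add ev_single T0_smult_monom neg face_diff_def transport_def
        face_index_def sgn_act_diff)
  finally show ?thesis .
qed

lemma coboundary_outside: "c \<notin> cubes P (Suc q) \<Longrightarrow> coboundary P w q \<phi> c = 0"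
  by (simp add: coboundary_def)

lemma coboundary_in_cochains: "coboundary P w q \<phi> \<in> cochains P (Suc q)"
  by (simp add: cochains_def coboundary_outside)

lemma transport_zero [simp]: "transport w c c' 0 = 0"
  by (simp add: transport_def)

lemma face_diff_add: "face_diff w (\<phi> + \<psi>) c i = face_diff w \<phi> c i + face_diff w \<psi> c i"
  by (cases c) (simp add: face_diff_def transport_def U_act_add)

lemma face_diff_smult: "face_diff w (cochain_smult p \<phi>) c i = T0_smult p (face_diff w \<phi> c i)"
  by (cases c)
    (simp add: face_diff_def transport_def cochain_smult_def T0_smult_U_act T0.scale_right_diff_distrib)

lemma coboundary_add: "coboundary P w q (\<phi> + \<psi>) = coboundary P w q \<phi> + coboundary P w q \<psi>"
proof
  fix c :: "'a cube"
  show "coboundary P w q (\<phi> + \<psi>) c = (coboundary P w q \<phi> + coboundary P w q \<psi>) c"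
    by (cases c; cases "c \<in> cubes P (Suc q)")
      (auto simp: coboundary_eq coboundary_outside face_diff_add sgn_act_add sum.distrib)
qed

lemma coboundary_diff: "coboundary P w q (\<phi> - \<psi>) = coboundary P w q \<phi> - coboundary P w q \<psi>"
  using coboundary_add [of P w q "\<phi> - \<psi>" \<psi>] by simp

lemma coboundary_smult:
  "coboundary P w q (cochain_smult p \<phi>) = cochain_smult p (coboundary P w q \<phi>)"
proof
  fix c :: "'a cube"
  show "coboundary P w q (cochain_smult p \<phi>) c = cochain_smult p (coboundary P w q \<phi>) c"
    by (cases c; cases "c \<in> cubes P (Suc q)")
      (auto simp: coboundary_eq coboundary_outside face_diff_smult cochain_smult_def [of p "coboundary _ _ _ _"]
        T0_smult_sgn_act T0.scale_sum_right)
qed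

lemma coboundary_zero: "coboundary P w q 0 = 0"
  using coboundary_diff [of P w q 0 0] by simp

text \<open>Enlarging the index set by \<open>x\<close> adds exactly the pairs
  \<open>g x j + g j x\<close>. Applied to faces of codimension two, which are reached in two orders
  with opposite signs, this makes the coboundary square to zero.\<close>

lemma antisymmetric_double_sum:
  fixes g :: "'b \<Rightarrow> 'b \<Rightarrow> 'a::ab_group_add"
  assumes "finite I" "\<And>i j. i \<in> I \<Longrightarrow> j \<in> I \<Longrightarrow> i \<noteq> j \<Longrightarrow> g i j + g j i = 0"
  shows "(\<Sum>i\<in>I. \<Sum>j\<in>I - {i}. g i j) = 0"
  using assms
proof (induction I rule: finite_induct)
  case (insert x I)
  have "(\<Sum>j\<in>insert x I - {i}. g i j) = g i x + (\<Sum>j\<in>I - {i}. g i j)" if "i \<in> I" for i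
  proof -
    have "insert x I - {i} = insert x (I - {i})" using that insert.hyps by auto
    then show ?thesis using insert.hyps by simp
  qed
  moreover have "insert x I - {x} = I" using insert.hyps by auto
  ultimately have "(\<Sum>i\<in>insert x I. \<Sum>j\<in>insert x I - {i}. g i j)
      = (\<Sum>j\<in>I. g x j + g j x) + (\<Sum>i\<in>I. \<Sum>j\<in>I - {i}. g i j)"
    using insert.hyps by (simp add: sum.distrib add.assoc)
  also have "(\<Sum>j\<in>I. g x j + g j x) = 0"
    using insert.prems insert.hyps by (intro sum.neutral ballI) auto
  finally show ?case using insert.IH insert.prems by auto
qed simp

text \<open>Deleting the smaller of two directions lowers the rank of the larger by one, while
  deleting the larger leaves the rank of the smaller alone.\<close>

lemma even_face_index_swap:
  assumes "finite I" "i \<in> I" "j \<in> I" "i \<noteq> j"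
  shows "even (face_index I i + face_index (I - {i}) j) \<longleftrightarrow>
    odd (face_index I j + face_index (I - {j}) i)"
proof -
  have *: "even (face_index I i + face_index (I - {i}) j) \<longleftrightarrow>
    odd (face_index I j + face_index (I - {j}) i)" if "i < j" "i \<in> I" "j \<in> I" for i j
  proof -
    have "{k \<in> I. k < j} = insert i {k \<in> I - {i}. k < j}" using that by auto
    then have "face_index I j = Suc (face_index (I - {i}) j)"
      unfolding face_index_def using assms(1) by simp
    moreover have "{k \<in> I - {j}. k < i} = {k \<in> I. k < i}" using that by auto
    then have "face_index (I - {j}) i = face_index I i"
      by (simp only: face_index_def)
    ultimately show ?thesis by auto
  qed
  show ?thesis
    using *[of i j] *[of j i] assms by (cases i j rule: linorder_cases) auto
qed

lemma transport_transport:
  assumes "cube_weight w c'' \<le> cube_weight w c'" "cube_weight w c' \<le> cube_weight w c"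
  shows "transport w c c' (transport w c' c'' x) = transport w c c'' x"
  using assms by (simp add: transport_def nat_add_distrib [symmetric])

lemma transport_diff: "transport w c c' (x - y) = transport w c c' x - transport w c c' y"
  by (simp add: transport_def U_act_diff)

lemma transport_sgn_act: "transport w c c' (sgn_act n x) = sgn_act n (transport w c c' x)"
  by (simp add: transport_def U_act_sgn_act)

lemma transport_sum: "transport w c c' (sum f A) = (\<Sum>a\<in>A. transport w c c' (f a))"
  by (simp add: transport_def U_act_sum)

lemma coboundary_coboundary: "coboundary P w (Suc q) (coboundary P w q \<phi>) = 0"
proof
  fix c :: "'a cube"
  obtain l I where c: "c = (l, I)" by force
  show "coboundary P w (Suc q) (coboundary P w q \<phi>) c = 0 c"
  proof (cases "c \<in> cubes P (Suc (Suc q))")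
    case False
    then show ?thesis by (simp add: coboundary_outside)
  next
    case True
    then have fin: "finite I" and cube: "(l, I) \<in> cubes P (Suc (Suc q))"
      by (auto simp: c cubes_def)
    \<comment> \<open>\<open>X a i b j\<close> is the value on a face of codimension two,
      transported to \<open>c\<close>; \<open>?u\<close> and \<open>?o\<close> select the front and
      the back side. The mixed difference \<open>D\<close> is symmetric, so the antisymmetry of
      \<open>g\<close> comes from the signs alone.\<close>
    define X where "X a i b j = transport w c (l + a i + b j, I - {i, j}) (\<phi> (l + a i + b j, I - {i, j}))"
      for a b :: "'a \<Rightarrow> 'a \<Rightarrow> int" and i j
    let ?u = "unit_vec :: 'a \<Rightarrow> 'a \<Rightarrow> int" and ?o = "\<lambda>_::'a. 0 :: 'a \<Rightarrow> int"
    define D where "D i j = (X ?u i ?u j - X ?u i ?o j) - (X ?o i ?u j - X ?o i ?o j)" for i j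
    define g where "g i j = sgn_act (face_index I i) (sgn_act (face_index (I - {i}) j) (D i j))" for i j
    have X_commute: "X a i b j = X b j a i" for a b i j
      by (simp add: X_def add.assoc add.commute [of "a i"] insert_commute)
    have D_commute: "D i j = D j i" for i j
      by (simp add: D_def X_commute [of ?u i] X_commute [of ?o i])
    have *: "transport w c (l', I - {i}) (coboundary P w q \<phi> (l', I - {i})) =
        (\<Sum>j\<in>I - {i}. sgn_act (face_index (I - {i}) j)
          (transport w c (l' + unit_vec j, I - {i, j}) (\<phi> (l' + unit_vec j, I - {i, j})) -
           transport w c (l', I - {i, j}) (\<phi> (l', I - {i, j}))))"
      if "(l', I - {i}) \<in> cubes P (Suc q)" "cube_weight w (l', I - {i}) \<le> cube_weight w c" for l' i
    proof -
      have [simp]: "I - {i} - {j} = I - {i, j}" for j by auto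
      have "cube_weight w (l', I - {i, j}) \<le> cube_weight w (l', I - {i})"
        "cube_weight w (l' + unit_vec j, I - {i, j}) \<le> cube_weight w (l', I - {i})" if "j \<in> I - {i}" for j
        using cube_weight_face [of "I - {i}" j w l'] fin that by auto
      then show ?thesis
        using that by (auto simp: coboundary_eq face_diff_def transport_sum transport_sgn_act
            transport_diff transport_transport intro!: sum.cong)
    qed
    have "coboundary P w (Suc q) (coboundary P w q \<phi>) c = (\<Sum>i\<in>I. \<Sum>j\<in>I - {i}. g i j)"
      unfolding c coboundary_eq [OF cube]
    proof (rule sum.cong)
      fix i assume i: "i \<in> I"
      have "cube_weight w (l, I - {i}) \<le> cube_weight w c"
        "cube_weight w (l + unit_vec i, I - {i}) \<le> cube_weight w c"
        using cube_weight_face [of I i w l] fin i by (auto simp: c)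
      moreover have "face_diff w (coboundary P w q \<phi>) (l, I) i =
          transport w c (l + unit_vec i, I - {i}) (coboundary P w q \<phi> (l + unit_vec i, I - {i})) -
          transport w c (l, I - {i}) (coboundary P w q \<phi> (l, I - {i}))"
        by (simp add: face_diff_def c)
      ultimately show "sgn_act (face_index I i) (face_diff w (coboundary P w q \<phi>) (l, I) i) = (\<Sum>j\<in>I - {i}. g i j)"
        using * [of l i] * [of "l + unit_vec i" i] cubes_face [OF cube i]
        by (simp add: g_def sgn_act_sum [symmetric] D_def X_def
            sgn_act_diff [symmetric] sum_subtractf [symmetric])
    qed simp
    also have "\<dots> = 0"
    proof (rule antisymmetric_double_sum [OF fin])
      fix i j assume "i \<in> I" "j \<in> I" "i \<noteq> j"
      then show "g i j + g j i = 0"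
        using even_face_index_swap [OF fin, of i j] D_commute [of i j]
        by (auto simp: g_def sgn_act_def)
    qed
    finally show ?thesis by simp
  qed
qed

section \<open>Cohomology classes and isomorphisms\<close>

lemma coboundaries_zero: "0 \<in> coboundaries P w q"
proof (cases q)
  case (Suc r)
  have "0 \<in> cochains P r" by (simp add: cochains_def)
  then show ?thesis
    unfolding Suc coboundaries_def nat.case by (metis coboundary_zero image_eqI)
qed (simp add: coboundaries_def)

lemma coboundaries_diff:
  assumes "\<phi> \<in> coboundaries P w q" "\<psi> \<in> coboundaries P w q"
  shows "\<phi> - \<psi> \<in> coboundaries P w q"
proof (cases q)
  case (Suc r)
  then obtain a b where "a \<in> cochains P r" "b \<in> cochains P r"
    "\<phi> = coboundary P w r a" "\<psi> = coboundary P w r b"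
    using assms by (auto simp: coboundaries_def)
  moreover from this have "a - b \<in> cochains P r" by (simp add: cochains_def)
  ultimately show ?thesis
    by (simp add: Suc coboundaries_def coboundary_diff [symmetric])
qed (use assms in \<open>simp add: coboundaries_def\<close>)

lemma coboundaries_add:
  assumes "\<phi> \<in> coboundaries P w q" "\<psi> \<in> coboundaries P w q"
  shows "\<phi> + \<psi> \<in> coboundaries P w q"
proof -
  have "\<phi> - (0 - \<psi>) \<in> coboundaries P w q"
    by (intro coboundaries_diff coboundaries_zero assms)
  then show ?thesis by simp
qed

lemma cochain_smult_zero: "cochain_smult p 0 = 0"
  by (simp add: cochain_smult_def fun_eq_iff)

lemma cochain_smult_add: "cochain_smult p (\<phi> + \<psi>) = cochain_smult p \<phi> + cochain_smult p \<psi>"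
  by (simp add: cochain_smult_def fun_eq_iff T0.scale_right_distrib)

lemma cochains_smult: "\<phi> \<in> cochains P q \<Longrightarrow> cochain_smult p \<phi> \<in> cochains P q"
  by (simp add: cochains_def cochain_smult_def)

lemma coboundaries_smult:
  assumes "\<phi> \<in> coboundaries P w q"
  shows "cochain_smult p \<phi> \<in> coboundaries P w q"
proof (cases q)
  case (Suc r)
  then obtain a where "a \<in> cochains P r" "\<phi> = coboundary P w r a"
    using assms by (auto simp: coboundaries_def)
  then show ?thesis
    by (simp add: Suc coboundaries_def coboundary_smult [symmetric] cochains_smult)
qed (use assms in \<open>simp add: coboundaries_def cochain_smult_zero\<close>)

lemma coboundaries_subset_cocycles: "coboundaries P w q \<subseteq> cocycles P w q"
proof (cases q)
  case 0
  then show ?thesis by (simp add: coboundaries_def cocycles_def coboundary_zero cochains_def)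
next
  case (Suc r)
  then show ?thesis
    by (auto simp: coboundaries_def cocycles_def coboundary_coboundary coboundary_in_cochains)
qed

lemma cocycles_add: "\<phi> \<in> cocycles P w q \<Longrightarrow> \<psi> \<in> cocycles P w q \<Longrightarrow> \<phi> + \<psi> \<in> cocycles P w q"
  by (simp add: cocycles_def coboundary_add cochains_def)

lemma cocycles_diff: "\<phi> \<in> cocycles P w q \<Longrightarrow> \<psi> \<in> cocycles P w q \<Longrightarrow> \<phi> - \<psi> \<in> cocycles P w q"
  by (simp add: cocycles_def coboundary_diff cochains_def)

lemma cocycles_smult: "\<phi> \<in> cocycles P w q \<Longrightarrow> cochain_smult p \<phi> \<in> cocycles P w q"
  by (simp add: cocycles_def coboundary_smult cochains_smult cochain_smult_zero)

lemma coset_eq_iff: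
  "\<phi> +o coboundaries P w q = \<psi> +o coboundaries P w q \<longleftrightarrow> \<phi> - \<psi> \<in> coboundaries P w q"
proof
  assume "\<phi> +o coboundaries P w q = \<psi> +o coboundaries P w q"
  then have "\<phi> + 0 \<in> \<psi> +o coboundaries P w q"
    using coboundaries_zero by (metis set_plus_intro2)
  then show "\<phi> - \<psi> \<in> coboundaries P w q"
    by (auto simp: elt_set_plus_def)
next
  assume *: "\<phi> - \<psi> \<in> coboundaries P w q"
  have "\<exists>b\<in>coboundaries P w q. \<phi> + a = \<psi> + b" if "a \<in> coboundaries P w q" for a
    using coboundaries_add [OF * that] by (intro bexI [of _ "\<phi> - \<psi> + a"]) (auto simp: algebra_simps)
  moreover have "\<exists>b\<in>coboundaries P w q. \<psi> + a = \<phi> + b" if "a \<in> coboundaries P w q" for a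
    using coboundaries_diff [OF that *] by (intro bexI [of _ "a - (\<phi> - \<psi>)"]) (auto simp: algebra_simps)
  ultimately show "\<phi> +o coboundaries P w q = \<psi> +o coboundaries P w q"
    by (auto simp: elt_set_plus_def)
qed

lemma coset_add:
  "(\<phi> +o coboundaries P w q) + (\<psi> +o coboundaries P w q) = (\<phi> + \<psi>) +o coboundaries P w q"
proof -
  have "coboundaries P w q + coboundaries P w q = coboundaries P w q"
  proof (intro equalityI subsetI)
    fix x assume "x \<in> coboundaries P w q"
    then have "0 + x \<in> coboundaries P w q + coboundaries P w q"
      by (intro set_plus_intro coboundaries_zero)
    then show "x \<in> coboundaries P w q + coboundaries P w q" by simp
  qed (auto elim!: set_plus_elim intro: coboundaries_add)
  then show ?thesis
    by (simp add: set_plus_rearrange)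
qed

text \<open>The image of a coset need not be a whole coset, which is why the coboundaries are added.\<close>

lemma image_coset:
  assumes "\<And>\<phi> \<psi>. h (\<phi> + \<psi>) = h \<phi> + h \<psi>" "h ` coboundaries P w q \<subseteq> coboundaries P' w' q"
  shows "h ` (\<phi> +o coboundaries P w q) + coboundaries P' w' q = h \<phi> +o coboundaries P' w' q"
proof (intro equalityI subsetI)
  fix x assume "x \<in> h ` (\<phi> +o coboundaries P w q) + coboundaries P' w' q"
  then obtain a b where "a \<in> coboundaries P w q" "b \<in> coboundaries P' w' q" "x = h \<phi> + h a + b"
    by (auto simp: set_plus_def elt_set_plus_def assms(1))
  moreover from this have "h a + b \<in> coboundaries P' w' q"
    using assms(2) coboundaries_add by blast
  ultimately show "x \<in> h \<phi> +o coboundaries P' w' q"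
    by (auto simp: elt_set_plus_def add.assoc)
next
  fix x assume "x \<in> h \<phi> +o coboundaries P' w' q"
  moreover have "h (\<phi> + 0) \<in> h ` (\<phi> +o coboundaries P w q)"
    using coboundaries_zero by (intro imageI set_plus_intro2)
  moreover from \<open>x \<in> h \<phi> +o _\<close> obtain b where "b \<in> coboundaries P' w' q" "x = h (\<phi> + 0) + b"
    by (auto simp: elt_set_plus_def)
  ultimately show "x \<in> h ` (\<phi> +o coboundaries P w q) + coboundaries P' w' q"
    by (metis set_plus_intro)
qed

lemma coset_smult:
  "cochain_smult p ` (\<phi> +o coboundaries P w q) + coboundaries P w q =
    cochain_smult p \<phi> +o coboundaries P w q"
  by (rule image_coset) (auto simp: cochain_smult_add coboundaries_smult)

lemma lattice_cohomology_simps: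
  "gm_carrier (lattice_cohomology P w q) = (\<lambda>\<phi>. \<phi> +o coboundaries P w q) ` cocycles P w q"
  "gm_add (lattice_cohomology P w q) = (+)"
  "gm_smult (lattice_cohomology P w q) = (\<lambda>p X. cochain_smult p ` X + coboundaries P w q)"
  "gm_degree (lattice_cohomology P w q) d =
    (\<lambda>\<phi>. \<phi> +o coboundaries P w q) ` (cocycles P w q \<inter> homogeneous_cochains P w q d)"
  by (simp_all add: lattice_cohomology_def Let_def)

text \<open>A class has degree \<open>d\<close> as soon as one representative does. Hence the
  preimage in \<open>surj\<close> must be homogeneous in each degree in which the given cocycle is;
  a mere bijection of classes would not match the graded pieces.\<close>

lemma lattice_cohomology_isoI:
  assumes add: "\<And>\<phi> \<psi>. h (\<phi> + \<psi>) = h \<phi> + h \<psi>"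
    and smult: "\<And>p \<phi>. h (cochain_smult p \<phi>) = cochain_smult p (h \<phi>)"
    and cocycle: "\<And>\<phi>. \<phi> \<in> cocycles P w q \<Longrightarrow> h \<phi> \<in> cocycles P' w' q"
    and coboundary: "\<And>\<phi>. \<phi> \<in> cocycles P w q \<Longrightarrow>
      h \<phi> \<in> coboundaries P' w' q \<longleftrightarrow> \<phi> \<in> coboundaries P w q"
    and degree: "\<And>\<phi> d. \<phi> \<in> homogeneous_cochains P w q d \<Longrightarrow> h \<phi> \<in> homogeneous_cochains P' w' q d"
    and surj: "\<And>\<Phi>. \<Phi> \<in> cocycles P' w' q \<Longrightarrow> \<exists>\<phi>\<in>cocycles P w q. \<Phi> - h \<phi> \<in> coboundaries P' w' q \<and>
      (\<forall>d. \<Phi> \<in> homogeneous_cochains P' w' q d \<longrightarrow> \<phi> \<in> homogeneous_cochains P w q d)"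
  shows "graded_module_iso (lattice_cohomology P w q) (lattice_cohomology P' w' q)"
proof -
  let ?B = "coboundaries P w q" and ?B' = "coboundaries P' w' q"
  have im: "h ` ?B \<subseteq> ?B'"
    using coboundary coboundaries_subset_cocycles by blast
  have diff: "h (\<phi> - \<psi>) = h \<phi> - h \<psi>" for \<phi> \<psi>
    using add [of "\<phi> - \<psi>" \<psi>] by (simp add: algebra_simps)
  define f where "f X = h ` X + ?B'" for X
  have f: "f (\<phi> +o ?B) = h \<phi> +o ?B'" for \<phi>
    unfolding f_def by (rule image_coset [OF add im])
  have "inj_on f ((\<lambda>\<phi>. \<phi> +o ?B) ` cocycles P w q)"
  proof (rule inj_onI, elim imageE)
    fix X Y \<phi> \<psi>
    assume "f X = f Y" "X = \<phi> +o ?B" "Y = \<psi> +o ?B" "\<phi> \<in> cocycles P w q" "\<psi> \<in> cocycles P w q"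
    then show "X = Y"
      using coboundary [OF cocycles_diff] by (simp add: f coset_eq_iff diff)
  qed
  moreover have "f ` (\<lambda>\<phi>. \<phi> +o ?B) ` cocycles P w q = (\<lambda>\<phi>. \<phi> +o ?B') ` cocycles P' w' q"
    unfolding image_image f
  proof (intro equalityI image_subsetI)
    fix \<phi> assume "\<phi> \<in> cocycles P w q"
    then show "h \<phi> +o ?B' \<in> (\<lambda>\<phi>. \<phi> +o ?B') ` cocycles P' w' q"
      using cocycle by blast
  next
    fix \<Phi> assume "\<Phi> \<in> cocycles P' w' q"
    with surj obtain \<phi> where "\<phi> \<in> cocycles P w q" "\<Phi> - h \<phi> \<in> ?B'"
      by blast
    then show "\<Phi> +o ?B' \<in> (\<lambda>\<phi>. h \<phi> +o ?B') ` cocycles P w q"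
      by (intro image_eqI [of _ _ \<phi>]) (auto simp: coset_eq_iff)
  qed
  moreover have "f ` (\<lambda>\<phi>. \<phi> +o ?B) ` (cocycles P w q \<inter> homogeneous_cochains P w q d) =
      (\<lambda>\<phi>. \<phi> +o ?B') ` (cocycles P' w' q \<inter> homogeneous_cochains P' w' q d)" for d
    unfolding image_image f
  proof (intro equalityI image_subsetI)
    fix \<phi> assume "\<phi> \<in> cocycles P w q \<inter> homogeneous_cochains P w q d"
    then show "h \<phi> +o ?B' \<in> (\<lambda>\<phi>. \<phi> +o ?B') ` (cocycles P' w' q \<inter> homogeneous_cochains P' w' q d)"
      using cocycle degree by blast
  next
    fix \<Phi> assume "\<Phi> \<in> cocycles P' w' q \<inter> homogeneous_cochains P' w' q d"
    with surj obtain \<phi> where "\<phi> \<in> cocycles P w q \<inter> homogeneous_cochains P w q d" "\<Phi> - h \<phi> \<in> ?B'"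
      by blast
    then show "\<Phi> +o ?B' \<in> (\<lambda>\<phi>. h \<phi> +o ?B') ` (cocycles P w q \<inter> homogeneous_cochains P w q d)"
      by (intro image_eqI [of _ _ \<phi>]) (auto simp: coset_eq_iff)
  qed
  ultimately show ?thesis
    unfolding graded_module_iso_def
    by (intro exI [of _ f])
      (auto simp: lattice_cohomology_simps bij_betw_def f coset_add coset_smult add smult)
qed

lemma graded_module_iso_trans:
  assumes "graded_module_iso L M" "graded_module_iso M N"
  shows "graded_module_iso L N"
proof -
  from assms obtain f g where f: "bij_betw f (gm_carrier L) (gm_carrier M)"
      "\<And>x y. x \<in> gm_carrier L \<Longrightarrow> y \<in> gm_carrier L \<Longrightarrow> f (gm_add L x y) = gm_add M (f x) (f y)"
      "\<And>p x. x \<in> gm_carrier L \<Longrightarrow> f (gm_smult L p x) = gm_smult M p (f x)"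
      "\<And>d. f ` gm_degree L d = gm_degree M d"
    and g: "bij_betw g (gm_carrier M) (gm_carrier N)"
      "\<And>x y. x \<in> gm_carrier M \<Longrightarrow> y \<in> gm_carrier M \<Longrightarrow> g (gm_add M x y) = gm_add N (g x) (g y)"
      "\<And>p x. x \<in> gm_carrier M \<Longrightarrow> g (gm_smult M p x) = gm_smult N p (g x)"
      "\<And>d. g ` gm_degree M d = gm_degree N d"
    unfolding graded_module_iso_def by metis
  have "f x \<in> gm_carrier M" if "x \<in> gm_carrier L" for x
    using f(1) that by (auto simp: bij_betw_def)
  moreover have "(g \<circ> f) ` gm_degree L d = gm_degree N d" for d
    by (simp only: image_comp [symmetric] f(4) g(4))
  ultimately show ?thesis
    unfolding graded_module_iso_def using f(1-3) g(1-3)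
    by (intro exI [of _ "g \<circ> f"]) (simp add: bij_betw_trans [OF f(1) g(1)])
qed

text \<open>The record of a graded module does not demand closure under its operations. Inverting an
  isomorphism needs closure of the source, which holds for cosets of cocycles.\<close>

lemma lattice_cohomology_iso_sym:
  assumes "graded_module_iso (lattice_cohomology P w q) N"
  shows "graded_module_iso N (lattice_cohomology P w q)"
proof -
  let ?M = "lattice_cohomology P w q"
  from assms obtain f where f: "bij_betw f (gm_carrier ?M) (gm_carrier N)"
      "\<And>x y. x \<in> gm_carrier ?M \<Longrightarrow> y \<in> gm_carrier ?M \<Longrightarrow> f (gm_add ?M x y) = gm_add N (f x) (f y)"
      "\<And>p x. x \<in> gm_carrier ?M \<Longrightarrow> f (gm_smult ?M p x) = gm_smult N p (f x)"
      "\<And>d. f ` gm_degree ?M d = gm_degree N d"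
    unfolding graded_module_iso_def by metis
  let ?g = "inv_into (gm_carrier ?M) f"
  have gf: "?g (f x) = x" if "x \<in> gm_carrier ?M" for x
    using f(1) that by (auto simp: bij_betw_def)
  have g: "?g y \<in> gm_carrier ?M" "f (?g y) = y" if "y \<in> gm_carrier N" for y
    using f(1) that by (auto simp: bij_betw_def inv_into_into f_inv_into_f)
  have add: "gm_add ?M x y \<in> gm_carrier ?M" if "x \<in> gm_carrier ?M" "y \<in> gm_carrier ?M" for x y
    using that by (auto simp: lattice_cohomology_simps coset_add intro: cocycles_add imageI)
  have smult: "gm_smult ?M p x \<in> gm_carrier ?M" if "x \<in> gm_carrier ?M" for p x
    using that by (auto simp: lattice_cohomology_simps coset_smult intro: cocycles_smult imageI)
  have deg: "gm_degree ?M d \<subseteq> gm_carrier ?M" for d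
    by (auto simp: lattice_cohomology_simps)
  show ?thesis
    unfolding graded_module_iso_def
  proof (intro exI [of _ ?g] conjI ballI allI)
    show "bij_betw ?g (gm_carrier N) (gm_carrier ?M)"
      using f(1) by (rule bij_betw_inv_into)
    show "?g (gm_add N x y) = gm_add ?M (?g x) (?g y)" if "x \<in> gm_carrier N" "y \<in> gm_carrier N" for x y
      using f(2) [of "?g x" "?g y"] gf [of "gm_add ?M (?g x) (?g y)"] g that add by simp
    show "?g (gm_smult N p x) = gm_smult ?M p (?g x)" if "x \<in> gm_carrier N" for p x
      using f(3) [of "?g x" p] gf [of "gm_smult ?M p (?g x)"] g that smult by simp
    show "?g ` gm_degree N d = gm_degree ?M d" for d
    proof -
      have "?g ` gm_degree N d = (\<lambda>x. ?g (f x)) ` gm_degree ?M d"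
        by (simp only: f(4) [symmetric] image_image)
      also have "\<dots> = (\<lambda>x. x) ` gm_degree ?M d"
        using deg [of d] by (intro image_cong refl gf) auto
      finally show ?thesis by simp
    qed
  qed
qed

section \<open>Compatibility with the grading\<close>

lemma homogeneous_cochains_iff:
  "\<phi> \<in> homogeneous_cochains P w q d \<longleftrightarrow>
    \<phi> \<in> cochains P q \<and> (\<forall>c. T0_degree (d - 2 * cube_weight w c) (\<phi> c))"
  by (auto simp: homogeneous_cochains_def T0_degree_def cochains_def)

text \<open>\<open>U\<close> lowers the degree by 2, which compensates the change of the shift by
  twice the weight. This is why the coboundary preserves degrees.\<close>

lemma T0_degree_transport:
  assumes "T0_degree (d - 2 * cube_weight w c') x" "cube_weight w c' \<le> cube_weight w c"
  shows "T0_degree (d - 2 * cube_weight w c) (transport w c c' x)"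
  unfolding transport_def using assms(1) by (rule T0_degree_U_act) (use assms(2) in simp)

lemma T0_degree_face_diff:
  assumes "finite I" "i \<in> I" "\<And>c. T0_degree (d - 2 * cube_weight w c) (\<phi> c)"
  shows "T0_degree (d - 2 * cube_weight w (l, I)) (face_diff w \<phi> (l, I) i)"
proof -
  have "cube_weight w (l, I - {i}) \<le> cube_weight w (l, I)"
    "cube_weight w (l + unit_vec i, I - {i}) \<le> cube_weight w (l, I)"
    using cube_weight_face [OF assms(1,2), of w l] by auto
  then show ?thesis
    unfolding face_diff_def prod.case by (intro T0_degree_diff T0_degree_transport assms(3))
qed

lemma T0_degree_coboundary:
  assumes "\<And>c. T0_degree (d - 2 * cube_weight w c) (\<phi> c)"
  shows "T0_degree (d - 2 * cube_weight w c) (coboundary P w q \<phi> c)"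
proof (cases "c \<in> cubes P (Suc q)")
  case True
  then obtain l I where "c = (l, I)" "finite I" by (auto simp: cubes_def)
  with True show ?thesis
    by (auto simp: coboundary_eq intro!: T0_degree_sum T0_degree_sgn_act T0_degree_face_diff assms)
qed (simp add: coboundary_outside)

lemma homogeneous_cochains_diff:
  assumes "\<phi> \<in> homogeneous_cochains P w q d" "\<psi> \<in> homogeneous_cochains P w q d"
  shows "\<phi> - \<psi> \<in> homogeneous_cochains P w q d"
  using assms by (auto simp: homogeneous_cochains_iff T0_degree_diff cochains_def)

lemma homogeneous_cochains_coboundary:
  "\<phi> \<in> homogeneous_cochains P w q d \<Longrightarrow> coboundary P w q \<phi> \<in> homogeneous_cochains P w (Suc q) d"
  unfolding homogeneous_cochains_iff by (blast intro: T0_degree_coboundary coboundary_in_cochains)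

lemma cubes_lattice_iff:
  assumes "finite A"
  shows "(l, I) \<in> cubes (lattice A) q \<longleftrightarrow> l \<in> lattice A \<and> I \<subseteq> A \<and> card I = q"
proof
  assume *: "(l, I) \<in> cubes (lattice A) q"
  then have I: "finite I" "\<And>K. K \<subseteq> I \<Longrightarrow> l + cube_vec K \<in> lattice A"
    by (auto simp: cubes_def cube_vertices_eq)
  from I(2) [of "{}"] have l: "l \<in> lattice A" by simp
  with I(2) [of I] have "I \<subseteq> A"
    by (auto simp: lattice_def cube_vec_def)
  with * l show "l \<in> lattice A \<and> I \<subseteq> A \<and> card I = q"
    by (simp add: cubes_def)
next
  assume *: "l \<in> lattice A \<and> I \<subseteq> A \<and> card I = q"
  then have "finite I" using assms finite_subset by blast
  with * show "(l, I) \<in> cubes (lattice A) q"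
    by (auto simp: cubes_def cube_vertices_eq lattice_def cube_vec_def)
qed

lemma cubes_quadrant_iff:
  assumes "finite A"
  shows "(l, I) \<in> cubes (quadrant A) q \<longleftrightarrow> l \<in> quadrant A \<and> I \<subseteq> A \<and> card I = q"
proof
  assume *: "(l, I) \<in> cubes (quadrant A) q"
  then have "(l, I) \<in> cubes (lattice A) q"
    by (auto simp: cubes_def quadrant_def)
  moreover have "l \<in> quadrant A"
    using * base_in_cube_vertices [of I l] by (auto simp: cubes_def)
  ultimately show "l \<in> quadrant A \<and> I \<subseteq> A \<and> card I = q"
    by (simp add: cubes_lattice_iff assms)
next
  assume *: "l \<in> quadrant A \<and> I \<subseteq> A \<and> card I = q"
  then have "finite I" using assms finite_subset by blast
  with * show "(l, I) \<in> cubes (quadrant A) q"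
    by (auto simp: cubes_def cube_vertices_eq quadrant_def lattice_def cube_vec_def)
qed

lemma unit_vec_pos: "0 < (unit_vec i :: 'v \<Rightarrow> int)"
proof -
  have "(0 :: 'v \<Rightarrow> int) i \<noteq> unit_vec i i" by (simp add: unit_vec_def)
  then have "(0 :: 'v \<Rightarrow> int) \<noteq> unit_vec i" by metis
  moreover have "(0 :: 'v \<Rightarrow> int) \<le> unit_vec i" by (simp add: le_fun_def unit_vec_def)
  ultimately show ?thesis by (simp add: less_le)
qed

lemma add_unit_vec_in_lattice: "l \<in> lattice A \<Longrightarrow> i \<in> A \<Longrightarrow> l + unit_vec i \<in> lattice A"
  by (auto simp: lattice_def unit_vec_def)

lemma add_unit_vec_in_quadrant: "l \<in> quadrant A \<Longrightarrow> i \<in> A \<Longrightarrow> l + unit_vec i \<in> quadrant A"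
  by (auto simp: quadrant_def lattice_def unit_vec_def)

section \<open>Restriction to the quadrant\<close>

text \<open>Cubes outside the quadrant are matched in pairs \<open>(l, I)\<close>, \<open>(l, insert (dir l) I)\<close> of equal
  weight. Hence the cochains vanishing on the quadrant form an acyclic complex; its contraction is
  defined by recursion over cubes with growing base point, which terminates because sublevel sets
  are finite.\<close>

locale outward_matching =
  fixes A :: "'v::linorder set" and w :: "('v \<Rightarrow> int) \<Rightarrow> int" and dir :: "('v \<Rightarrow> int) \<Rightarrow> 'v"
  assumes finite_A: "finite A"
    and finite_sublevel: "\<And>N. finite {l \<in> lattice A. w l \<le> N}"
    and dir_in: "\<And>l. l \<in> lattice A \<Longrightarrow> l \<notin> quadrant A \<Longrightarrow> dir l \<in> A"
    and dir_le: "\<And>l K. l \<in> lattice A \<Longrightarrow> l \<notin> quadrant A \<Longrightarrow> K \<subseteq> A - {dir l} \<Longrightarrow>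
      w (l + unit_vec (dir l) + cube_vec K) \<le> w (l + cube_vec K)"
begin

text \<open>Vertex by vertex, the front face in direction \<open>dir l\<close> weighs no more than
  the back face.\<close>

lemma weight_matched:
  assumes "l \<in> lattice A" "l \<notin> quadrant A" "I \<subseteq> A" "dir l \<notin> I"
  shows "cube_weight w (l, insert (dir l) I) = cube_weight w (l, I)"
proof -
  have fin: "finite I" using assms(3) finite_A finite_subset by blast
  have "cube_weight w (l + unit_vec (dir l), I) \<le> cube_weight w (l, I)"
    unfolding cube_weight_le_iff [OF fin]
  proof (intro allI impI)
    fix K assume "K \<subseteq> I"
    with assms dir_le [of l K] cube_weight_ge [OF fin this, of w l]
    show "w (l + unit_vec (dir l) + cube_vec K) \<le> cube_weight w (l, I)"
      by fastforce
  qed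
  then show ?thesis
    using cube_weight_face [of "insert (dir l) I" "dir l" w l] fin assms(4) by simp
qed

definition later :: "('v cube \<times> 'v cube) set" where
  "later = {((l', I'), (l, I)). finite I' \<and> l < l' \<and> l' \<in> lattice A \<and>
     cube_weight w (l', I') \<le> cube_weight w (l, I)}"

text \<open>The measure counts the lattice points strictly above the base point whose weight is at
  most that of the cube. Passing to a later cube loses at least the new base point.\<close>

lemma wf_later: "wf later"
proof (rule wf_subset [OF wf_measure])
  let ?S = "\<lambda>(l, I). {x \<in> lattice A. l < x \<and> w x \<le> cube_weight w (l, I)}"
  show "later \<subseteq> measure (\<lambda>c. card (?S c))"
  proof (rule subrelI)
    fix c' c assume "(c', c) \<in> later"
    then obtain l' I' l I where c: "c' = (l', I')" "c = (l, I)" and *: "finite I'" "l < l'" "l' \<in> lattice A"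
      "cube_weight w (l', I') \<le> cube_weight w (l, I)"
      unfolding later_def by blast
    have "w l' \<le> cube_weight w (l', I')"
      using cube_weight_ge [OF \<open>finite I'\<close>, of "{}" w l'] by simp
    then have "l' \<in> ?S c" "l' \<notin> ?S c'"
      using * by (simp_all add: c)
    moreover have "?S c' \<subseteq> ?S c"
      using *(2,4) by (auto simp: c intro: less_trans)
    ultimately have "?S c' \<subset> ?S c"
      by blast
    moreover have "finite (?S c)"
      by (rule finite_subset [OF _ finite_sublevel [of "cube_weight w c"]]) (auto simp: c)
    ultimately show "(c', c) \<in> measure (\<lambda>c. card (?S c))"
      by (simp add: psubset_card_mono)
  qed
qed

text \<open>These are the front faces of the upper cube of a pair. The back faces other than
  \<open>(l, I)\<close> contain \<open>dir l\<close> and are upper cubes themselves, so a recursion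
  over lower cubes refers only to later ones.\<close>

lemma later_faces:
  assumes "l \<in> lattice A" "l \<notin> quadrant A" "I \<subseteq> A" "dir l \<notin> I" "i \<in> insert (dir l) I"
  shows "((l + unit_vec i, insert (dir l) I - {i}), (l, I)) \<in> later"
proof -
  have fin: "finite I" using assms(3) finite_A finite_subset by blast
  have "cube_weight w (l + unit_vec i, insert (dir l) I - {i}) \<le> cube_weight w (l, I)"
    using cube_weight_face [of "insert (dir l) I" i w l] assms(5) fin weight_matched [OF assms(1-4)] by simp
  moreover have "l < l + unit_vec i"
    by (simp add: unit_vec_pos)
  moreover have "i \<in> A"
    using assms dir_in by blast
  then have "l + unit_vec i \<in> lattice A"
    by (rule add_unit_vec_in_lattice [OF assms(1)])
  ultimately show ?thesis
    unfolding later_def using fin by blast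
qed

lemma matched_cube:
  assumes "(l, I) \<in> cubes (lattice A) q" "l \<notin> quadrant A" "dir l \<notin> I"
  shows "(l, insert (dir l) I) \<in> cubes (lattice A) (Suc q)"
proof -
  have "finite I" using assms(1) by (auto simp: cubes_def)
  with assms dir_in show ?thesis by (auto simp: cubes_lattice_iff finite_A)
qed

text \<open>On the upper cube over \<open>(l, I)\<close> only one face survives in the coboundary:
  front faces vanish by induction, back faces other than \<open>(l, I)\<close> are upper cubes.
  Since the pair has equal weights, \<open>\<theta> (l, I)\<close> occurs there with coefficient
  \<open>\<plusminus>1\<close> and no power of \<open>U\<close>.\<close>

lemma relative_cocycle_zero:
  assumes "\<theta> \<in> cochains (lattice A) q" "coboundary (lattice A) w q \<theta> = 0"
    and quad: "\<And>l I. l \<in> quadrant A \<Longrightarrow> \<theta> (l, I) = 0"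
    and upper: "\<And>l I. l \<in> lattice A \<Longrightarrow> l \<notin> quadrant A \<Longrightarrow> dir l \<in> I \<Longrightarrow> \<theta> (l, I) = 0"
  shows "\<theta> = 0"
proof
  fix c
  show "\<theta> c = 0 c"
  proof (induction c rule: wf_induct_rule [OF wf_later])
    case (1 c)
    obtain l I where c: "c = (l, I)" by force
    show ?case
    proof (cases "(l, I) \<in> cubes (lattice A) q \<and> l \<notin> quadrant A \<and> dir l \<notin> I")
      case False
      then show ?thesis
        using assms(1) quad [of l I] upper [of l I] by (auto simp: c cochains_def cubes_lattice_iff finite_A)
    next
      case True
      then have l: "l \<in> lattice A" "l \<notin> quadrant A" "I \<subseteq> A" "dir l \<notin> I" and fin: "finite I"
        using finite_subset [OF _ finite_A] by (auto simp: cubes_lattice_iff finite_A)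
      let ?J = "insert (dir l) I"
      have up: "\<theta> (l + unit_vec i, ?J - {i}) = 0" if "i \<in> ?J" for i
        using 1 [unfolded c, OF later_faces [OF l that]] by simp
      have "face_diff w \<theta> (l, ?J) i = (if i = dir l then - \<theta> (l, I) else 0)" if "i \<in> ?J" for i
        using up [OF that] upper [OF l(1,2), of "?J - {i}"] l(4) weight_matched [OF l]
        by (auto simp: face_diff_def transport_def)
      then have "coboundary (lattice A) w q \<theta> (l, ?J) =
          (\<Sum>i\<in>?J. sgn_act (face_index ?J i) (if i = dir l then - \<theta> (l, I) else 0))"
        using True by (simp add: coboundary_eq [OF matched_cube])
      also have "\<dots> = sgn_act (face_index ?J (dir l)) (- \<theta> (l, I)) + (\<Sum>i\<in>I. 0)"
        using l(4) fin by (auto intro!: arg_cong2 [where f = "(+)"] sum.neutral)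
      finally show ?thesis
        using assms(2) by (simp add: c)
    qed
  qed
qed

text \<open>The equation for the primitive is solved on upper cubes only, by a cochain living on
  lower cubes. The remaining error is a relative cocycle vanishing on upper cubes, hence
  zero.\<close>

lemma relative_primitive:
  assumes "\<phi> \<in> cochains (lattice A) (Suc q)" "coboundary (lattice A) w (Suc q) \<phi> = 0"
    and quad: "\<forall>l I. l \<in> quadrant A \<longrightarrow> \<phi> (l, I) = 0"
  shows "\<exists>\<psi>\<in>cochains (lattice A) q. coboundary (lattice A) w q \<psi> = \<phi> \<and>
    (\<forall>l I. l \<in> quadrant A \<longrightarrow> \<psi> (l, I) = 0) \<and>
    (\<forall>d. \<phi> \<in> homogeneous_cochains (lattice A) w (Suc q) d \<longrightarrow>
       \<psi> \<in> homogeneous_cochains (lattice A) w q d)"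
proof -
  let ?J = "\<lambda>l I. insert (dir l) I"
  let ?low = "\<lambda>l I. (l, I) \<in> cubes (lattice A) q \<and> l \<notin> quadrant A \<and> dir l \<notin> I"
  \<comment> \<open>Cutting off everything but later cubes makes \<open>H\<close> admissible for
    well-founded recursion; \<open>H\<close> solves the equation on the upper cube for the value at
    \<open>(l, I)\<close>.\<close>
  define above where "above \<psi> c = (\<lambda>c'. if (c', c) \<in> later then \<psi> c' else 0)"
    for \<psi> :: "'v cube \<Rightarrow> T0" and c
  define H where "H \<psi> = (\<lambda>(l, I). if ?low l I
      then sgn_act (face_index (?J l I) (dir l))
        (coboundary (lattice A) w q (above \<psi> (l, I)) (l, ?J l I) - \<phi> (l, ?J l I)) else 0)" for \<psi>
  have "adm_wf later H"
    unfolding adm_wf_def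
  proof (intro allI impI)
    fix f g :: "'v cube \<Rightarrow> T0" and c
    assume "\<forall>z. (z, c) \<in> later \<longrightarrow> f z = g z"
    then have "above f c = above g c"
      by (auto simp: above_def fun_eq_iff)
    then show "H f c = H g c"
      by (cases c) (simp add: H_def)
  qed
  then have "\<exists>\<psi>. \<psi> = H \<psi>"
    using wfrec_fixpoint [OF wf_later] by blast
  then obtain \<psi> where \<psi>: "\<psi> = H \<psi>" by blast
  have \<psi>_low: "\<psi> (l, I) = sgn_act (face_index (?J l I) (dir l))
      (coboundary (lattice A) w q (above \<psi> (l, I)) (l, ?J l I) - \<phi> (l, ?J l I))" if "?low l I" for l I
    using that by (subst \<psi>) (simp add: H_def)
  have \<psi>_0: "\<psi> (l, I) = 0" if "\<not> ?low l I" for l I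
    using that by (subst \<psi>) (auto simp: H_def)
  have cochain: "\<psi> \<in> cochains (lattice A) q"
    using \<psi>_0 by (auto simp: cochains_def)
  have low: "coboundary (lattice A) w q \<psi> (l, ?J l I) = \<phi> (l, ?J l I)" if *: "?low l I" for l I
  proof -
    from * have l: "l \<in> lattice A" "l \<notin> quadrant A" "I \<subseteq> A" "dir l \<notin> I" and fin: "finite I"
      using finite_subset [OF _ finite_A] by (auto simp: cubes_lattice_iff finite_A)
    \<comment> \<open>The cut-off loses only the face \<open>(l, I)\<close>: front faces are later,
      and on the other back faces \<open>\<psi>\<close> is zero.\<close>
    have "face_diff w \<psi> (l, ?J l I) i =
        face_diff w (above \<psi> (l, I)) (l, ?J l I) i - (if i = dir l then \<psi> (l, I) else 0)"
      if "i \<in> ?J l I" for i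
      using later_faces [OF l that] \<psi>_0 [of l "?J l I - {i}"] l(4) weight_matched [OF l]
      by (auto simp: face_diff_def transport_def above_def) (auto simp: later_def)
    then have "coboundary (lattice A) w q \<psi> (l, ?J l I) =
        (\<Sum>i\<in>?J l I. sgn_act (face_index (?J l I) i) (face_diff w (above \<psi> (l, I)) (l, ?J l I) i) -
          sgn_act (face_index (?J l I) i) (if i = dir l then \<psi> (l, I) else 0))"
      using * by (simp add: coboundary_eq [OF matched_cube] sgn_act_diff)
    also have "\<dots> = coboundary (lattice A) w q (above \<psi> (l, I)) (l, ?J l I) -
        (\<Sum>i\<in>?J l I. sgn_act (face_index (?J l I) i) (if i = dir l then \<psi> (l, I) else 0))"
      by (simp only: sum_subtractf coboundary_eq [OF matched_cube [OF _ l(2,4)], OF conjunct1 [OF *]])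
    also have "(\<Sum>i\<in>?J l I. sgn_act (face_index (?J l I) i) (if i = dir l then \<psi> (l, I) else 0)) =
        (\<Sum>i\<in>?J l I. if i = dir l then sgn_act (face_index (?J l I) (dir l)) (\<psi> (l, I)) else 0)"
      by (intro sum.cong) auto
    also have "\<dots> = sgn_act (face_index (?J l I) (dir l)) (\<psi> (l, I))"
      using fin by simp
    finally show ?thesis
      using \<psi>_low [OF *] by simp
  qed
  have \<psi>_quad: "\<psi> (l, I) = 0" if "l \<in> quadrant A" for l I
    using that \<psi>_0 by blast
  have coboundary_quad: "coboundary (lattice A) w q \<psi> (l, I) = 0" if "l \<in> quadrant A" for l I
  proof (cases "(l, I) \<in> cubes (lattice A) (Suc q)")
    case True
    then have "face_diff w \<psi> (l, I) i = 0" if "i \<in> I" for i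
      using that \<open>l \<in> quadrant A\<close> add_unit_vec_in_quadrant [of l A i]
      by (auto simp: face_diff_def \<psi>_quad cubes_lattice_iff finite_A subset_iff)
    then show ?thesis using True by (simp add: coboundary_eq)
  qed (simp add: coboundary_outside)
  have "\<phi> - coboundary (lattice A) w q \<psi> = 0"
  proof (rule relative_cocycle_zero)
    show "\<phi> - coboundary (lattice A) w q \<psi> \<in> cochains (lattice A) (Suc q)"
      using assms(1) coboundary_in_cochains by (auto simp: cochains_def coboundary_outside)
    show "coboundary (lattice A) w (Suc q) (\<phi> - coboundary (lattice A) w q \<psi>) = 0"
      by (simp add: coboundary_diff assms(2) coboundary_coboundary)
    show "(\<phi> - coboundary (lattice A) w q \<psi>) (l, I) = 0" if "l \<in> quadrant A" for l I
      using that by (simp add: quad coboundary_quad)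
    fix l I assume l: "l \<in> lattice A" "l \<notin> quadrant A" "dir l \<in> I"
    show "(\<phi> - coboundary (lattice A) w q \<psi>) (l, I) = 0"
    proof (cases "(l, I) \<in> cubes (lattice A) (Suc q)")
      case True
      then have "?low l (I - {dir l})"
        using cubes_face l by auto
      from low [OF this] show ?thesis
        using l by (simp add: insert_absorb)
    next
      case False
      then show ?thesis using assms(1) by (simp add: cochains_def coboundary_outside)
    qed
  qed
  then have primitive: "coboundary (lattice A) w q \<psi> = \<phi>" by simp
  \<comment> \<open>The recursion uses only coboundaries, differences and signs between cubes of
    equal weight, so it stays in one degree.\<close>
  have degree: "\<psi> \<in> homogeneous_cochains (lattice A) w q d"
    if hom: "\<phi> \<in> homogeneous_cochains (lattice A) w (Suc q) d" for d
  proof -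
    have "T0_degree (d - 2 * cube_weight w c) (\<psi> c)" for c
    proof (induction c rule: wf_induct_rule [OF wf_later])
      case (1 c)
      obtain l I where c: "c = (l, I)" by force
      show ?case
      proof (cases "?low l I")
        case True
        then have weight: "cube_weight w (l, I) = cube_weight w (l, ?J l I)"
          using weight_matched [of l I] by (auto simp: cubes_lattice_iff finite_A)
        have "T0_degree (d - 2 * cube_weight w c') (above \<psi> (l, I) c')" for c'
          using 1 by (auto simp: above_def c)
        then show ?thesis
          using hom True unfolding c \<psi>_low [OF True] weight homogeneous_cochains_iff
          by (intro T0_degree_sgn_act T0_degree_diff T0_degree_coboundary) auto
      next
        case False
        then show ?thesis by (simp add: c \<psi>_0)
      qed
    qed
    with cochain show ?thesis by (simp add: homogeneous_cochains_iff)
  qed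
  show ?thesis
    by (intro bexI [OF _ cochain] conjI allI impI primitive \<psi>_quad degree)
qed

text \<open>Testing the base point suffices, since a cube of the lattice lies in the quadrant as
  soon as its base point does.\<close>

definition restrict_cochain :: "('v cube \<Rightarrow> T0) \<Rightarrow> 'v cube \<Rightarrow> T0" where
  "restrict_cochain \<phi> = (\<lambda>(l, I). if l \<in> quadrant A then \<phi> (l, I) else 0)"

lemma coboundary_restrict:
  "coboundary (quadrant A) w q (restrict_cochain \<phi>) = restrict_cochain (coboundary (lattice A) w q \<phi>)"
proof
  fix c :: "'v cube"
  obtain l I where c: "c = (l, I)" by force
  show "coboundary (quadrant A) w q (restrict_cochain \<phi>) c =
    restrict_cochain (coboundary (lattice A) w q \<phi>) c"
  proof (cases "(l, I) \<in> cubes (quadrant A) (Suc q)")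
    case True
    then have l: "l \<in> quadrant A" "I \<subseteq> A" "card I = Suc q"
      by (auto simp: cubes_quadrant_iff finite_A)
    moreover from this have "(l, I) \<in> cubes (lattice A) (Suc q)"
      by (auto simp: cubes_lattice_iff finite_A quadrant_def)
    moreover have "face_diff w (restrict_cochain \<phi>) (l, I) i = face_diff w \<phi> (l, I) i" if "i \<in> I" for i
      using that l add_unit_vec_in_quadrant [of l A i] by (auto simp: face_diff_def restrict_cochain_def)
    ultimately show ?thesis
      using True by (simp add: c coboundary_eq) (simp add: restrict_cochain_def coboundary_eq)
  next
    case False
    then show ?thesis
      by (auto simp: c coboundary_outside restrict_cochain_def cubes_quadrant_iff cubes_lattice_iff finite_A)
  qed
qed

lemma quadrant_cochains_subset: "cochains (quadrant A) q \<subseteq> cochains (lattice A) q"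
proof -
  have "c \<in> cubes (lattice A) q" if "c \<in> cubes (quadrant A) q" for c
    using that by (auto simp: cubes_def quadrant_def)
  then show ?thesis by (auto simp: cochains_def)
qed

lemma restrict_quadrant_cochain: "\<phi> \<in> cochains (quadrant A) q \<Longrightarrow> restrict_cochain \<phi> = \<phi>"
  by (auto simp: fun_eq_iff restrict_cochain_def cochains_def cubes_quadrant_iff finite_A)

lemma restrict_in_cochains: "\<phi> \<in> cochains (lattice A) q \<Longrightarrow> restrict_cochain \<phi> \<in> cochains (quadrant A) q"
  by (auto simp: restrict_cochain_def cochains_def cubes_quadrant_iff cubes_lattice_iff finite_A)

lemma restrict_diff: "restrict_cochain (\<phi> - \<psi>) = restrict_cochain \<phi> - restrict_cochain \<psi>"
  by (auto simp: restrict_cochain_def fun_eq_iff)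

lemma restrict_zeroD:
  assumes "restrict_cochain \<phi> = 0" "l \<in> quadrant A"
  shows "\<phi> (l, I) = 0"
  using fun_cong [OF assms(1), of "(l, I)"] assms(2) by (simp add: restrict_cochain_def)

lemma restrict_zero: "restrict_cochain 0 = 0"
  by (auto simp: restrict_cochain_def fun_eq_iff)

text \<open>Extension by zero is a section of restriction on cochains, and the kernel of restriction
  is acyclic. Every failure of the section to respect coboundaries is a relative cocycle and can be
  corrected by a relative primitive.\<close>

lemma lattice_quadrant_iso:
  "graded_module_iso (lattice_cohomology (lattice A) w q) (lattice_cohomology (quadrant A) w q)"
proof (rule lattice_cohomology_isoI [where h = restrict_cochain])
  show "restrict_cochain (\<phi> + \<psi>) = restrict_cochain \<phi> + restrict_cochain \<psi>" for \<phi> \<psi>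
    by (auto simp: restrict_cochain_def fun_eq_iff)
  show "restrict_cochain (cochain_smult p \<phi>) = cochain_smult p (restrict_cochain \<phi>)" for p \<phi>
    by (auto simp: restrict_cochain_def cochain_smult_def fun_eq_iff)
  show cocycle: "restrict_cochain \<phi> \<in> cocycles (quadrant A) w q" if "\<phi> \<in> cocycles (lattice A) w q" for \<phi>
    using that by (simp add: cocycles_def coboundary_restrict restrict_zero restrict_in_cochains)
  show "restrict_cochain \<phi> \<in> homogeneous_cochains (quadrant A) w q d"
    if "\<phi> \<in> homogeneous_cochains (lattice A) w q d" for \<phi> d
    using that restrict_in_cochains by (auto simp: homogeneous_cochains_iff restrict_cochain_def)
  show "restrict_cochain \<phi> \<in> coboundaries (quadrant A) w q \<longleftrightarrow> \<phi> \<in> coboundaries (lattice A) w q"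
    if \<phi>: "\<phi> \<in> cocycles (lattice A) w q" for \<phi>
  proof (cases q)
    case 0
    \<comment> \<open>In degree 0 there are no primitives, but no cube has a direction either, so
      the condition on upper cubes is empty.\<close>
    have "\<phi> = 0" if zero: "restrict_cochain \<phi> = 0"
    proof (rule relative_cocycle_zero)
      show *: "\<phi> \<in> cochains (lattice A) q" "coboundary (lattice A) w q \<phi> = 0"
        using \<phi> by (auto simp: cocycles_def)
      show "\<phi> (l, I) = 0" if "dir l \<in> I" for l I
      proof -
        have "(l, I) \<notin> cubes (lattice A) q"
          using that by (auto simp: 0 cubes_def)
        with *(1) show ?thesis by (simp add: cochains_def)
      qed
      show "\<phi> (l, I) = 0" if "l \<in> quadrant A" for l I
        using restrict_zeroD [OF zero that] .
    qed
    then show ?thesis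
      by (auto simp: 0 coboundaries_def restrict_zero)
  next
    case (Suc r)
    show ?thesis
    proof
      assume "restrict_cochain \<phi> \<in> coboundaries (quadrant A) w q"
      then obtain \<psi> where \<psi>: "\<psi> \<in> cochains (quadrant A) r" "restrict_cochain \<phi> = coboundary (quadrant A) w r \<psi>"
        by (auto simp: Suc coboundaries_def)
      \<comment> \<open>The primitive on the quadrant, extended by zero, is correct up to this
        relative cocycle.\<close>
      define \<theta> where "\<theta> = \<phi> - coboundary (lattice A) w r \<psi>"
      have "restrict_cochain \<theta> = 0"
        unfolding \<theta>_def restrict_diff coboundary_restrict [symmetric]
        using \<psi> by (simp add: restrict_quadrant_cochain)
      have quad: "\<forall>l I. l \<in> quadrant A \<longrightarrow> \<theta> (l, I) = 0"
        by (intro allI impI) (rule restrict_zeroD [OF \<open>restrict_cochain \<theta> = 0\<close>])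
      have "\<theta> \<in> cocycles (lattice A) w q"
        unfolding \<theta>_def Suc
        by (rule cocycles_diff [OF \<phi> [unfolded Suc]])
          (simp add: cocycles_def coboundary_coboundary coboundary_in_cochains)
      then have *: "\<theta> \<in> cochains (lattice A) (Suc r)" "coboundary (lattice A) w (Suc r) \<theta> = 0"
        by (auto simp: cocycles_def Suc)
      obtain \<eta> where \<eta>: "\<eta> \<in> cochains (lattice A) r" "coboundary (lattice A) w r \<eta> = \<theta>"
        using relative_primitive [OF * quad] by blast
      have "\<phi> = coboundary (lattice A) w r (\<psi> + \<eta>)"
        unfolding coboundary_add \<eta>(2) \<theta>_def by simp
      moreover have "\<psi> + \<eta> \<in> cochains (lattice A) r"
        using subsetD [OF quadrant_cochains_subset \<psi>(1)] \<eta>(1) by (simp add: cochains_def)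
      ultimately show "\<phi> \<in> coboundaries (lattice A) w q"
        by (simp add: Suc coboundaries_def)
    next
      assume "\<phi> \<in> coboundaries (lattice A) w q"
      then show "restrict_cochain \<phi> \<in> coboundaries (quadrant A) w q"
        by (auto simp: Suc coboundaries_def coboundary_restrict [symmetric] intro!: imageI restrict_in_cochains)
    qed
  qed
  fix \<Phi> assume \<Phi>: "\<Phi> \<in> cocycles (quadrant A) w q"
  then have res: "restrict_cochain \<Phi> = \<Phi>"
    by (auto simp: cocycles_def intro: restrict_quadrant_cochain)
  \<comment> \<open>The extension of \<open>\<Phi>\<close> by zero need not be closed; a relative
    primitive of its coboundary is subtracted.\<close>
  define \<theta> where "\<theta> = coboundary (lattice A) w q \<Phi>"
  have "restrict_cochain \<theta> = 0"
    using \<Phi> unfolding \<theta>_def coboundary_restrict [symmetric]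
    by (simp add: res cocycles_def)
  have quad: "\<forall>l I. l \<in> quadrant A \<longrightarrow> \<theta> (l, I) = 0"
    by (intro allI impI) (rule restrict_zeroD [OF \<open>restrict_cochain \<theta> = 0\<close>])
  have \<theta>: "\<theta> \<in> cochains (lattice A) (Suc q)" "coboundary (lattice A) w (Suc q) \<theta> = 0"
    by (simp_all add: \<theta>_def coboundary_in_cochains coboundary_coboundary)
  obtain \<psi> where \<psi>: "\<psi> \<in> cochains (lattice A) q" "coboundary (lattice A) w q \<psi> = \<theta>"
    "\<And>l I. l \<in> quadrant A \<Longrightarrow> \<psi> (l, I) = 0"
    "\<And>d. \<theta> \<in> homogeneous_cochains (lattice A) w (Suc q) d \<Longrightarrow>
       \<psi> \<in> homogeneous_cochains (lattice A) w q d"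
    using relative_primitive [OF \<theta> quad] by blast
  have "\<Phi> \<in> cochains (lattice A) q"
    using \<Phi> quadrant_cochains_subset by (auto simp: cocycles_def)
  then have "\<Phi> - \<psi> \<in> cocycles (lattice A) w q"
    using \<psi>(1,2) by (auto simp: cocycles_def coboundary_diff \<theta>_def cochains_def)
  moreover have "restrict_cochain \<psi> = 0"
    using \<psi>(3) by (auto simp: restrict_cochain_def fun_eq_iff)
  then have "\<Phi> - restrict_cochain (\<Phi> - \<psi>) = 0"
    by (simp add: restrict_diff res)
  moreover have "\<Phi> - \<psi> \<in> homogeneous_cochains (lattice A) w q d"
    if "\<Phi> \<in> homogeneous_cochains (quadrant A) w q d" for d
  proof -
    have "\<Phi> \<in> homogeneous_cochains (lattice A) w q d"
      using that quadrant_cochains_subset by (auto simp: homogeneous_cochains_iff)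
    moreover from this have "\<theta> \<in> homogeneous_cochains (lattice A) w (Suc q) d"
      unfolding \<theta>_def by (rule homogeneous_cochains_coboundary)
    ultimately show ?thesis
      by (intro homogeneous_cochains_diff \<psi>(4))
  qed
  ultimately show "\<exists>\<phi>\<in>cocycles (lattice A) w q. \<Phi> - restrict_cochain \<phi> \<in> coboundaries (quadrant A) w q \<and>
      (\<forall>d. \<Phi> \<in> homogeneous_cochains (quadrant A) w q d \<longrightarrow> \<phi> \<in> homogeneous_cochains (lattice A) w q d)"
    by (intro bexI [of _ "\<Phi> - \<psi>"]) (simp_all add: coboundaries_zero)
qed

end

lemma cube_weight_face_le:
  assumes "finite I" "i \<in> I"
  shows "cube_weight w (l, I - {i}) \<le> cube_weight w (l, I)"
    "cube_weight w (l + unit_vec i, I - {i}) \<le> cube_weight w (l, I)"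
  unfolding cube_weight_face [OF assms, of w l] by (rule max.cobounded1, rule max.cobounded2)

section \<open>Projection along one coordinate\<close>

text \<open>\<open>F\<close> acts from \<open>t0\<close> upwards and \<open>G\<close> below it, so
  both recursions can start from the common value at \<open>t0\<close>. This serves to integrate
  cochains along a fibre in both directions away from the bottom.\<close>

lemma two_sided_recursion:
  fixes t0 :: int
  obtains g where "g t0 = z" "\<And>t. t0 \<le> t \<Longrightarrow> g (t + 1) = F t (g t)"
    "\<And>t. t < t0 \<Longrightarrow> g t = G t (g (t + 1))"
proof -
  define up where "up = rec_nat z (\<lambda>n. F (t0 + int n))"
  define down where "down = rec_nat z (\<lambda>n. G (t0 - int n - 1))"
  define g where "g t = (if t0 \<le> t then up (nat (t - t0)) else down (nat (t0 - t)))" for t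
  have "g t0 = z" by (simp add: g_def up_def)
  moreover have "g (t + 1) = F t (g t)" if "t0 \<le> t" for t
  proof -
    define n where "n = nat (t - t0)"
    have "nat (t + 1 - t0) = Suc n" "t0 + int n = t" using that by (simp_all add: n_def)
    then show ?thesis using that by (simp add: g_def up_def n_def [symmetric])
  qed
  moreover have "g t = G t (g (t + 1))" if "t < t0" for t
  proof -
    define n where "n = nat (t0 - (t + 1))"
    have n: "nat (t0 - t) = Suc n" "t0 - int n - 1 = t" using that by (simp_all add: n_def)
    have "g (t + 1) = down n"
      using that by (cases "t + 1 = t0") (simp_all add: g_def n_def up_def down_def)
    moreover have "g t = G (t0 - int n - 1) (down n)"
      using that by (simp add: g_def n(1)) (simp add: down_def)
    ultimately show ?thesis by (simp only: n(2))
  qed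
  ultimately show ?thesis by (rule that)
qed

text \<open>Over each base cube the weights of the lifts form a valley whose depth is the weight of
  the base cube; \<open>bottom\<close> is a height where this depth is reached, and it need not
  agree on neighbouring cubes.\<close>

locale coordinate_projection =
  fixes A :: "'v::linorder set" and v :: 'v and w wb :: "('v \<Rightarrow> int) \<Rightarrow> int"
    and bottom :: "'v cube \<Rightarrow> int"
  assumes finite_A: "finite A" and v_notin: "v \<notin> A"
    and bottom_nonneg: "\<And>l I. l \<in> quadrant A \<Longrightarrow> I \<subseteq> A \<Longrightarrow> 0 \<le> bottom (l, I)"
    and weight_bottom: "\<And>l I. l \<in> quadrant A \<Longrightarrow> I \<subseteq> A \<Longrightarrow>
      cube_weight w (l(v := bottom (l, I)), I) = cube_weight wb (l, I)"
    and weight_ge: "\<And>l I t. l \<in> quadrant A \<Longrightarrow> I \<subseteq> A \<Longrightarrow> 0 \<le> t \<Longrightarrow>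
      cube_weight wb (l, I) \<le> cube_weight w (l(v := t), I)"
    and weight_up: "\<And>l I t. l \<in> quadrant A \<Longrightarrow> I \<subseteq> A \<Longrightarrow> bottom (l, I) \<le> t \<Longrightarrow>
      cube_weight w (l(v := t), I) \<le> cube_weight w (l(v := t + 1), I)"
    and weight_down: "\<And>l I t. l \<in> quadrant A \<Longrightarrow> I \<subseteq> A \<Longrightarrow> 0 \<le> t \<Longrightarrow> t < bottom (l, I) \<Longrightarrow>
      cube_weight w (l(v := t + 1), I) \<le> cube_weight w (l(v := t), I)"
begin

abbreviation base :: "('v \<Rightarrow> int) set" where "base \<equiv> quadrant A"
abbreviation total :: "('v \<Rightarrow> int) set" where "total \<equiv> quadrant (insert v A)"

lemma base_in_total: "l \<in> base \<Longrightarrow> 0 \<le> t \<Longrightarrow> l(v := t) \<in> total"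
  by (auto simp: quadrant_def lattice_def)

lemma total_to_base: "l \<in> total \<Longrightarrow> l(v := 0) \<in> base"
  by (auto simp: quadrant_def lattice_def)

lemma total_nonneg: "l \<in> total \<Longrightarrow> 0 \<le> l v"
  by (auto simp: quadrant_def)

lemma base_at_v: "l \<in> base \<Longrightarrow> l(v := 0) = l"
  using v_notin by (auto simp: quadrant_def lattice_def fun_upd_idem)

lemma horizontal_cube:
  "(l, I) \<in> cubes base q \<Longrightarrow> 0 \<le> t \<Longrightarrow> (l(v := t), I) \<in> cubes total q"
  by (auto simp: cubes_quadrant_iff finite_A base_in_total)

lemma vertical_cube:
  assumes "(l, I) \<in> cubes base q" "0 \<le> t"
  shows "(l(v := t), insert v I) \<in> cubes total (Suc q)"
proof -
  have "finite I" "v \<notin> I"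
    using assms v_notin finite_subset [OF _ finite_A] by (auto simp: cubes_quadrant_iff finite_A)
  with assms show ?thesis
    by (auto simp: cubes_quadrant_iff finite_A base_in_total)
qed

lemma base_cube: "(l, I) \<in> cubes total q \<Longrightarrow> v \<notin> I \<Longrightarrow> (l(v := 0), I) \<in> cubes base q"
  by (auto simp: cubes_quadrant_iff finite_A total_to_base)

lemma upd_add_unit_vec: "i \<noteq> v \<Longrightarrow> (l + unit_vec i)(v := t) = l(v := t) + unit_vec i"
  for l :: "'v \<Rightarrow> int"
  by (auto simp: unit_vec_def fun_eq_iff)

lemma upd_add_unit_vec_v: "l(v := t) + unit_vec v = l(v := t + 1)"
  for l :: "'v \<Rightarrow> int"
  by (auto simp: unit_vec_def fun_eq_iff)

lemma add_unit_vec_v_upd: "(l + unit_vec v)(v := t) = l(v := t)"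
  for l :: "'v \<Rightarrow> int"
  by (auto simp: unit_vec_def fun_eq_iff)

text \<open>The composition with the projection along \<open>v\<close>, zero on cubes that the
  projection collapses. The power of \<open>U\<close> compensates the difference of the weights and
  keeps the degree.\<close>

definition pullback :: "nat \<Rightarrow> ('v cube \<Rightarrow> T0) \<Rightarrow> 'v cube \<Rightarrow> T0" where
  "pullback q \<phi> = (\<lambda>(l, I). if (l, I) \<in> cubes total q \<and> v \<notin> I
     then U_act (nat (cube_weight w (l, I) - cube_weight wb (l(v := 0), I))) (\<phi> (l(v := 0), I)) else 0)"

lemma pullback_vertical: "v \<in> I \<Longrightarrow> pullback q \<phi> (l, I) = 0"
  by (simp add: pullback_def)

lemma weight_ge': "(l, I) \<in> cubes total q \<Longrightarrow> v \<notin> I \<Longrightarrow>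
    cube_weight wb (l(v := 0), I) \<le> cube_weight w (l, I)"
  using weight_ge [of "l(v := 0)" I "l v"] total_nonneg [of l]
  by (auto simp: cubes_quadrant_iff finite_A total_to_base)

text \<open>The two exponents add up to one that depends on the lift only through \<open>c\<close>
  and the projected face; the lift itself drops out.\<close>

lemma transport_pullback:
  assumes "(l, I) \<in> cubes total q" "v \<notin> I" "cube_weight w (l, I) \<le> cube_weight w c"
  shows "transport w c (l, I) (pullback q \<phi> (l, I)) =
    U_act (nat (cube_weight w c - cube_weight wb (l(v := 0), I))) (\<phi> (l(v := 0), I))"
  using assms weight_ge' [OF assms(1,2)]
  by (simp add: pullback_def transport_def nat_add_distrib [symmetric])

text \<open>On a vertical cube the two faces in direction \<open>v\<close> project to the same base
  cube and cancel, and all others are vertical. On a horizontal cube a common power of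
  \<open>U\<close> factors out.\<close>

lemma coboundary_pullback:
  "coboundary total w q (pullback q \<phi>) = pullback (Suc q) (coboundary base wb q \<phi>)"
proof
  fix c :: "'v cube"
  obtain l I where c: "c = (l, I)" by force
  show "coboundary total w q (pullback q \<phi>) c = pullback (Suc q) (coboundary base wb q \<phi>) c"
  proof (cases "(l, I) \<in> cubes total (Suc q)")
    case False
    then show ?thesis by (simp add: c coboundary_outside pullback_def)
  next
    case True
    then have fin: "finite I" by (auto simp: cubes_def)
    have le: "cube_weight w (l, I - {i}) \<le> cube_weight w (l, I)"
      "cube_weight w (l + unit_vec i, I - {i}) \<le> cube_weight w (l, I)" if "i \<in> I" for i
      by (rule cube_weight_face_le [OF fin that])+
    have faces: "(l, I - {i}) \<in> cubes total q" "(l + unit_vec i, I - {i}) \<in> cubes total q" if "i \<in> I" for i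
      using cubes_face [OF True that] by auto
    show ?thesis
    proof (cases "v \<in> I")
      case True
      have "face_diff w (pullback q \<phi>) (l, I) i = 0" if i: "i \<in> I" for i
      proof (cases "i = v")
        case True
        then have v: "v \<in> I" and v': "v \<notin> I - {v}" using i by auto
        have "transport w (l, I) (l + unit_vec v, I - {v}) (pullback q \<phi> (l + unit_vec v, I - {v})) =
            transport w (l, I) (l, I - {v}) (pullback q \<phi> (l, I - {v}))"
          unfolding transport_pullback [OF faces(2) [OF v] v' le(2) [OF v]]
            transport_pullback [OF faces(1) [OF v] v' le(1) [OF v]] add_unit_vec_v_upd ..
        then show ?thesis
          by (simp add: face_diff_def \<open>i = v\<close>)
      next
        case False
        then show ?thesis
          using \<open>v \<in> I\<close> by (simp add: face_diff_def pullback_vertical)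
      qed
      then show ?thesis
        unfolding c coboundary_eq [OF \<open>(l, I) \<in> cubes total (Suc q)\<close>]
        using True by (simp add: pullback_vertical)
    next
      case False
      let ?b = "(l(v := 0), I)"
      have base: "?b \<in> cubes base (Suc q)"
        by (rule base_cube [OF True False])
      let ?n = "nat (cube_weight w (l, I) - cube_weight wb ?b)"
      have "face_diff w (pullback q \<phi>) (l, I) i = U_act ?n (face_diff wb \<phi> ?b i)" if i: "i \<in> I" for i
      proof -
        have "i \<noteq> v" using False i by auto
        let ?hi = "(l(v := 0) + unit_vec i, I - {i})" and ?lo = "(l(v := 0), I - {i})"
        have "cube_weight wb ?lo \<le> cube_weight wb ?b" "cube_weight wb ?hi \<le> cube_weight wb ?b"
          by (rule cube_weight_face_le [OF fin i])+
        moreover have "cube_weight wb ?b \<le> cube_weight w (l, I)"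
          by (rule weight_ge' [OF True False])
        ultimately have n: "?n + nat (cube_weight wb ?b - cube_weight wb ?hi) =
            nat (cube_weight w (l, I) - cube_weight wb ?hi)"
          "?n + nat (cube_weight wb ?b - cube_weight wb ?lo) =
            nat (cube_weight w (l, I) - cube_weight wb ?lo)"
          by linarith+
        have "v \<notin> I - {i}" using False by simp
        from transport_pullback [OF faces(2) [OF i] this le(2) [OF i]]
          transport_pullback [OF faces(1) [OF i] this le(1) [OF i]]
        show ?thesis
          by (simp only: face_diff_def prod.case upd_add_unit_vec [OF \<open>i \<noteq> v\<close>] U_act_diff
              transport_def [of wb] U_act_U_act n)
      qed
      then have "coboundary total w q (pullback q \<phi>) (l, I) =
          (\<Sum>i\<in>I. U_act ?n (sgn_act (face_index I i) (face_diff wb \<phi> ?b i)))"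
        using True by (simp add: coboundary_eq U_act_sgn_act)
      also have "\<dots> = U_act ?n (coboundary base wb q \<phi> ?b)"
        using base by (simp add: coboundary_eq U_act_sum)
      finally show ?thesis
        using True False by (simp add: c pullback_def)
    qed
  qed
qed

lemma pullback_in_cochains: "pullback q \<phi> \<in> cochains total q"
  by (auto simp: cochains_def pullback_def)

lemma pullback_diff: "pullback q (\<phi> - \<psi>) = pullback q \<phi> - pullback q \<psi>"
  by (auto simp: pullback_def fun_eq_iff U_act_diff)

text \<open>At the bottom the exponent of \<open>U\<close> is zero, so the value on the base cube
  can be read off. Elsewhere \<open>U\<close> may have killed it.\<close>

lemma pullback_inject:
  assumes "\<phi> \<in> cochains base q" "pullback q \<phi> = 0"
  shows "\<phi> = 0"
proof
  fix c :: "'v cube"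
  obtain l I where c: "c = (l, I)" by force
  show "\<phi> c = 0 c"
  proof (cases "(l, I) \<in> cubes base q")
    case True
    then have l: "l \<in> base" "I \<subseteq> A" by (auto simp: cubes_quadrant_iff finite_A)
    have "pullback q \<phi> (l(v := bottom (l, I)), I) = \<phi> (l, I)"
      using l v_notin horizontal_cube [OF True bottom_nonneg [OF l]]
      by (auto simp: pullback_def weight_bottom base_at_v)
    then show ?thesis using assms(2) by (simp add: c)
  next
    case False
    then show ?thesis using assms(1) by (simp add: c cochains_def)
  qed
qed

lemma pullback_homogeneous:
  assumes "\<phi> \<in> homogeneous_cochains base wb q d"
  shows "pullback q \<phi> \<in> homogeneous_cochains total w q d"
proof -
  have "T0_degree (d - 2 * cube_weight w (l, I)) (pullback q \<phi> (l, I))" for l I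
  proof (cases "(l, I) \<in> cubes total q \<and> v \<notin> I")
    case True
    then show ?thesis
      using assms weight_ge' [of l I q]
      by (auto simp: pullback_def homogeneous_cochains_iff
          intro!: T0_degree_U_act [where d = "d - 2 * cube_weight wb (l(v := 0), I)"])
  qed (auto simp: pullback_def)
  then show ?thesis
    by (auto simp: homogeneous_cochains_iff pullback_in_cochains)
qed

section \<open>Vertical cubes and integration along the fibre\<close>

lemma vertical_weight:
  assumes "(l, I) \<in> cubes base q"
  shows "cube_weight w (l(v := t), insert v I) =
    max (cube_weight w (l(v := t), I)) (cube_weight w (l(v := t + 1), I))"
proof -
  have "finite I" "v \<notin> I"
    using assms v_notin finite_subset [OF _ finite_A] by (auto simp: cubes_quadrant_iff finite_A)
  then show ?thesis
    using cube_weight_face [of "insert v I" v w "l(v := t)"] by (simp add: upd_add_unit_vec_v)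
qed

lemma vertical_coboundary:
  assumes "(l, I) \<in> cubes base q" "0 \<le> t"
    and vanish: "\<And>l I. v \<in> I \<Longrightarrow> \<psi> (l, I) = 0"
  defines "C \<equiv> (l(v := t), insert v I)"
  shows "coboundary total w q \<psi> C = sgn_act (face_index (insert v I) v)
    (transport w C (l(v := t + 1), I) (\<psi> (l(v := t + 1), I)) - transport w C (l(v := t), I) (\<psi> (l(v := t), I)))"
proof -
  have fin: "finite I" "v \<notin> I"
    using assms v_notin finite_subset [OF _ finite_A] by (auto simp: cubes_quadrant_iff finite_A)
  have "face_diff w \<psi> C i = (if i = v then transport w C (l(v := t + 1), I) (\<psi> (l(v := t + 1), I)) -
      transport w C (l(v := t), I) (\<psi> (l(v := t), I)) else 0)" if "i \<in> insert v I" for i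
    using fin by (auto simp: C_def face_diff_def upd_add_unit_vec_v vanish)
  then have "coboundary total w q \<psi> C = (\<Sum>i\<in>insert v I. if i = v then
      sgn_act (face_index (insert v I) v) (transport w C (l(v := t + 1), I) (\<psi> (l(v := t + 1), I)) -
      transport w C (l(v := t), I) (\<psi> (l(v := t), I))) else 0)"
    unfolding C_def coboundary_eq [OF vertical_cube [OF assms(1,2)]] by (intro sum.cong) auto
  also have "\<dots> = sgn_act (face_index (insert v I) v) (transport w C (l(v := t + 1), I) (\<psi> (l(v := t + 1), I)) -
      transport w C (l(v := t), I) (\<psi> (l(v := t), I)))"
    using fin by simp
  finally show ?thesis .
qed

lemma total_vertical_cases:
  assumes "(l, I) \<in> cubes total (Suc q)" "v \<in> I"
  obtains l' I' t where "l = l'(v := t)" "I = insert v I'" "(l', I') \<in> cubes base q" "0 \<le> t"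
proof
  show "l = (l(v := 0))(v := l v)" "I = insert v (I - {v})" "0 \<le> l v"
    using assms total_nonneg by (auto simp: cubes_quadrant_iff finite_A)
  show "(l(v := 0), I - {v}) \<in> cubes base q"
    using base_cube cubes_face(1) [OF assms] by blast
qed

text \<open>For a cochain supported on horizontal cubes this is a first order difference equation
  along each fibre. Away from the bottom the weight does not decrease, so a vertical cube has the
  weight of its farther end, and the unknown value there carries no power of \<open>U\<close>.
  Starting with 0 at the bottom, no division occurs.\<close>

lemma vertical_primitive:
  assumes "\<Phi> \<in> cochains total (Suc q)"
  obtains \<psi> where "\<psi> \<in> cochains total q"
    "\<And>l I. v \<in> I \<Longrightarrow> coboundary total w q \<psi> (l, I) = \<Phi> (l, I)"
    "\<And>d. \<Phi> \<in> homogeneous_cochains total w (Suc q) d \<Longrightarrow> \<psi> \<in> homogeneous_cochains total w q d"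
proof -
  define W where "W l I t = cube_weight w (l(v := t), I)" for l I t
  define D where "D l I t = sgn_act (face_index (insert v I) v) (\<Phi> (l(v := t), insert v I))" for l I t
  have "\<exists>g. g (bottom c) = 0 \<and>
      (\<forall>t\<ge>bottom c. g (t + 1) = D (fst c) (snd c) t +
        U_act (nat (W (fst c) (snd c) (t + 1) - W (fst c) (snd c) t)) (g t)) \<and>
      (\<forall>t<bottom c. g t = U_act (nat (W (fst c) (snd c) t - W (fst c) (snd c) (t + 1))) (g (t + 1)) -
        D (fst c) (snd c) t)" for c
    by (rule two_sided_recursion [of "bottom c" 0
          "\<lambda>t x. D (fst c) (snd c) t + U_act (nat (W (fst c) (snd c) (t + 1) - W (fst c) (snd c) t)) x"
          "\<lambda>t x. U_act (nat (W (fst c) (snd c) t - W (fst c) (snd c) (t + 1))) x - D (fst c) (snd c) t"]) blast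
  then obtain g where g0: "\<And>c. g c (bottom c) = 0"
    and g_up: "\<And>l I t. bottom (l, I) \<le> t \<Longrightarrow>
      g (l, I) (t + 1) = D l I t + U_act (nat (W l I (t + 1) - W l I t)) (g (l, I) t)"
    and g_down: "\<And>l I t. t < bottom (l, I) \<Longrightarrow>
      g (l, I) t = U_act (nat (W l I t - W l I (t + 1))) (g (l, I) (t + 1)) - D l I t"
    by (metis fst_conv snd_conv)
  define \<psi> where "\<psi> = (\<lambda>(l, I). if (l, I) \<in> cubes total q \<and> v \<notin> I then g (l(v := 0), I) (l v) else 0)"
  have \<psi>_g: "\<psi> (l(v := t), I) = g (l, I) t" if "(l, I) \<in> cubes base q" "0 \<le> t" for l I t
  proof -
    have "l \<in> base" "v \<notin> I"
      using that(1) v_notin by (auto simp: cubes_quadrant_iff finite_A)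
    then show ?thesis
      using horizontal_cube [OF that] by (simp add: \<psi>_def base_at_v)
  qed
  have cochain: "\<psi> \<in> cochains total q"
    by (auto simp: \<psi>_def cochains_def)
  have vertical: "coboundary total w q \<psi> (l, I) = \<Phi> (l, I)" if "v \<in> I" for l I
  proof (cases "(l, I) \<in> cubes total (Suc q)")
    case True
    from total_vertical_cases [OF this that] obtain l' I' t
      where eq: "l = l'(v := t)" "I = insert v I'" and b: "(l', I') \<in> cubes base q" and t: "0 \<le> t" .
    have l': "l' \<in> base" "I' \<subseteq> A" using b by (auto simp: cubes_quadrant_iff finite_A)
    let ?C = "(l'(v := t), insert v I')"
    have "transport w ?C (l'(v := t + 1), I') (g (l', I') (t + 1)) -
        transport w ?C (l'(v := t), I') (g (l', I') t) = D l' I' t"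
    proof (cases "bottom (l', I') \<le> t")
      case True
      from weight_up [OF l' True] g_up [OF True] show ?thesis
        by (simp add: transport_def vertical_weight [OF b] W_def)
    next
      case False
      with weight_down [OF l' t] g_down [of t l' I'] show ?thesis
        by (simp add: transport_def vertical_weight [OF b] W_def)
    qed
    moreover have "\<psi> (l, I) = 0" if "v \<in> I" for l I
      using that by (simp add: \<psi>_def)
    ultimately show ?thesis
      using t unfolding eq by (simp add: vertical_coboundary [OF b t] \<psi>_g [OF b] D_def)
  next
    case False
    then show ?thesis using assms by (simp add: coboundary_outside cochains_def)
  qed
  have "\<psi> \<in> homogeneous_cochains total w q d" if hom: "\<Phi> \<in> homogeneous_cochains total w (Suc q) d" for d
  proof -
    have g_degree: "T0_degree (d - 2 * W l I t) (g (l, I) t)" if b: "(l, I) \<in> cubes base q" and "0 \<le> t" for l I t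
    proof -
      have l: "l \<in> base" "I \<subseteq> A" using b by (auto simp: cubes_quadrant_iff finite_A)
      have D_degree: "T0_degree (d - 2 * max (W l I t) (W l I (t + 1))) (D l I t)" for t
        using hom by (auto simp: D_def homogeneous_cochains_iff W_def vertical_weight [OF b, symmetric]
            intro!: T0_degree_sgn_act)
      have up: "T0_degree (d - 2 * W l I t) (g (l, I) t)" if "bottom (l, I) \<le> t" for t
        using that
      proof (induction t rule: int_ge_induct)
        case base
        then show ?case by (simp add: g0)
      next
        case (step t)
        then show ?case
          using weight_up [OF l step(1)] D_degree [of t]
          by (auto simp: g_up [OF step(1)] W_def intro!: T0_degree_add T0_degree_U_act [OF step(2)])
      qed
      \<comment> \<open>The premise \<open>0 \<le> t\<close> sits inside the induction because the
        weights are known to fall only within the quadrant.\<close>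
      have down: "0 \<le> t \<longrightarrow> T0_degree (d - 2 * W l I t) (g (l, I) t)" if "t \<le> bottom (l, I)" for t
        using that
      proof (induction t rule: int_le_induct)
        case base
        then show ?case by (simp add: g0)
      next
        case (step t)
        show ?case
        proof
          assume t: "0 \<le> t - 1"
          with step have *: "t - 1 < bottom (l, I)" "T0_degree (d - 2 * W l I t) (g (l, I) t)"
            by auto
          have "W l I t \<le> W l I (t - 1)"
            using weight_down [OF l t *(1)] by (simp add: W_def)
          then show "T0_degree (d - 2 * W l I (t - 1)) (g (l, I) (t - 1))"
            using D_degree [of "t - 1"] g_down [OF *(1)]
            by (auto intro!: T0_degree_diff T0_degree_U_act [OF *(2)])
        qed
      qed
      from up down that show ?thesis by (meson linorder_le_cases)
    qed
    have "T0_degree (d - 2 * cube_weight w (l, I)) (\<psi> (l, I))" for l I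
    proof (cases "(l, I) \<in> cubes total q \<and> v \<notin> I")
      case True
      then show ?thesis
        using g_degree [OF base_cube [of l I q] total_nonneg [of l]]
        by (auto simp: \<psi>_def W_def cubes_quadrant_iff finite_A)
    qed (auto simp: \<psi>_def)
    with cochain show ?thesis by (auto simp: homogeneous_cochains_iff)
  qed
  with that cochain vertical show ?thesis by blast
qed

text \<open>The values at the bottom define the cochain on the base. The cocycle condition on
  vertical cubes then determines each value from its neighbour nearer to the bottom, again because
  the farther end carries \<open>U^0\<close>.\<close>

lemma horizontal_eq_pullback:
  assumes \<Phi>: "\<Phi> \<in> cochains total q" and vanish: "\<And>l I. v \<in> I \<Longrightarrow> \<Phi> (l, I) = 0"
    and cocycle: "\<And>l I. v \<in> I \<Longrightarrow> coboundary total w q \<Phi> (l, I) = 0"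
  obtains \<phi> where "\<phi> \<in> cochains base q" "pullback q \<phi> = \<Phi>"
    "\<And>d. \<Phi> \<in> homogeneous_cochains total w q d \<Longrightarrow> \<phi> \<in> homogeneous_cochains base wb q d"
proof -
  define \<phi> where "\<phi> = (\<lambda>(l, I). if (l, I) \<in> cubes base q then \<Phi> (l(v := bottom (l, I)), I) else 0)"
  have cochain: "\<phi> \<in> cochains base q"
    by (auto simp: \<phi>_def cochains_def)
  have eq: "\<Phi> (l(v := t), I) = U_act (nat (cube_weight w (l(v := t), I) - cube_weight wb (l, I))) (\<phi> (l, I))"
    if b: "(l, I) \<in> cubes base q" and "0 \<le> t" for l I t
  proof -
    have l: "l \<in> base" "I \<subseteq> A" using b by (auto simp: cubes_quadrant_iff finite_A)
    define W where "W t = cube_weight w (l(v := t), I)" for t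
    define F where "F t = \<Phi> (l(v := t), I)" for t
    define m where "m = cube_weight wb (l, I)"
    \<comment> \<open>Whichever end of the vertical edge has the larger weight gets exponent 0
      here.\<close>
    have rel: "U_act (nat (max (W t) (W (t + 1)) - W (t + 1))) (F (t + 1)) =
        U_act (nat (max (W t) (W (t + 1)) - W t)) (F t)" if "0 \<le> t" for t
      using cocycle [of "insert v I" "l(v := t)"] vertical_coboundary [OF b that, of \<Phi>] vanish
      by (simp add: transport_def vertical_weight [OF b] W_def F_def)
    have m_le: "m \<le> W t" if "0 \<le> t" for t
      using weight_ge [OF l that] by (simp add: m_def W_def)
    have bottom: "F (bottom (l, I)) = U_act (nat (W (bottom (l, I)) - m)) (\<phi> (l, I))"
      using b by (simp add: \<phi>_def weight_bottom [OF l] F_def W_def m_def)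
    have up: "F t = U_act (nat (W t - m)) (\<phi> (l, I))" if "bottom (l, I) \<le> t" for t
      using that
    proof (induction t rule: int_ge_induct)
      case base
      then show ?case by (rule bottom)
    next
      case (step t)
      have t: "0 \<le> t" using step(1) bottom_nonneg [OF l] by simp
      have "W t \<le> W (t + 1)"
        using weight_up [OF l step(1)] by (simp add: W_def)
      then show ?case
        using rel [OF t] step(2) m_le [OF t] by (simp add: nat_add_distrib [symmetric])
    qed
    have down: "0 \<le> t \<longrightarrow> F t = U_act (nat (W t - m)) (\<phi> (l, I))" if "t \<le> bottom (l, I)" for t
      using that
    proof (induction t rule: int_le_induct)
      case base
      show ?case using bottom by simp
    next
      case (step t)
      show ?case
      proof
        assume t: "0 \<le> t - 1"
        have "W t \<le> W (t - 1)"
          using weight_down [OF l t] step by (simp add: W_def)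
        then show "F (t - 1) = U_act (nat (W (t - 1) - m)) (\<phi> (l, I))"
          using rel [OF t] step(2) m_le [of t] t by (simp add: nat_add_distrib [symmetric])
      qed
    qed
    have "F t = U_act (nat (W t - m)) (\<phi> (l, I))"
      using up [of t] down [of t] that by linarith
    then show ?thesis by (simp add: F_def W_def m_def)
  qed
  have "pullback q \<phi> (l, I) = \<Phi> (l, I)" for l I
  proof (cases "(l, I) \<in> cubes total q \<and> v \<notin> I")
    case True
    then have "0 \<le> l v" by (auto simp: cubes_quadrant_iff finite_A total_nonneg)
    from eq [OF base_cube [of l I] this] True show ?thesis by (simp add: pullback_def)
  next
    case False
    then show ?thesis using \<Phi> vanish by (auto simp: pullback_def cochains_def)
  qed
  then have "pullback q \<phi> = \<Phi>" by auto
  moreover have "\<phi> \<in> homogeneous_cochains base wb q d" if "\<Phi> \<in> homogeneous_cochains total w q d" for d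
  proof -
    have "T0_degree (d - 2 * cube_weight wb (l, I)) (\<phi> (l, I))" for l I
    proof (cases "(l, I) \<in> cubes base q")
      case True
      then have "cube_weight wb (l, I) = cube_weight w (l(v := bottom (l, I)), I)"
        by (auto simp: cubes_quadrant_iff finite_A weight_bottom)
      then show ?thesis using that True by (simp add: \<phi>_def homogeneous_cochains_iff)
    qed (simp add: \<phi>_def)
    with cochain show ?thesis by (auto simp: homogeneous_cochains_iff)
  qed
  ultimately show ?thesis using that cochain by blast
qed

text \<open>Subtracting the coboundary of a vertical primitive leaves a cochain that vanishes on
  vertical cubes. Closedness is demanded only on vertical cubes, so that the lemma also applies to a
  primitive of a pullback, which need not be closed.\<close>

lemma cohomologous_to_pullback:
  assumes \<Phi>: "\<Phi> \<in> cochains total q"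
    and cocycle: "\<And>l I. v \<in> I \<Longrightarrow> coboundary total w q \<Phi> (l, I) = 0"
  obtains \<phi> where "\<phi> \<in> cochains base q" "\<Phi> - pullback q \<phi> \<in> coboundaries total w q"
    "\<And>d. \<Phi> \<in> homogeneous_cochains total w q d \<Longrightarrow> \<phi> \<in> homogeneous_cochains base wb q d"
proof -
  have "\<exists>\<beta>\<in>coboundaries total w q. (\<forall>l I. v \<in> I \<longrightarrow> \<beta> (l, I) = \<Phi> (l, I)) \<and>
      (\<forall>d. \<Phi> \<in> homogeneous_cochains total w q d \<longrightarrow> \<beta> \<in> homogeneous_cochains total w q d)"
  proof (cases q)
    case 0
    have "\<Phi> (l, I) = 0" if "v \<in> I" for l I
    proof -
      have "(l, I) \<notin> cubes total q" using that by (auto simp: 0 cubes_def)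
      with \<Phi> show ?thesis by (simp add: cochains_def)
    qed
    then show ?thesis
      by (intro bexI [of _ 0] conjI) (auto simp: coboundaries_zero homogeneous_cochains_iff cochains_def)
  next
    case (Suc r)
    from vertical_primitive [OF \<Phi> [unfolded Suc]] obtain \<psi> where "\<psi> \<in> cochains total r"
      "\<And>l I. v \<in> I \<Longrightarrow> coboundary total w r \<psi> (l, I) = \<Phi> (l, I)"
      "\<And>d. \<Phi> \<in> homogeneous_cochains total w (Suc r) d \<Longrightarrow> \<psi> \<in> homogeneous_cochains total w r d"
      by blast
    then show ?thesis
      unfolding Suc
      by (intro bexI [of _ "coboundary total w r \<psi>"])
        (auto simp: coboundaries_def intro: homogeneous_cochains_coboundary)
  qed
  then obtain \<beta> where \<beta>: "\<beta> \<in> coboundaries total w q" "\<And>l I. v \<in> I \<Longrightarrow> \<beta> (l, I) = \<Phi> (l, I)"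
    "\<And>d. \<Phi> \<in> homogeneous_cochains total w q d \<Longrightarrow> \<beta> \<in> homogeneous_cochains total w q d"
    by blast
  then have "\<beta> \<in> cocycles total w q"
    using coboundaries_subset_cocycles by blast
  then have "\<Phi> - \<beta> \<in> cochains total q" "\<And>l I. v \<in> I \<Longrightarrow> (\<Phi> - \<beta>) (l, I) = 0"
    "\<And>l I. v \<in> I \<Longrightarrow> coboundary total w q (\<Phi> - \<beta>) (l, I) = 0"
    using \<Phi> \<beta>(2) cocycle by (auto simp: cocycles_def cochains_def coboundary_diff)
  from horizontal_eq_pullback [OF this] obtain \<phi> where \<phi>: "\<phi> \<in> cochains base q" "pullback q \<phi> = \<Phi> - \<beta>"
    "\<And>d. \<Phi> - \<beta> \<in> homogeneous_cochains total w q d \<Longrightarrow> \<phi> \<in> homogeneous_cochains base wb q d"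
    by blast
  show ?thesis
  proof
    show "\<phi> \<in> cochains base q" by (fact \<phi>(1))
    show "\<Phi> - pullback q \<phi> \<in> coboundaries total w q" by (simp add: \<phi>(2) \<beta>(1))
    show "\<phi> \<in> homogeneous_cochains base wb q d" if "\<Phi> \<in> homogeneous_cochains total w q d" for d
      using that \<beta>(3) \<phi>(3) homogeneous_cochains_diff by blast
  qed
qed

lemma projection_iso:
  "graded_module_iso (lattice_cohomology base wb q) (lattice_cohomology total w q)"
proof (rule lattice_cohomology_isoI [where h = "pullback q"])
  have pullback_zero: "pullback q 0 = 0" for q
    by (auto simp: pullback_def fun_eq_iff)
  show "pullback q (\<phi> + \<psi>) = pullback q \<phi> + pullback q \<psi>" for \<phi> \<psi>
    by (auto simp: pullback_def fun_eq_iff U_act_add)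
  show "pullback q (cochain_smult p \<phi>) = cochain_smult p (pullback q \<phi>)" for p \<phi>
    by (auto simp: pullback_def cochain_smult_def fun_eq_iff T0_smult_U_act)
  show "pullback q \<phi> \<in> cocycles total w q" if "\<phi> \<in> cocycles base wb q" for \<phi>
    using that by (simp add: cocycles_def coboundary_pullback pullback_zero pullback_in_cochains)
  show "pullback q \<phi> \<in> homogeneous_cochains total w q d"
    if "\<phi> \<in> homogeneous_cochains base wb q d" for \<phi> d
    using that by (rule pullback_homogeneous)
  show "pullback q \<phi> \<in> coboundaries total w q \<longleftrightarrow> \<phi> \<in> coboundaries base wb q"
    if "\<phi> \<in> cocycles base wb q" for \<phi>
  proof (cases q)
    case 0
    then show ?thesis
      using that pullback_inject [of \<phi> 0] by (auto simp: coboundaries_def cocycles_def pullback_zero)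
  next
    case (Suc r)
    have \<phi>: "\<phi> \<in> cochains base (Suc r)" using that by (simp add: cocycles_def Suc)
    show ?thesis
    proof
      assume "pullback q \<phi> \<in> coboundaries total w q"
      then obtain \<Psi> where \<Psi>: "\<Psi> \<in> cochains total r" "pullback (Suc r) \<phi> = coboundary total w r \<Psi>"
        by (auto simp: Suc coboundaries_def)
      \<comment> \<open>\<open>\<Psi>\<close> need not be a cocycle, but its coboundary is a
        pullback and so vanishes on vertical cubes.\<close>
      then have "coboundary total w r \<Psi> (l, I) = 0" if "v \<in> I" for l I
        using that by (simp flip: \<Psi>(2)) (simp add: pullback_def)
      from cohomologous_to_pullback [OF \<Psi>(1) this] obtain \<psi> where \<psi>: "\<psi> \<in> cochains base r"
        "\<Psi> - pullback r \<psi> \<in> coboundaries total w r" by blast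
      from subsetD [OF coboundaries_subset_cocycles \<psi>(2)]
      have "coboundary total w r (\<Psi> - pullback r \<psi>) = 0"
        by (simp add: cocycles_def)
      then have "pullback (Suc r) (\<phi> - coboundary base wb r \<psi>) = 0"
        by (simp add: coboundary_diff coboundary_pullback pullback_diff \<Psi>(2))
      moreover have "\<phi> - coboundary base wb r \<psi> \<in> cochains base (Suc r)"
        using \<phi> coboundary_in_cochains [of base wb r \<psi>] by (simp add: cochains_def)
      ultimately have "\<phi> = coboundary base wb r \<psi>"
        using pullback_inject by fastforce
      with \<psi>(1) show "\<phi> \<in> coboundaries base wb q"
        by (auto simp: Suc coboundaries_def)
    next
      assume "\<phi> \<in> coboundaries base wb q"
      then show "pullback q \<phi> \<in> coboundaries total w q"
        by (auto simp: Suc coboundaries_def coboundary_pullback [symmetric] intro!: imageI pullback_in_cochains)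
    qed
  qed
  fix \<Phi> assume \<Phi>: "\<Phi> \<in> cocycles total w q"
  then have "\<Phi> \<in> cochains total q" "\<And>l I. coboundary total w q \<Phi> (l, I) = 0"
    by (auto simp: cocycles_def)
  from cohomologous_to_pullback [OF this] obtain \<phi> where \<phi>: "\<phi> \<in> cochains base q"
    "\<Phi> - pullback q \<phi> \<in> coboundaries total w q"
    "\<And>d. \<Phi> \<in> homogeneous_cochains total w q d \<Longrightarrow> \<phi> \<in> homogeneous_cochains base wb q d"
    by blast
  from subsetD [OF coboundaries_subset_cocycles \<phi>(2)]
  have "coboundary total w q (\<Phi> - pullback q \<phi>) = 0"
    by (simp add: cocycles_def)
  \<comment> \<open>The cochain \<open>\<phi>\<close> was only read off at the bottoms; that it is
    closed follows from injectivity of the pullback.\<close>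
  then have "pullback (Suc q) (coboundary base wb q \<phi>) = 0"
    using \<Phi> by (simp add: coboundary_diff coboundary_pullback cocycles_def)
  then have "coboundary base wb q \<phi> = 0"
    using pullback_inject coboundary_in_cochains by blast
  with \<phi> show "\<exists>\<phi>\<in>cocycles base wb q. \<Phi> - pullback q \<phi> \<in> coboundaries total w q \<and>
      (\<forall>d. \<Phi> \<in> homogeneous_cochains total w q d \<longrightarrow> \<phi> \<in> homogeneous_cochains base wb q d)"
    by (auto simp: cocycles_def)
qed

end

section \<open>Weights minimised over fibres\<close>

lemma the_minimal_eq:
  assumes "x \<in> S" "\<And>y. y \<in> S \<Longrightarrow> x \<le> y"
  shows "the_minimal S = x"
  unfolding the_minimal_def
proof (rule the_equality)
  show "x \<in> S \<and> (\<forall>y\<in>S. y \<le> x \<longrightarrow> y = x)"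
    using assms by (auto intro: order.antisym)
  show "y = x" if "y \<in> S \<and> (\<forall>z\<in>S. z \<le> y \<longrightarrow> z = y)" for y
    using assms that by metis
qed

text \<open>An element with least coordinate sum works: if it were not below \<open>y\<close>, its
  infimum with \<open>y\<close> would have a smaller sum.\<close>

lemma ex_least_lattice_point:
  fixes S :: "('v \<Rightarrow> int) set"
  assumes "finite V" "S \<subseteq> lattice V" "S \<noteq> {}"
    and inf_closed: "\<And>x y. x \<in> S \<Longrightarrow> y \<in> S \<Longrightarrow> inf x y \<in> S"
    and bounded: "\<And>x v. x \<in> S \<Longrightarrow> v \<in> V \<Longrightarrow> b v \<le> x v"
  obtains x where "x \<in> S" "\<And>y. y \<in> S \<Longrightarrow> x \<le> y"
proof -
  let ?m = "\<lambda>x. nat (\<Sum>v\<in>V. x v - b v)"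
  from assms(3) obtain x where x: "x \<in> S" "\<And>y. y \<in> S \<Longrightarrow> ?m x \<le> ?m y"
    using ex_has_least_nat [of "\<lambda>x. x \<in> S" _ ?m] by blast
  have "x \<le> y" if "y \<in> S" for y
  proof (rule ccontr)
    assume "\<not> x \<le> y"
    then obtain v where v: "y v < x v"
      by (auto simp: le_fun_def not_le)
    have "v \<in> V"
    proof (rule ccontr)
      assume "v \<notin> V"
      then have "x v = 0" "y v = 0"
        using assms(2) x(1) that by (auto simp: lattice_def)
      with v show False by simp
    qed
    have xy: "inf x y \<in> S" by (rule inf_closed [OF x(1) that])
    have "(\<Sum>u\<in>V. inf x y u - b u) < (\<Sum>u\<in>V. x u - b u)"
      using assms(1) \<open>v \<in> V\<close> v by (intro sum_strict_mono_ex1 bexI [of _ v]) (auto simp: inf_min)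
    moreover have "0 \<le> (\<Sum>u\<in>V. inf x y u - b u)"
      using bounded [OF xy] by (intro sum_nonneg) auto
    ultimately have "?m (inf x y) < ?m x" by simp
    with x(2) [OF xy] show False by linarith
  qed
  with x(1) that show ?thesis by blast
qed

text \<open>\<open>M\<close> is the intersection matrix and \<open>\<rho> j\<close> stands for
  \<open>(l', E_j)\<close> where \<open>k = k_can + 2l'\<close>; by adjunction
  \<open>(k, E_j) = - M j j - 2 + 2 * \<rho> j\<close>, and the last assumption reads
  \<open>2\<chi>(x) = -(x, x + k)\<close>. The positive, strictly anti-nef cycle \<open>Z\<close>
  takes the place of negative definiteness.\<close>

locale integral_weight =
  fixes V :: "'v::linorder set" and M :: "'v \<Rightarrow> 'v \<Rightarrow> int" and \<rho> :: "'v \<Rightarrow> int"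
    and \<chi> :: "('v \<Rightarrow> int) \<Rightarrow> int" and Z :: "'v \<Rightarrow> int"
  assumes finite_V: "finite V"
    and M_sym: "M i j = M j i"
    and M_nonneg: "i \<noteq> j \<Longrightarrow> 0 \<le> M i j"
    and Z_pos: "j \<in> V \<Longrightarrow> 1 \<le> Z j"
    and Z_neg: "j \<in> V \<Longrightarrow> (\<Sum>i\<in>V. Z i * M i j) \<le> - 1"
    and chi: "x \<in> lattice V \<Longrightarrow>
      2 * \<chi> x = (\<Sum>j\<in>V. x j * (M j j + 2 - 2 * \<rho> j - (\<Sum>i\<in>V. x i * M i j)))"
begin

section \<open>The intersection numbers \<open>pr x j\<close>, that is \<open>(x, E_j)\<close>, and
  the quadratic function \<open>\<chi>\<close>\<close>

definition pr :: "('v \<Rightarrow> int) \<Rightarrow> 'v \<Rightarrow> int" where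
  "pr x j = (\<Sum>i\<in>V. x i * M i j)"

lemma pr_add: "pr (x + y) j = pr x j + pr y j"
  by (simp add: pr_def distrib_right sum.distrib)

lemma pr_diff: "pr (x - y) j = pr x j - pr y j"
  by (simp add: pr_def left_diff_distrib sum_subtractf)

lemma pr_unit_vec: "i \<in> V \<Longrightarrow> pr (unit_vec i) j = M i j"
  using finite_V by (simp add: pr_def unit_vec_def if_distrib [of "\<lambda>a. a * _"] cong: if_cong)

text \<open>The only possibly negative coefficient is the diagonal one, and it meets equal
  coordinates.\<close>

lemma pr_mono:
  assumes "\<And>i. i \<in> V \<Longrightarrow> x i \<le> y i" "x j = y j"
  shows "pr x j \<le> pr y j"
  unfolding pr_def
proof (rule sum_mono)
  fix i assume "i \<in> V"
  then show "x i * M i j \<le> y i * M i j"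
    using assms M_nonneg [of i j] by (cases "i = j") (auto intro: mult_right_mono)
qed

lemma pr_inf: "x j \<le> y j \<Longrightarrow> pr (inf x y) j \<le> pr x j"
  by (rule pr_mono) (auto simp: inf_min)

lemma pr_inf_le:
  assumes "pr x j + r \<le> 0" "pr y j + r \<le> 0"
  shows "pr (inf x y) j + r \<le> 0"
  using pr_inf [of x j y] pr_inf [of y j x] assms
  by (cases "x j \<le> y j") (auto simp: inf_commute)

lemma sum_pr_commute: "(\<Sum>j\<in>V. x j * pr y j) = (\<Sum>j\<in>V. y j * pr x j)"
proof -
  have "(\<Sum>j\<in>V. x j * pr y j) = (\<Sum>j\<in>V. \<Sum>i\<in>V. x j * (y i * M i j))"
    by (simp add: pr_def sum_distrib_left)
  also have "\<dots> = (\<Sum>i\<in>V. \<Sum>j\<in>V. x j * (y i * M i j))"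
    by (rule sum.swap)
  also have "\<dots> = (\<Sum>j\<in>V. y j * pr x j)"
    by (simp add: pr_def sum_distrib_left M_sym mult.left_commute)
  finally show ?thesis .
qed

lemma chi_pr: "x \<in> lattice V \<Longrightarrow> 2 * \<chi> x = (\<Sum>j\<in>V. x j * (M j j + 2 - 2 * \<rho> j - pr x j))"
  by (simp add: chi pr_def)

lemma add_in_lattice: "x \<in> lattice V \<Longrightarrow> y \<in> lattice V \<Longrightarrow> x + y \<in> lattice V"
  by (simp add: lattice_def)

lemma diff_in_lattice: "x \<in> lattice V \<Longrightarrow> y \<in> lattice V \<Longrightarrow> x - y \<in> lattice V"
  by (simp add: lattice_def)

lemma unit_vec_in_lattice: "j \<in> V \<Longrightarrow> unit_vec j \<in> lattice V"
  by (auto simp: lattice_def unit_vec_def)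

lemma inf_in_lattice: "x \<in> lattice V \<Longrightarrow> y \<in> lattice V \<Longrightarrow> inf x y \<in> lattice V"
  by (simp add: lattice_def)

lemma sup_in_lattice: "x \<in> lattice V \<Longrightarrow> y \<in> lattice V \<Longrightarrow> sup x y \<in> lattice V"
  by (simp add: lattice_def)

lemma chi_add:
  assumes "x \<in> lattice V" "y \<in> lattice V"
  shows "\<chi> (x + y) = \<chi> x + \<chi> y - (\<Sum>j\<in>V. y j * pr x j)"
proof -
  have "2 * \<chi> (x + y) = (\<Sum>j\<in>V. (x j + y j) * (M j j + 2 - 2 * \<rho> j - (pr x j + pr y j)))"
    by (simp add: chi_pr add_in_lattice assms pr_add)
  also have "\<dots> = (\<Sum>j\<in>V. x j * (M j j + 2 - 2 * \<rho> j - pr x j)) + (\<Sum>j\<in>V. y j * (M j j + 2 - 2 * \<rho> j - pr y j))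
      - (\<Sum>j\<in>V. y j * pr x j) - (\<Sum>j\<in>V. x j * pr y j)"
    by (simp add: sum.distrib [symmetric] sum_subtractf [symmetric] algebra_simps)
  also have "\<dots> = 2 * \<chi> x + 2 * \<chi> y - 2 * (\<Sum>j\<in>V. y j * pr x j)"
    by (simp add: chi_pr assms sum_pr_commute [of x y])
  finally show ?thesis by simp
qed

lemma sum_unit_vec_mult: "j \<in> V \<Longrightarrow> (\<Sum>i\<in>V. unit_vec j i * f i) = (f j :: int)"
  using finite_V by (simp add: unit_vec_def if_distrib [of "\<lambda>a. a * _"] cong: if_cong)

text \<open>The engine of all computation sequences: raising the coordinate \<open>j\<close> does
  not increase \<open>\<chi>\<close> exactly when \<open>pr x j + \<rho> j\<close> is at least
  1.\<close>

lemma chi_step: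
  assumes "x \<in> lattice V" "j \<in> V"
  shows "\<chi> (x + unit_vec j) = \<chi> x + 1 - pr x j - \<rho> j"
proof -
  have "2 * \<chi> (unit_vec j) = 2 - 2 * \<rho> j"
    using assms by (simp add: chi_pr unit_vec_in_lattice sum_unit_vec_mult pr_unit_vec)
  then show ?thesis
    using assms by (simp add: chi_add unit_vec_in_lattice sum_unit_vec_mult)
qed

text \<open>The parts \<open>a\<close>, \<open>b\<close> of \<open>x\<close>, \<open>y\<close> above
  their infimum are effective with disjoint supports, so \<open>(a, b) \<ge> 0\<close>; the two
  sides differ by this number.\<close>

lemma chi_submodular:
  assumes "x \<in> lattice V" "y \<in> lattice V"
  shows "\<chi> (inf x y) + \<chi> (sup x y) \<le> \<chi> x + \<chi> y"
proof -
  define m a b where "m = inf x y" and "a = x - inf x y" and "b = y - inf x y"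
  have mem: "m \<in> lattice V" "a \<in> lattice V" "b \<in> lattice V"
    using assms by (auto simp: m_def a_def b_def intro: inf_in_lattice diff_in_lattice)
  have eq: "x = m + a" "y = m + b" "sup x y = m + a + b"
    by (auto simp: m_def a_def b_def fun_eq_iff inf_min sup_max)
  have "0 \<le> (\<Sum>j\<in>V. b j * pr a j)"
  proof (rule sum_nonneg)
    fix j assume "j \<in> V"
    have "0 \<le> a i" "0 \<le> b i" for i by (auto simp: a_def b_def)
    moreover have "b j = 0 \<or> a j = 0" by (auto simp: a_def b_def inf_min)
    ultimately show "0 \<le> b j * pr a j"
      using pr_mono [of 0 a j] by (auto simp: pr_def)
  qed
  moreover have "\<chi> (m + a + b) = \<chi> (m + a) + \<chi> b - (\<Sum>j\<in>V. b j * pr m j) - (\<Sum>j\<in>V. b j * pr a j)"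
    using mem by (simp add: chi_add add_in_lattice pr_add distrib_left sum.distrib)
  moreover have "\<chi> (m + b) = \<chi> m + \<chi> b - (\<Sum>j\<in>V. b j * pr m j)"
    using mem by (simp add: chi_add)
  ultimately show ?thesis
    by (simp add: eq(3) m_def [symmetric]) (simp add: eq(1,2))
qed

section \<open>Least cycles with prescribed coordinates\<close>

definition feasible :: "'v set \<Rightarrow> ('v \<Rightarrow> int) \<Rightarrow> ('v \<Rightarrow> int) set" where
  "feasible A i = {x \<in> lattice V. (\<forall>j\<in>A. x j = i j) \<and> (\<forall>j\<in>V - A. pr x j + \<rho> j \<le> 0)}"

definition xs :: "'v set \<Rightarrow> ('v \<Rightarrow> int) \<Rightarrow> 'v \<Rightarrow> int" where
  "xs A i = the_minimal (feasible A i)"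

definition wt :: "'v set \<Rightarrow> ('v \<Rightarrow> int) \<Rightarrow> int" where
  "wt A i = \<chi> (xs A i)"

text \<open>Anti-nef conditions survive infima, so a feasible point and a lower bound suffice.
  Multiples of \<open>Z\<close> provide both.\<close>

lemma ex_least_feasible:
  assumes "A \<subseteq> V"
  obtains x where "x \<in> feasible A i" "\<And>y. y \<in> feasible A i \<Longrightarrow> x \<le> y"
proof -
  \<comment> \<open>Large enough to dominate the prescribed coordinates and every
    \<open>\<rho> j\<close>, so that \<open>n * Z\<close> outside \<open>A\<close> is feasible and
    \<open>- n * Z\<close> bounds from below.\<close>
  define n where "n = (\<Sum>j\<in>V. \<bar>i j\<bar> + \<bar>\<rho> j\<bar>)"
  have n: "\<bar>i j\<bar> + \<bar>\<rho> j\<bar> \<le> n" if "j \<in> V" for j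
    unfolding n_def using finite_V that by (intro member_le_sum) auto
  then have n': "\<bar>i j\<bar> \<le> n" "\<bar>\<rho> j\<bar> \<le> n" if "j \<in> V" for j
    using that by force+
  have n_nonneg: "0 \<le> n" unfolding n_def by (intro sum_nonneg) auto
  have nZ: "n \<le> n * Z j" if "j \<in> V" for j
    using mult_left_mono [OF Z_pos [OF that] n_nonneg] by simp
  have pr_Z: "n * pr Z j \<le> - n" if "j \<in> V" for j
    using mult_left_mono [OF Z_neg [OF that] n_nonneg] by (simp add: pr_def)
  define x where "x = (\<lambda>j. if j \<in> A then i j else if j \<in> V then n * Z j else 0)"
  have "pr x j + \<rho> j \<le> 0" if j: "j \<in> V - A" for j
  proof -
    have "pr x j \<le> pr (\<lambda>j. n * Z j) j"
    proof (rule pr_mono)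
      show "x u \<le> n * Z u" if "u \<in> V" for u
        using n' [OF that] nZ [OF that] by (auto simp: x_def)
    qed (use j in \<open>simp add: x_def\<close>)
    also have "\<dots> = n * pr Z j"
      by (simp add: pr_def sum_distrib_left mult.assoc)
    finally show ?thesis using pr_Z [of j] n' [of j] j by fastforce
  qed
  then have "x \<in> feasible A i"
    using assms by (auto simp: feasible_def x_def lattice_def)
  moreover have "feasible A i \<subseteq> lattice V" by (auto simp: feasible_def)
  moreover have "inf x y \<in> feasible A i" if "x \<in> feasible A i" "y \<in> feasible A i" for x y
    using that by (auto simp: feasible_def inf_in_lattice pr_inf_le)
  moreover have "- (n * Z v) \<le> x v" if x: "x \<in> feasible A i" and v: "v \<in> V" for x v
  proof (rule ccontr)
    assume less: "\<not> - (n * Z v) \<le> x v"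
    let ?r = "\<lambda>u. of_int (x u) / of_int (Z u) :: rat"
    \<comment> \<open>At the index with the least ratio \<open>x j / Z j\<close> the cycle
      \<open>(x j / Z j) * Z\<close> lies below \<open>x\<close> and touches it, whence
      \<open>(x, E_j) \<ge> - x j / Z j > n\<close>, too large for an anti-nef condition.\<close>
    obtain j where j: "j \<in> V" "\<And>u. u \<in> V \<Longrightarrow> ?r j \<le> ?r u"
      using finite_V v ex_min_if_finite [of "?r ` V"] by (fastforce simp: not_less)
    have cross: "x j * Z u \<le> x u * Z j" if "u \<in> V" for u
    proof -
      have "(0::rat) < of_int (Z j)" "(0::rat) < of_int (Z u)"
        using Z_pos j(1) that by fastforce+
      then have "(of_int (x j * Z u) :: rat) \<le> of_int (x u * Z j)"
        using j(2) [OF that] by (simp add: field_simps)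
      then show ?thesis by (simp only: of_int_le_iff)
    qed
    have Zj: "0 < Z j" "0 < Z v" using Z_pos [OF j(1)] Z_pos [OF v] by auto
    have "x j * Z v < - (n * Z v) * Z j"
      using cross [OF v] less Zj by (meson le_less_trans linorder_not_le mult_strict_right_mono)
    then have "x j * Z v < - (n * Z j) * Z v" by (simp add: algebra_simps)
    then have xj: "x j < - (n * Z j)" using Zj(2) by (simp only: mult_less_cancel_right_pos)
    have "j \<notin> A"
      using x xj nZ [OF j(1)] n'(1) [OF j(1)] by (auto simp: feasible_def)
    with x j(1) have fe: "pr x j + \<rho> j \<le> 0" by (auto simp: feasible_def)
    have "x j * pr Z j = (\<Sum>u\<in>V. (x j * Z u) * M u j)"
      by (simp add: pr_def sum_distrib_left mult.assoc)
    also have "\<dots> \<le> (\<Sum>u\<in>V. (x u * Z j) * M u j)"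
    proof (rule sum_mono)
      fix u assume "u \<in> V"
      then show "(x j * Z u) * M u j \<le> (x u * Z j) * M u j"
        using cross M_nonneg [of u j] by (cases "u = j") (auto intro: mult_right_mono)
    qed
    also have "\<dots> = Z j * pr x j"
      by (simp add: pr_def sum_distrib_left mult.commute mult.left_commute)
    finally have "x j * pr Z j \<le> Z j * pr x j" .
    moreover have "- x j \<le> x j * pr Z j"
    proof -
      have "x j \<le> 0" using xj nZ [OF j(1)] n_nonneg by linarith
      then show ?thesis
        using mult_left_mono_neg [of "pr Z j" "- 1" "x j"] Z_neg [OF j(1)] by (simp add: pr_def)
    qed
    ultimately have "n * Z j < pr x j * Z j" using xj by (simp add: mult.commute)
    then have "n < pr x j" using Zj by (simp add: mult_less_cancel_right)
    with fe n'(2) [OF j(1)] show False by linarith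
  qed
  ultimately show ?thesis
    using ex_least_lattice_point [OF finite_V, of "feasible A i" "\<lambda>v. - (n * Z v)"] that by blast
qed

lemma xs_feasible: "A \<subseteq> V \<Longrightarrow> xs A i \<in> feasible A i"
  and xs_le: "A \<subseteq> V \<Longrightarrow> y \<in> feasible A i \<Longrightarrow> xs A i \<le> y"
proof -
  assume "A \<subseteq> V"
  then obtain x where x: "x \<in> feasible A i" "\<And>y. y \<in> feasible A i \<Longrightarrow> x \<le> y"
    using ex_least_feasible by metis
  then have "xs A i = x" unfolding xs_def by (rule the_minimal_eq)
  with x show "xs A i \<in> feasible A i" "y \<in> feasible A i \<Longrightarrow> xs A i \<le> y" by auto
qed

lemma xs_in_lattice: "A \<subseteq> V \<Longrightarrow> xs A i \<in> lattice V"
  and xs_on: "A \<subseteq> V \<Longrightarrow> j \<in> A \<Longrightarrow> xs A i j = i j"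
  and xs_anti_nef: "A \<subseteq> V \<Longrightarrow> j \<in> V \<Longrightarrow> j \<notin> A \<Longrightarrow> pr (xs A i) j + \<rho> j \<le> 0"
  using xs_feasible [of A i] by (auto simp: feasible_def)

text \<open>The infimum of the two cycles is feasible for the smaller data.\<close>

lemma xs_mono:
  assumes "A \<subseteq> V" "\<And>j. j \<in> A \<Longrightarrow> i j \<le> i' j"
  shows "xs A i \<le> xs A i'"
proof -
  have "inf (xs A i) (xs A i') \<in> feasible A i"
    using assms by (auto simp: feasible_def inf_in_lattice xs_in_lattice xs_on pr_inf_le xs_anti_nef inf_min)
  from xs_le [OF assms(1) this] show ?thesis by simp
qed

lemma xs_all: "i \<in> lattice V \<Longrightarrow> xs V i = i"
  unfolding xs_def
proof (rule the_minimal_eq)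
  show "i \<le> y" if "i \<in> lattice V" "y \<in> feasible V i" for y
  proof -
    have "y v = i v" for v
      using that by (cases "v \<in> V") (auto simp: feasible_def lattice_def)
    then show ?thesis by (simp add: le_fun_def)
  qed
qed (auto simp: feasible_def)

text \<open>Laufer's algorithm: an infeasible cycle below \<open>x(i)\<close> violates the condition
  at some \<open>j\<close> outside \<open>A\<close>, and raising \<open>j\<close> costs nothing. The
  result stays below \<open>x(i)\<close>, since equality at \<open>j\<close> would transfer the
  violation to \<open>x(i)\<close>.\<close>

lemma chi_laufer:
  assumes "A \<subseteq> V" "x \<in> lattice V" "\<And>j. j \<in> A \<Longrightarrow> x j = i j" "x \<le> xs A i"
  shows "wt A i \<le> \<chi> x"
  using assms(2-)
proof (induction "nat (\<Sum>j\<in>V. xs A i j - x j)" arbitrary: x rule: less_induct)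
  case less
  show ?case
  proof (cases "x = xs A i")
    case False
    have "x \<notin> feasible A i"
      using xs_le [OF assms(1), of x i] less.prems(3) False by (auto dest: order.antisym)
    then obtain j where j: "j \<in> V" "j \<notin> A" "1 \<le> pr x j + \<rho> j"
      using less.prems by (force simp: feasible_def)
    have "x j \<noteq> xs A i j"
      using pr_mono [of x "xs A i" j] xs_anti_nef [OF assms(1) j(1,2), of i] j(3) less.prems(3)
      by (auto simp: le_fun_def)
    then have xj: "x j < xs A i j"
      using less.prems(3) by (auto simp: le_fun_def order_less_le)
    let ?x = "x + unit_vec j"
    have le: "?x \<le> xs A i"
      using xj less.prems(3) by (auto simp: le_fun_def unit_vec_def)
    have "(\<Sum>u\<in>V. xs A i u - ?x u) < (\<Sum>u\<in>V. xs A i u - x u)"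
      using finite_V j(1) by (intro sum_strict_mono_ex1 bexI [of _ j]) (auto simp: unit_vec_def)
    moreover have "0 \<le> (\<Sum>u\<in>V. xs A i u - ?x u)"
      using le by (intro sum_nonneg) (auto simp: le_fun_def)
    ultimately have "wt A i \<le> \<chi> ?x"
      using j less.prems le
      by (intro less.hyps) (auto simp: unit_vec_in_lattice add_in_lattice, auto simp: unit_vec_def)
    also have "\<dots> \<le> \<chi> x"
      using chi_step [OF less.prems(1) j(1)] j(3) by simp
    finally show ?thesis .
  qed (simp add: wt_def)
qed

end

text \<open>In the graph with lowered decorations on \<open>B\<close>, rationality of a cycle with coefficients at
  most 1 on \<open>B\<close> does not depend on these decorations. This is how bad vertices are used.\<close>

locale rational_weight = integral_weight V M \<rho> \<chi> Z
  for V :: "'v::linorder set" and M \<rho> \<chi> Z +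
  fixes B :: "'v set"
  assumes B_subset: "B \<subseteq> V"
    and rho_nonpos: "j \<in> V \<Longrightarrow> \<rho> j \<le> 0"
    and rho_minimal: "m \<in> lattice V \<Longrightarrow> 0 < m \<Longrightarrow> \<exists>j\<in>V. 1 \<le> \<rho> j - (\<Sum>i\<in>V. m i * M i j)"
    and rational: "l \<in> lattice V \<Longrightarrow> 0 < l \<Longrightarrow> (\<And>j. j \<in> B \<Longrightarrow> l j \<le> 1) \<Longrightarrow>
      0 < (\<Sum>j\<in>V. l j * (M j j + 2 - (\<Sum>i\<in>V. l i * M i j)))"
begin

lemma rational_pr:
  assumes "l \<in> lattice V" "0 < l" "\<And>j. j \<in> B \<Longrightarrow> l j \<le> 1"
  shows "0 < (\<Sum>j\<in>V. l j * (M j j + 2 - pr l j))"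
  using rational [OF assms] by (simp add: pr_def)

text \<open>By submodularity it is enough to treat the infimum and the supremum of \<open>x\<close>
  with \<open>x(i)\<close>. The infimum falls to Laufer's algorithm. The supremum exceeds
  \<open>x(i)\<close> by an effective cycle vanishing on \<open>A\<close>, and adding such a nonzero
  cycle to \<open>x(i)\<close> raises \<open>\<chi>\<close> by rationality and anti-nefness.\<close>

lemma wt_le:
  assumes "B \<subseteq> A" "A \<subseteq> V" "x \<in> lattice V" "\<And>j. j \<in> A \<Longrightarrow> x j = i j"
  shows "wt A i \<le> \<chi> x"
proof -
  let ?y = "xs A i"
  have y: "?y \<in> lattice V" by (simp add: xs_in_lattice assms)
  have "wt A i \<le> \<chi> (inf x ?y)"
    using assms y by (intro chi_laufer) (auto simp: inf_in_lattice xs_on)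
  moreover have "wt A i \<le> \<chi> (sup x ?y)"
  proof (cases "sup x ?y = ?y")
    case False
    define l where "l = sup x ?y - ?y"
    have l: "l \<in> lattice V"
      using assms(3) y by (auto simp: l_def intro: diff_in_lattice sup_in_lattice)
    have l_nonneg: "0 \<le> l j" for j by (simp add: l_def)
    have l_A: "l j = 0" if "j \<in> A" for j
      using that assms by (simp add: l_def xs_on)
    have "0 < l"
      using False l_nonneg by (auto simp: less_le le_fun_def l_def)
    then have "0 < (\<Sum>j\<in>V. l j * (M j j + 2 - pr l j))"
      using l l_A assms(1) by (intro rational_pr) auto
    moreover have "(\<Sum>j\<in>V. l j * (\<rho> j + pr ?y j)) \<le> 0"
    proof (rule sum_nonpos)
      fix j assume "j \<in> V"
      then show "l j * (\<rho> j + pr ?y j) \<le> 0"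
        using l_A [of j] l_nonneg [of j] xs_anti_nef [OF assms(2), of j i]
        by (cases "j \<in> A") (auto simp: mult_nonneg_nonpos add.commute)
    qed
    moreover have "(\<Sum>j\<in>V. l j * (M j j + 2 - 2 * \<rho> j - pr l j)) =
        (\<Sum>j\<in>V. l j * (M j j + 2 - pr l j)) - 2 * (\<Sum>j\<in>V. l j * \<rho> j)"
      by (simp add: sum_distrib_left sum_subtractf [symmetric] algebra_simps)
    moreover have "(\<Sum>j\<in>V. l j * (\<rho> j + pr ?y j)) = (\<Sum>j\<in>V. l j * \<rho> j) + (\<Sum>j\<in>V. l j * pr ?y j)"
      by (simp add: distrib_left sum.distrib)
    moreover note chi_pr [OF l]
    ultimately have "0 < \<chi> l - (\<Sum>j\<in>V. l j * pr ?y j)"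
      by presburger
    then have "\<chi> ?y < \<chi> (?y + l)"
      using chi_add [OF y l] by simp
    then show ?thesis by (simp add: wt_def l_def)
  qed (simp add: wt_def)
  moreover have "\<chi> (inf x ?y) + \<chi> (sup x ?y) \<le> \<chi> x + wt A i"
    using chi_submodular [OF assms(3) y] by (simp add: wt_def)
  ultimately show ?thesis by simp
qed

text \<open>Infimum and supremum of the two minimising cycles lie over the infimum and supremum of
  the base points, so submodularity passes to fibre minima.\<close>

lemma wt_submodular:
  assumes "B \<subseteq> A" "A \<subseteq> V"
  shows "wt A (inf i i') + wt A (sup i i') \<le> wt A i + wt A i'"
proof -
  have "wt A (inf i i') \<le> \<chi> (inf (xs A i) (xs A i'))"
    using assms by (intro wt_le) (auto simp: xs_in_lattice inf_in_lattice xs_on)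
  moreover have "wt A (sup i i') \<le> \<chi> (sup (xs A i) (xs A i'))"
    using assms by (intro wt_le) (auto simp: xs_in_lattice sup_in_lattice xs_on)
  moreover have "\<chi> (inf (xs A i) (xs A i')) + \<chi> (sup (xs A i) (xs A i')) \<le> wt A i + wt A i'"
    unfolding wt_def using assms by (intro chi_submodular xs_in_lattice)
  ultimately show ?thesis by simp
qed

text \<open>Submodularity for \<open>p + unit_vec j\<close> and \<open>q\<close>, whose infimum is
  \<open>p\<close> and whose supremum is \<open>q + unit_vec j\<close>.\<close>

lemma wt_increment_antimono:
  assumes "B \<subseteq> A" "A \<subseteq> V" "p \<le> q" "p j = q j"
  shows "wt A (q + unit_vec j) - wt A q \<le> wt A (p + unit_vec j) - wt A p"
proof -
  have "p v \<le> q v" for v using assms(3) by (simp add: le_fun_def)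
  then have "inf (p + unit_vec j) q = p" "sup (p + unit_vec j) q = q + unit_vec j"
    using assms(4) by (auto simp: fun_eq_iff unit_vec_def inf_min sup_max)
  with wt_submodular [OF assms(1,2), of "p + unit_vec j" q] show ?thesis by simp
qed

text \<open>A computation sequence run backwards: rationality of \<open>l\<close> gives a
  \<open>j\<close> in its support with \<open>(l, E_j) \<le> M j j + 1\<close>, and since
  \<open>y\<close> is anti-nef at \<open>j\<close>, removing \<open>E_j\<close> does not raise
  \<open>\<chi>\<close>. This is repeated until \<open>j\<close> falls into \<open>S\<close>;
  positivity at \<open>s\<close> keeps \<open>l\<close> nonzero meanwhile.\<close>

lemma rational_descent:
  assumes "y \<in> lattice V" "\<And>j. j \<in> D \<Longrightarrow> pr y j + \<rho> j \<le> 0" "S \<subseteq> D" "s \<in> S"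
    and "l \<in> lattice V" "0 \<le> l" "\<And>j. j \<notin> D \<Longrightarrow> l j = 0" "\<And>j. j \<in> B \<Longrightarrow> l j \<le> 1" "0 < l s"
  shows "\<exists>l' j. j \<in> S \<and> j \<in> V \<and> l' \<in> lattice V \<and> 0 \<le> l' \<and> l' \<le> l \<and> (\<forall>u\<in>S. l' u = l u) \<and>
    \<chi> (y + l' - unit_vec j) \<le> \<chi> (y + l)"
  using assms(5-)
proof (induction "nat (\<Sum>j\<in>V. l j)" arbitrary: l rule: less_induct)
  case less
  have nonneg: "0 \<le> l u" for u using less.prems(2) by (simp add: le_fun_def)
  have "0 < l"
    using less.prems(2,5) by (auto simp: less_le)
  then have "0 < (\<Sum>j\<in>V. l j * (M j j + 2 - pr l j))"
    using less.prems by (intro rational_pr)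
  then obtain j where j: "j \<in> V" "0 < l j * (M j j + 2 - pr l j)"
    by (meson not_le sum_nonpos)
  then have lj: "0 < l j" "pr l j \<le> M j j + 1"
    using nonneg [of j] by (auto simp: zero_less_mult_iff)
  then have "j \<in> D" using less.prems(3) by fastforce
  let ?l = "l - unit_vec j"
  have yl: "y + ?l \<in> lattice V"
    using assms(1) less.prems(1) j(1) by (intro add_in_lattice diff_in_lattice unit_vec_in_lattice)
  have "y + ?l + unit_vec j = y + l" by (simp add: fun_eq_iff)
  then have "\<chi> (y + l) = \<chi> (y + ?l) + 1 - pr (y + ?l) j - \<rho> j"
    using chi_step [OF yl j(1)] by (simp only:)
  also have "pr (y + ?l) j = pr y j + pr l j - M j j"
    using j(1) by (simp add: pr_add pr_diff pr_unit_vec)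
  finally have step: "\<chi> (y + ?l) \<le> \<chi> (y + l)"
    using lj(2) assms(2) [OF \<open>j \<in> D\<close>] by linarith
  show ?case
  proof (cases "j \<in> S")
    case True
    with step j(1) less.prems(1,2) show ?thesis
      by (intro exI [of _ l] exI [of _ j]) (simp add: add_diff_eq)
  next
    case False
    have "?l u = l u" if "u \<in> S" for u
      using False that by (auto simp: unit_vec_def)
    moreover have "\<exists>l' k. k \<in> S \<and> k \<in> V \<and> l' \<in> lattice V \<and> 0 \<le> l' \<and> l' \<le> ?l \<and>
        (\<forall>u\<in>S. l' u = ?l u) \<and> \<chi> (y + l' - unit_vec k) \<le> \<chi> (y + ?l)"
    proof (rule less.hyps)
      have "(\<Sum>u\<in>V. ?l u) < (\<Sum>u\<in>V. l u)"
        using finite_V j(1) by (intro sum_strict_mono_ex1 bexI [of _ j]) (auto simp: unit_vec_def)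
      moreover have "0 \<le> (\<Sum>u\<in>V. ?l u)"
        using nonneg lj(1) by (intro sum_nonneg) (auto simp: unit_vec_def)
      ultimately show "nat (\<Sum>u\<in>V. ?l u) < nat (\<Sum>u\<in>V. l u)" by simp
      show "?l \<in> lattice V" using less.prems(1) j(1) by (intro diff_in_lattice unit_vec_in_lattice)
      show "0 \<le> ?l" using nonneg lj(1) by (auto simp: le_fun_def unit_vec_def)
      show "?l u = 0" if "u \<notin> D" for u
        using that less.prems(3) \<open>j \<in> D\<close> by (auto simp: unit_vec_def)
      show "?l u \<le> 1" if "u \<in> B" for u
        using less.prems(4) [OF that] by (auto simp: unit_vec_def)
      show "0 < ?l s" using False assms(4) less.prems(5) by (auto simp: unit_vec_def)
    qed
    ultimately obtain l' k where l': "k \<in> S" "k \<in> V" "l' \<in> lattice V" "0 \<le> l'" "l' \<le> ?l"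
      "\<And>u. u \<in> S \<Longrightarrow> l' u = l u" "\<chi> (y + l' - unit_vec k) \<le> \<chi> (y + ?l)"
      by auto
    moreover have "?l \<le> l" by (auto simp: le_fun_def unit_vec_def)
    ultimately show ?thesis
      using step by (intro exI [of _ l'] exI [of _ k]) (auto intro: order_trans)
  qed
qed

end

section \<open>Elimination of one vertex\<close>

locale elimination = rational_weight V M \<rho> \<chi> Z B
  for V :: "'v::linorder set" and M \<rho> \<chi> Z B +
  fixes A :: "'v set" and v :: 'v
  assumes B_A: "B \<subseteq> A" and vA_V: "insert v A \<subseteq> V" and v_A: "v \<notin> A"
begin

lemma A_V: "A \<subseteq> V" and v_V: "v \<in> V" and B_vA: "B \<subseteq> insert v A"
  using B_A vA_V by auto

abbreviation f :: "('v \<Rightarrow> int) \<Rightarrow> int" where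
  "f \<equiv> wt (insert v A)"

abbreviation valley :: "('v \<Rightarrow> int) \<Rightarrow> int" where
  "valley i \<equiv> xs A i v"

lemma wt_le_f: "wt A i \<le> f (i(v := t))"
proof -
  have "wt A i \<le> \<chi> (xs (insert v A) (i(v := t)))"
    using vA_V v_A B_A A_V by (intro wt_le) (auto simp: xs_in_lattice xs_on)
  then show ?thesis by (simp add: wt_def)
qed

lemma f_le:
  assumes "x \<in> lattice V" "\<And>j. j \<in> A \<Longrightarrow> x j = p j" "x v = p v"
  shows "f p \<le> \<chi> x"
  using assms vA_V B_vA by (intro wt_le) auto

text \<open>The cycle \<open>xs A i\<close> itself lies over this point.\<close>

lemma f_valley: "f (i(v := valley i)) = wt A i"
proof (rule antisym)
  show "f (i(v := valley i)) \<le> wt A i"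
    unfolding wt_def [of A i] using A_V v_A
    by (intro f_le) (auto simp: xs_in_lattice xs_on)
qed (rule wt_le_f)

text \<open>Below the valley the minimising cycle must violate the condition at \<open>v\<close>;
  otherwise it would be feasible for \<open>A\<close> with a smaller coordinate at \<open>v\<close>
  than the least one. Raising \<open>v\<close> is therefore free.\<close>

lemma f_step_down:
  assumes "t < valley i"
  shows "f (i(v := t + 1)) \<le> f (i(v := t))"
proof -
  let ?x = "xs (insert v A) (i(v := t))"
  have x: "?x \<in> lattice V" "?x v = t" "\<And>j. j \<in> A \<Longrightarrow> ?x j = i j"
    using vA_V v_A by (auto simp: xs_in_lattice xs_on)
  have "1 \<le> pr ?x v + \<rho> v"
  proof (rule ccontr)
    assume "\<not> ?thesis"
    then have "pr ?x j + \<rho> j \<le> 0" if "j \<in> V - A" for j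
      using that xs_anti_nef [OF vA_V, of j "i(v := t)"] by (cases "j = v") auto
    then have "?x \<in> feasible A i"
      using x by (auto simp: feasible_def)
    from xs_le [OF A_V this] assms x(2) show False by (auto simp: le_fun_def not_less dest: spec [of _ v])
  qed
  then have "\<chi> (?x + unit_vec v) \<le> \<chi> ?x"
    using chi_step [OF x(1) v_V] by simp
  moreover have "f (i(v := t + 1)) \<le> \<chi> (?x + unit_vec v)"
    using x v_V v_A by (intro f_le) (auto simp: add_in_lattice unit_vec_in_lattice, auto simp: unit_vec_def)
  ultimately show ?thesis by (simp add: wt_def)
qed

text \<open>The infimum is feasible for \<open>A\<close>. At \<open>v\<close>, where the cycle on
  the right is not known to be anti-nef, \<open>xs A i\<close> has the smaller coordinate and alone
  decides.\<close>

lemma base_le_xs: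
  assumes "valley i < t" "\<And>j. j \<in> A \<Longrightarrow> i j \<le> p j"
  shows "xs A i \<le> xs (insert v A) (p(v := t))"
proof -
  let ?x = "xs (insert v A) (p(v := t))" and ?y = "xs A i"
  have "pr (inf ?y ?x) j + \<rho> j \<le> 0" if "j \<in> V" "j \<notin> A" for j
  proof (cases "j = v")
    case True
    have "pr (inf ?y ?x) v \<le> pr ?y v"
      using assms vA_V by (intro pr_inf) (simp add: xs_on)
    then show ?thesis using xs_anti_nef [OF A_V that, of i] True by simp
  next
    case False
    then show ?thesis
      using that A_V vA_V by (intro pr_inf_le) (auto simp: xs_anti_nef)
  qed
  moreover have "inf ?y ?x j = i j" if "j \<in> A" for j
    using that assms(2) [OF that] v_A A_V vA_V by (auto simp: xs_on inf_min)
  ultimately have "inf ?y ?x \<in> feasible A i"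
    using A_V vA_V by (auto simp: feasible_def inf_in_lattice xs_in_lattice)
  from xs_le [OF A_V this] show ?thesis by simp
qed

text \<open>The rational cycle between the base point and the corner is peeled off vertex by vertex until
  a coordinate in \<open>insert v I\<close> has to drop.\<close>

lemma descent_from_corner:
  assumes "I \<subseteq> A" "valley i < T" "\<And>b. b \<in> I \<Longrightarrow> pr (xs A i) b + \<rho> b \<le> 0"
  defines "p \<equiv> (i + cube_vec I)(v := T)"
  shows "\<exists>j\<in>insert v I. f (p - unit_vec j) \<le> f p"
proof -
  let ?x = "xs (insert v A) p" and ?y = "xs A i"
  define l where "l = ?x - ?y"
  have le: "?y \<le> ?x"
    unfolding p_def using assms(2) by (intro base_le_xs) (auto simp: cube_vec_def)
  have x: "?x \<in> lattice V" "?x v = T" "\<And>j. j \<in> A \<Longrightarrow> ?x j = i j + cube_vec I j"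
    using vA_V v_A by (auto simp: xs_in_lattice xs_on p_def)
  have y: "?y \<in> lattice V" "\<And>j. j \<in> A \<Longrightarrow> ?y j = i j"
    using A_V by (auto simp: xs_in_lattice xs_on)
  have l: "l \<in> lattice V" "0 \<le> l" "\<And>j. j \<in> A \<Longrightarrow> l j = cube_vec I j" "0 < l v"
    using x y le assms(2) by (auto simp: l_def diff_in_lattice)
  \<comment> \<open>Over \<open>A\<close> the cycle \<open>l\<close> is the indicator of
    \<open>I\<close>, so its coefficients on \<open>B\<close> are at most 1. On \<open>I\<close> the
    base cycle is anti-nef by assumption, outside \<open>A\<close> by construction; above the valley
    \<open>l v\<close> is positive.\<close>
  have "\<exists>l' j. j \<in> insert v I \<and> j \<in> V \<and> l' \<in> lattice V \<and> 0 \<le> l' \<and> l' \<le> l \<and>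
      (\<forall>u\<in>insert v I. l' u = l u) \<and> \<chi> (?y + l' - unit_vec j) \<le> \<chi> (?y + l)"
  proof (rule rational_descent [where D = "(V - A) \<union> I" and s = v])
    show "pr ?y j + \<rho> j \<le> 0" if "j \<in> (V - A) \<union> I" for j
      using that assms(3) xs_anti_nef [OF A_V, of j i] by auto
    show "l j = 0" if "j \<notin> (V - A) \<union> I" for j
      using that l(1) l(3) [of j] by (cases "j \<in> V") (auto simp: lattice_def cube_vec_def)
    show "l j \<le> 1" if "j \<in> B" for j
      using that B_A l(3) [of j] by (auto simp: cube_vec_def)
  qed (use y l v_V v_A in auto)
  then obtain l' j where l': "j \<in> insert v I" "j \<in> V" "l' \<in> lattice V" "0 \<le> l'" "l' \<le> l"
    "\<And>u. u \<in> insert v I \<Longrightarrow> l' u = l u" "\<chi> (?y + l' - unit_vec j) \<le> \<chi> (?y + l)"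
    by auto
  \<comment> \<open>Peeling cannot disturb the coordinates in \<open>A\<close>: they are kept on
    \<open>I\<close> and squeezed between 0 and 0 on the rest.\<close>
  have on_A: "l' u = cube_vec I u" if "u \<in> A" for u
  proof (cases "u \<in> I")
    case True
    then show ?thesis using l'(6) [of u] l(3) [OF that] by simp
  next
    case False
    then have "l u = 0" using l(3) [OF that] by (simp add: cube_vec_def)
    moreover have "0 \<le> l' u" "l' u \<le> l u" using l'(4,5) by (auto simp: le_fun_def)
    ultimately show ?thesis using False by (simp add: cube_vec_def)
  qed
  have "f (p - unit_vec j) \<le> \<chi> (?y + l' - unit_vec j)"
  proof (rule f_le)
    show "?y + l' - unit_vec j \<in> lattice V"
      using y(1) l'(2,3) by (intro diff_in_lattice add_in_lattice unit_vec_in_lattice)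
    show "(?y + l' - unit_vec j) u = (p - unit_vec j) u" if "u \<in> A" for u
      using that v_A y(2) on_A by (auto simp: p_def)
    show "(?y + l' - unit_vec j) v = (p - unit_vec j) v"
      using l'(6) [of v] x(2) by (simp add: p_def l_def)
  qed
  also have "\<dots> \<le> \<chi> (?y + l)" by (fact l'(7))
  also have "?y + l = ?x" by (simp add: l_def)
  finally have "f (p - unit_vec j) \<le> f p"
    by (simp only: wt_def)
  with l'(1) show ?thesis by blast
qed

text \<open>Over a cube without directions the descent can only lower \<open>v\<close>.\<close>

lemma f_step_up:
  assumes "valley i \<le> t"
  shows "f (i(v := t)) \<le> f (i(v := t + 1))"
proof -
  have "i(v := t + 1) - unit_vec v = i(v := t)"
    by (auto simp: unit_vec_def fun_eq_iff)
  then show ?thesis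
    using descent_from_corner [of "{}" i "t + 1"] assms by simp
qed

section \<open>Common points of the sublevel intervals over a cube\<close>

lemma f_antimono:
  assumes "t \<le> t'" "t' \<le> valley i"
  shows "f (i(v := t')) \<le> f (i(v := t))"
  using assms
proof (induction t' rule: int_ge_induct)
  case (step t')
  then have "t' < valley i" by simp
  from order.trans [OF f_step_down [OF this] step.IH] step.prems show ?case by linarith
qed simp

lemma f_mono:
  assumes "t \<le> t'" "valley i \<le> t"
  shows "f (i(v := t)) \<le> f (i(v := t'))"
  using assms
proof (induction t' rule: int_ge_induct)
  case (step t')
  then have "valley i \<le> t'" by simp
  from order.trans [OF step.IH f_step_up [OF this]] step.prems show ?case by linarith
qed simp

lemma valley_mono: "(\<And>j. j \<in> A \<Longrightarrow> i j \<le> i' j) \<Longrightarrow> valley i \<le> valley i'"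
  using xs_mono [OF A_V, of i i'] by (simp add: le_fun_def)

lemma valley_cube: "valley i \<le> valley (i + cube_vec K)"
  by (rule valley_mono) (simp add: cube_vec_def)

lemma f_increment:
  assumes "p \<le> q" "p j = q j"
  shows "f (q + unit_vec j) - f q \<le> f (p + unit_vec j) - f p"
  using wt_increment_antimono [OF B_vA vA_V assms] .

lemma cube_upd_insert:
  "a \<notin> K \<Longrightarrow> a \<noteq> v \<Longrightarrow>
    (i + cube_vec (insert a K))(v := t) = (i + cube_vec K)(v := t) + unit_vec a"
  by (auto simp: cube_vec_def unit_vec_def fun_eq_iff)

text \<open>The ceiling \<open>T\<close> is part of the induction because comparisons made at the
  top corner at height \<open>T\<close> extend by submodularity only downwards. Each step removes a
  direction of the cube or lowers \<open>T\<close> towards the valley of the base corner.\<close>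

lemma common_level:
  assumes "I \<subseteq> A" "\<And>K. K \<subseteq> I \<Longrightarrow> \<exists>t\<le>T. f ((i + cube_vec K)(v := t)) \<le> N"
  shows "\<exists>t\<le>T. \<forall>K\<subseteq>I. f ((i + cube_vec K)(v := t)) \<le> N"
  using assms
proof (induction "card I" arbitrary: I i T rule: less_induct)
  case (less I i T)
  note outer = less.hyps and I_A = less.prems(1)
  have fin: "finite I" using less.prems(1) A_V finite_V by (meson finite_subset)
  let ?g = "\<lambda>K t. f ((i + cube_vec K)(v := t))"
  have "v \<notin> I" using less.prems(1) v_A by auto
  have smaller: "card (I - {b}) < card I" "I - {b} \<subseteq> A" if "b \<in> I" for b
    using that card_Diff1_less [OF fin] less.prems(1) by auto
  show ?case
    using less.prems(2)
  proof (induction "nat (T - valley i)" arbitrary: T rule: less_induct)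
    case (less T)
    note inner = less.hyps and low = less.prems
    show ?case
    proof (cases "T \<le> valley i")
      case True
      \<comment> \<open>The valley of the base corner is the lowest of all, so up to
        \<open>T\<close> the weight falls over every corner and \<open>T\<close> itself
        works.\<close>
      have "?g K T \<le> N" if K: "K \<subseteq> I" for K
      proof -
        from low [OF K] obtain t where "t \<le> T" "?g K t \<le> N" by blast
        then show ?thesis
          using f_antimono [of t T "i + cube_vec K"] True valley_cube [of i K] by simp
      qed
      then show ?thesis by blast
    next
      case False
      then have T: "valley i < T" by simp
      show ?thesis
      proof (cases "\<exists>b\<in>I. 1 \<le> pr (xs A i) b + \<rho> b")
        case True
        \<comment> \<open>Raising \<open>b\<close> is free at \<open>x(i)\<close>, hence free at all
          points above it; the face without \<open>b\<close> controls the whole cube.\<close>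
        then obtain b where b: "b \<in> I" "1 \<le> pr (xs A i) b + \<rho> b" by blast
        have "b \<in> A" "b \<noteq> v" "b \<in> V" using b(1) \<open>v \<notin> I\<close> I_A A_V by auto
        have "\<exists>t\<le>T. \<forall>K\<subseteq>I - {b}. ?g K t \<le> N"
          by (rule outer [OF smaller [OF b(1)]]) (use low in blast)
        then obtain t where t: "t \<le> T" "\<And>K. K \<subseteq> I - {b} \<Longrightarrow> ?g K t \<le> N" by blast
        \<comment> \<open>The comparison starts at height \<open>valley i\<close>, so the level is
          lifted to it; this is free because all valleys over the cube are at least that
          high.\<close>
        define t' where "t' = max t (valley i)"
        have t': "t' \<le> T" "valley i \<le> t'" using t(1) T by (auto simp: t'_def)
        have good: "?g K t' \<le> N" if K: "K \<subseteq> I - {b}" for K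
        proof (cases "valley i \<le> t")
          case True
          then show ?thesis using t(2) [OF K] by (simp add: t'_def)
        next
          case False
          then show ?thesis
            using f_antimono [of t "valley i" "i + cube_vec K"] valley_cube [of i K] t(2) [OF K]
            by (simp add: t'_def)
        qed
        have "?g K t' \<le> N" if K: "K \<subseteq> I" for K
        proof (cases "b \<in> K")
          case True
          define q where "q = (i + cube_vec (K - {b}))(v := t')"
          let ?p = "i(v := valley i)"
          have "?p \<le> q"
            using t'(2) by (auto simp: q_def le_fun_def cube_vec_def)
          moreover have "?p b = q b"
            using \<open>b \<noteq> v\<close> by (simp add: q_def cube_vec_def)
          ultimately have "f (q + unit_vec b) - f q \<le> f (?p + unit_vec b) - f ?p"
            by (rule f_increment)
          moreover have "f (?p + unit_vec b) \<le> \<chi> (xs A i + unit_vec b)"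
            using \<open>b \<in> V\<close> \<open>b \<noteq> v\<close> A_V v_A
            by (intro f_le add_in_lattice xs_in_lattice unit_vec_in_lattice) (auto simp: xs_on unit_vec_def)
          moreover have "\<chi> (xs A i + unit_vec b) \<le> wt A i"
            using chi_step [OF xs_in_lattice [OF A_V] \<open>b \<in> V\<close>, of i] b(2) by (simp add: wt_def)
          ultimately have "f (q + unit_vec b) \<le> f q"
            using wt_le_f [of i "valley i"] by linarith
          moreover have "q + unit_vec b = (i + cube_vec K)(v := t')"
            using cube_upd_insert [of b "K - {b}" i t'] \<open>b \<noteq> v\<close> True by (simp add: q_def insert_absorb)
          ultimately show ?thesis
            using good [of "K - {b}"] K by (simp add: q_def Diff_mono)
        next
          case False
          then show ?thesis using good K by blast
        qed
        with t'(1) show ?thesis by blast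
      next
        case False
        then have "pr (xs A i) b + \<rho> b \<le> 0" if "b \<in> I" for b
          using that by force
        from descent_from_corner [OF I_A T this] obtain j where j: "j \<in> insert v I"
          and desc: "f ((i + cube_vec I)(v := T) - unit_vec j) \<le> f ((i + cube_vec I)(v := T))"
          by blast
        show ?thesis
        proof (cases "j = v")
          case True
          \<comment> \<open>The step from \<open>T - 1\<close> to \<open>T\<close> does not decrease
            at the top corner, and increments are larger at lower corners.\<close>
          have "?g K (T - 1) \<le> ?g K T" if K: "K \<subseteq> I" for K
          proof -
            have shift: "(i + cube_vec K)(v := T - 1) + unit_vec v = (i + cube_vec K)(v := T)" for K
              by (auto simp: unit_vec_def fun_eq_iff)
            have "(i + cube_vec I)(v := T) - unit_vec v = (i + cube_vec I)(v := T - 1)"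
              by (auto simp: unit_vec_def fun_eq_iff)
            then have "?g I (T - 1) \<le> ?g I T" using desc True by simp
            moreover have "(i + cube_vec K)(v := T - 1) \<le> (i + cube_vec I)(v := T - 1)"
              using K by (auto simp: le_fun_def cube_vec_def)
            then have "f ((i + cube_vec I)(v := T - 1) + unit_vec v) - ?g I (T - 1) \<le>
                f ((i + cube_vec K)(v := T - 1) + unit_vec v) - ?g K (T - 1)"
              by (rule f_increment) simp
            ultimately show ?thesis by (simp add: shift)
          qed
          then have "\<exists>t\<le>T - 1. ?g K t \<le> N" if "K \<subseteq> I" for K
            using low [OF that] that by (metis order.trans order_refl zle_diff1_eq order_le_less)
          then have "\<exists>t\<le>T - 1. \<forall>K\<subseteq>I. ?g K t \<le> N"
            using T by (intro inner) auto
          then show ?thesis by (meson order.trans zle_diff1_eq less_imp_le)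
        next
          case False
          then have "j \<in> I" "j \<noteq> v" using j by auto
          \<comment> \<open>Dropping \<open>j\<close> is free at the top corner, so below it the
            face containing \<open>j\<close> dominates the opposite one and the induction goes on
            over that face.\<close>
          have le: "?g K t \<le> ?g (insert j K) t" if "K \<subseteq> I - {j}" "t \<le> T" for K t
          proof -
            have "j \<notin> K" using that by auto
            let ?p = "(i + cube_vec K)(v := t)" and ?q = "(i + cube_vec (I - {j}))(v := T)"
            have q: "?q + unit_vec j = (i + cube_vec I)(v := T)"
              using cube_upd_insert [of j "I - {j}" i T] \<open>j \<in> I\<close> \<open>j \<noteq> v\<close> by (simp add: insert_absorb)
            then have "f ?q \<le> f (?q + unit_vec j)"
              using desc by (simp flip: q)
            moreover have "?p \<le> ?q" using that by (auto simp: le_fun_def cube_vec_def)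
            moreover have "?p j = ?q j"
              using \<open>j \<notin> K\<close> \<open>j \<noteq> v\<close> by (simp add: cube_vec_def)
            ultimately have "f ?p \<le> f (?p + unit_vec j)"
              using f_increment [of ?p ?q j] by simp
            then show ?thesis
              using cube_upd_insert [OF \<open>j \<notin> K\<close> \<open>j \<noteq> v\<close>, of i t] by simp
          qed
          have shift: "i + unit_vec j + cube_vec K = i + cube_vec (insert j K)" if "K \<subseteq> I - {j}" for K
            using that by (subst cube_vec_insert) (auto simp: add.assoc)
          have "\<exists>t\<le>T. \<forall>K\<subseteq>I - {j}. f ((i + unit_vec j + cube_vec K)(v := t)) \<le> N"
          proof (rule outer [OF smaller [OF \<open>j \<in> I\<close>]])
            fix K assume "K \<subseteq> I - {j}"
            moreover from this have "insert j K \<subseteq> I" using \<open>j \<in> I\<close> by auto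
            ultimately show "\<exists>t\<le>T. f ((i + unit_vec j + cube_vec K)(v := t)) \<le> N"
              using low by (simp only: shift)
          qed
          then obtain t where t: "t \<le> T" "\<And>K. K \<subseteq> I - {j} \<Longrightarrow> ?g (insert j K) t \<le> N"
            using shift by metis
          have "?g K t \<le> N" if K: "K \<subseteq> I" for K
          proof (cases "j \<in> K")
            case True
            then show ?thesis using t(2) [of "K - {j}"] K by (auto simp: insert_absorb)
          next
            case False
            then have "K \<subseteq> I - {j}" using K by blast
            from le [OF this t(1)] t(2) [OF this] show ?thesis by simp
          qed
          with t(1) show ?thesis by blast
        qed
      qed
    qed
  qed
qed

end

section \<open>Nonnegativity from the minimality of the class\<close>

context rational_weight
begin

text \<open>Subtracting the negative part \<open>m\<close> of \<open>x\<close> from the minimal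
  class destroys anti-nefness at some \<open>j\<close>. There \<open>m\<close> cannot vanish, as
  \<open>\<rho> j \<le> 0\<close>; and the positive part \<open>x + m\<close> vanishes at
  \<open>j\<close>, so it meets \<open>E_j\<close> nonnegatively and the violation passes to
  \<open>x\<close>.\<close>

lemma negative_direction:
  assumes "x \<in> lattice V" "\<not> 0 \<le> x"
  obtains j where "j \<in> V" "x j < 0" "1 \<le> pr x j + \<rho> j"
proof -
  define m where "m = sup (- x) 0"
  have m: "m j = max (- x j) 0" for j by (simp add: m_def sup_max)
  have "m \<in> lattice V" using assms(1) by (simp add: lattice_def m)
  moreover have "0 < m"
    using assms(2) by (auto simp: less_le le_fun_def m fun_eq_iff max_def)
  ultimately obtain j where j: "j \<in> V" "1 \<le> \<rho> j - pr m j"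
    using rho_minimal [of m] by (auto simp: pr_def)
  have "x j < 0"
  proof (rule ccontr)
    assume "\<not> x j < 0"
    then have "pr 0 j \<le> pr m j" by (intro pr_mono) (auto simp: m)
    with j rho_nonpos [OF j(1)] show False by (simp add: pr_def)
  qed
  moreover from this have "pr 0 j \<le> pr (x + m) j" by (intro pr_mono) (auto simp: m)
  then have "1 \<le> pr x j + \<rho> j" using j(2) by (simp add: pr_add) (simp add: pr_def)
  ultimately show ?thesis using that j(1) by blast
qed

text \<open>A negative coordinate would produce a negative \<open>j\<close>, necessarily outside
  \<open>A\<close>, at which the cycle is not anti-nef.\<close>

lemma xs_nonneg:
  assumes "A \<subseteq> V" "\<And>j. j \<in> A \<Longrightarrow> 0 \<le> i j"
  shows "0 \<le> xs A i"
proof (rule ccontr)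
  assume "\<not> 0 \<le> xs A i"
  from negative_direction [OF xs_in_lattice [OF assms(1)] this] obtain j
    where j: "j \<in> V" "xs A i j < 0" "1 \<le> pr (xs A i) j + \<rho> j" .
  then have "j \<notin> A" using assms xs_on [of A j i] by force
  from xs_anti_nef [OF assms(1) j(1) this, of i] j(3) show False by simp
qed

end

context elimination
begin

text \<open>A common level for the weight of the base cube gives the height \<open>t0\<close>.
  Moving away from it, each corner either recedes from its own valley and rises, or still approaches
  it and stays below the value at \<open>t0\<close>, hence below the minimum \<open>N\<close>; so
  the maximum over the corners is monotone on both sides.\<close>

lemma ex_bottom:
  assumes "l \<in> quadrant A" "I \<subseteq> A"
  shows "\<exists>t0\<ge>0. cube_weight f (l(v := t0), I) = cube_weight (wt A) (l, I) \<and>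
    (\<forall>t\<ge>t0. cube_weight f (l(v := t), I) \<le> cube_weight f (l(v := t + 1), I)) \<and>
    (\<forall>t. 0 \<le> t \<longrightarrow> t < t0 \<longrightarrow> cube_weight f (l(v := t + 1), I) \<le> cube_weight f (l(v := t), I))"
proof -
  have fin: "finite I" using assms(2) A_V finite_V by (meson finite_subset)
  define N where "N = cube_weight (wt A) (l, I)"
  let ?g = "\<lambda>K t. f ((l + cube_vec K)(v := t))"
  have upd: "l(v := t) + cube_vec K = (l + cube_vec K)(v := t)" if "K \<subseteq> I" for K t
    using that assms(2) v_A by (auto simp: cube_vec_def fun_eq_iff)
  have weight_le_iff: "cube_weight f (l(v := t), I) \<le> n \<longleftrightarrow> (\<forall>K\<subseteq>I. ?g K t \<le> n)" for t n
    unfolding cube_weight_le_iff [OF fin] using upd by simp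
  have g_le: "?g K t \<le> cube_weight f (l(v := t), I)" if "K \<subseteq> I" for K t
    using weight_le_iff [of t "cube_weight f (l(v := t), I)"] that by simp
  have N_le: "N \<le> cube_weight f (l(v := t), I)" for t
    unfolding N_def cube_weight_le_iff [OF fin]
    using g_le wt_le_f order_trans by blast
  \<comment> \<open>The valley of the top corner is the highest one, which makes it a ceiling for
    all corners.\<close>
  have "\<exists>t\<le>valley (l + cube_vec I). ?g K t \<le> N" if "K \<subseteq> I" for K
  proof (intro exI conjI)
    show "valley (l + cube_vec K) \<le> valley (l + cube_vec I)"
      using that by (intro valley_mono) (auto simp: cube_vec_def)
    show "?g K (valley (l + cube_vec K)) \<le> N"
      unfolding f_valley N_def by (rule cube_weight_ge [OF fin that])
  qed
  from common_level [OF assms(2) this] obtain t1 where t1: "\<And>K. K \<subseteq> I \<Longrightarrow> ?g K t1 \<le> N" by blast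
  \<comment> \<open>Clipping at 0 keeps the level common: the valleys are nonnegative, so all
    weights fall on the way from a negative \<open>t1\<close> to 0.\<close>
  define t0 where "t0 = max t1 0"
  have valley_nonneg: "0 \<le> valley (l + cube_vec K)" for K
    using xs_nonneg [OF A_V, of "l + cube_vec K"] assms(1)
    by (auto simp: le_fun_def quadrant_def cube_vec_def)
  have g_N: "?g K t0 \<le> N" if "K \<subseteq> I" for K
  proof (cases "0 \<le> t1")
    case True
    then show ?thesis using t1 [OF that] by (simp add: t0_def)
  next
    case False
    then show ?thesis
      using f_antimono [of t1 0 "l + cube_vec K"] valley_nonneg [of K] t1 [OF that] by (simp add: t0_def)
  qed
  have "cube_weight f (l(v := t0), I) = N"
    using N_le [of t0] g_N weight_le_iff by (intro antisym) auto
  moreover have "cube_weight f (l(v := t), I) \<le> cube_weight f (l(v := t + 1), I)" if "t0 \<le> t" for t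
    unfolding weight_le_iff
  proof (intro allI impI)
    fix K assume K: "K \<subseteq> I"
    show "?g K t \<le> cube_weight f (l(v := t + 1), I)"
    proof (cases "valley (l + cube_vec K) \<le> t")
      case True
      from order_trans [OF f_step_up [OF this] g_le [OF K]] show ?thesis .
    next
      case False
      then have "?g K t \<le> ?g K t0" using that by (intro f_antimono) auto
      with g_N [OF K] N_le [of "t + 1"] show ?thesis by linarith
    qed
  qed
  moreover have "cube_weight f (l(v := t + 1), I) \<le> cube_weight f (l(v := t), I)" if "t < t0" for t
    unfolding weight_le_iff
  proof (intro allI impI)
    fix K assume K: "K \<subseteq> I"
    show "?g K (t + 1) \<le> cube_weight f (l(v := t), I)"
    proof (cases "t < valley (l + cube_vec K)")
      case True
      from order_trans [OF f_step_down [OF this] g_le [OF K]] show ?thesis .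
    next
      case False
      then have "?g K (t + 1) \<le> ?g K t0" using that by (intro f_mono) auto
      with g_N [OF K] N_le [of t] show ?thesis by linarith
    qed
  qed
  moreover have "0 \<le> t0" by (simp add: t0_def)
  ultimately show ?thesis unfolding N_def by blast
qed

lemma elimination_iso:
  "graded_module_iso (lattice_cohomology (quadrant A) (wt A) q)
    (lattice_cohomology (quadrant (insert v A)) (wt (insert v A)) q)"
proof -
  define bottom where "bottom c = (SOME t0. 0 \<le> t0 \<and>
    cube_weight f ((fst c)(v := t0), snd c) = cube_weight (wt A) c \<and>
    (\<forall>t\<ge>t0. cube_weight f ((fst c)(v := t), snd c) \<le> cube_weight f ((fst c)(v := t + 1), snd c)) \<and>
    (\<forall>t. 0 \<le> t \<longrightarrow> t < t0 \<longrightarrow>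
      cube_weight f ((fst c)(v := t + 1), snd c) \<le> cube_weight f ((fst c)(v := t), snd c)))" for c
  have bottom: "0 \<le> bottom (l, I) \<and> cube_weight f (l(v := bottom (l, I)), I) = cube_weight (wt A) (l, I) \<and>
    (\<forall>t\<ge>bottom (l, I). cube_weight f (l(v := t), I) \<le> cube_weight f (l(v := t + 1), I)) \<and>
    (\<forall>t. 0 \<le> t \<longrightarrow> t < bottom (l, I) \<longrightarrow>
      cube_weight f (l(v := t + 1), I) \<le> cube_weight f (l(v := t), I))"
    if "l \<in> quadrant A" "I \<subseteq> A" for l I
    unfolding bottom_def fst_conv snd_conv by (rule someI_ex [OF ex_bottom [OF that]])
  interpret coordinate_projection A v "wt (insert v A)" "wt A" bottom
  proof
    show "finite A" using A_V finite_V by (rule finite_subset)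
    show "v \<notin> A" by (rule v_A)
  next
    fix l I assume l: "l \<in> quadrant A" "I \<subseteq> A"
    note b = bottom [OF l]
    show "0 \<le> bottom (l, I)" using b by simp
    show "cube_weight f (l(v := bottom (l, I)), I) = cube_weight (wt A) (l, I)" using b by simp
    show "cube_weight (wt A) (l, I) \<le> cube_weight f (l(v := t), I)" if "0 \<le> t" for t
    proof -
      have fin: "finite I" using l(2) A_V finite_V by (meson finite_subset)
      have "wt A (l + cube_vec K) \<le> cube_weight f (l(v := t), I)" if K: "K \<subseteq> I" for K
      proof -
        have "l(v := t) + cube_vec K = (l + cube_vec K)(v := t)"
          using K l(2) v_A by (auto simp: cube_vec_def fun_eq_iff)
        then show ?thesis
          using cube_weight_ge [OF fin K, of f "l(v := t)"] wt_le_f [of "l + cube_vec K" t] by simp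
      qed
      then show ?thesis by (simp add: cube_weight_le_iff [OF fin])
    qed
    show "cube_weight f (l(v := t), I) \<le> cube_weight f (l(v := t + 1), I)" if "bottom (l, I) \<le> t" for t
      using b that by simp
    show "cube_weight f (l(v := t + 1), I) \<le> cube_weight f (l(v := t), I)"
      if "0 \<le> t" "t < bottom (l, I)" for t
      using b that by simp
  qed
  show ?thesis by (rule projection_iso)
qed

end

lemma graded_module_iso_refl: "graded_module_iso L L"
  unfolding graded_module_iso_def by (intro exI [of _ id]) auto

lemma lattice_cohomology_cong:
  assumes "\<And>l. l \<in> P \<Longrightarrow> w l = w' l"
  shows "lattice_cohomology P w q = lattice_cohomology P w' q"
proof -
  have weight: "cube_weight w c = cube_weight w' c" if "c \<in> cubes P r" for c r
    using that assms by (auto simp: cubes_def cube_weight_def intro!: arg_cong [where f = Max] image_cong)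
  have coboundary: "coboundary P w r = coboundary P w' r" for r
  proof (intro ext)
    fix \<phi> and c :: "'a cube"
    obtain l I where c: "c = (l, I)" by force
    show "coboundary P w r \<phi> c = coboundary P w' r \<phi> c"
    proof (cases "(l, I) \<in> cubes P (Suc r)")
      case True
      have "face_diff w \<phi> (l, I) i = face_diff w' \<phi> (l, I) i" if "i \<in> I" for i
        by (simp add: face_diff_def transport_def weight [OF True] weight [OF cubes_face(1) [OF True that]]
            weight [OF cubes_face(2) [OF True that]])
      then show ?thesis by (simp add: c coboundary_eq [OF True])
    qed (simp add: c coboundary_outside)
  qed
  have "homogeneous_cochains P w q = homogeneous_cochains P w' q"
    by (auto simp: homogeneous_cochains_def weight fun_eq_iff)
  moreover have "coboundaries P w q = coboundaries P w' q"
    by (simp add: coboundaries_def coboundary split: nat.split)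
  moreover have "cocycles P w q = cocycles P w' q"
    by (simp add: cocycles_def coboundary)
  ultimately show ?thesis by (simp add: lattice_cohomology_def)
qed

section \<open>Finiteness of the sublevel sets\<close>

context integral_weight
begin

text \<open>Quantitative negative definiteness. With \<open>x = Z * y\<close>, the inequality
  \<open>y i * y j \<le> (y i ^ 2 + y j ^ 2) / 2\<close> on the nonnegative off-diagonal terms
  collects each row into \<open>pr Z j\<close>, which is at most -1.\<close>

lemma quadratic_bound:
  "(\<Sum>j\<in>V. (real_of_int (x j))\<^sup>2 / Z j) \<le> - (\<Sum>j\<in>V. real_of_int (x j * pr x j))"
proof -
  define y where "y j = real_of_int (x j) / Z j" for j
  have x: "real_of_int (x j) = Z j * y j" if "j \<in> V" for j
    using Z_pos [OF that] by (simp add: y_def)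
  have "(\<Sum>j\<in>V. real_of_int (x j * pr x j)) = (\<Sum>j\<in>V. \<Sum>i\<in>V. Z i * Z j * M i j * (y i * y j))"
    by (simp add: pr_def sum_distrib_left x mult_ac)
  also have "\<dots> \<le> (\<Sum>j\<in>V. \<Sum>i\<in>V. Z i * Z j * M i j * (((y i)\<^sup>2 + (y j)\<^sup>2) / 2))"
  proof (intro sum_mono)
    fix i j assume ij: "i \<in> V" "j \<in> V"
    show "Z i * Z j * M i j * (y i * y j) \<le> Z i * Z j * M i j * (((y i)\<^sup>2 + (y j)\<^sup>2) / 2)"
    proof (cases "i = j")
      case True
      then show ?thesis by (simp add: power2_eq_square)
    next
      case False
      have "0 \<le> (y i - y j)\<^sup>2" by simp
      then have "y i * y j \<le> ((y i)\<^sup>2 + (y j)\<^sup>2) / 2" by (simp add: power2_diff)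
      moreover have "0 \<le> Z i * Z j * M i j"
        using Z_pos [OF ij(1)] Z_pos [OF ij(2)] M_nonneg [OF False] by simp
      then have "0 \<le> real_of_int (Z i * Z j * M i j)"
        by (simp only: of_int_0_le_iff)
      ultimately show ?thesis by (rule mult_left_mono)
    qed
  qed
  also have "\<dots> = (\<Sum>j\<in>V. \<Sum>i\<in>V. Z i * Z j * M i j * ((y i)\<^sup>2 / 2)) +
      (\<Sum>j\<in>V. \<Sum>i\<in>V. Z i * Z j * M i j * ((y j)\<^sup>2 / 2))"
    by (simp add: sum.distrib [symmetric] distrib_left add_divide_distrib)
  also have "(\<Sum>j\<in>V. \<Sum>i\<in>V. Z i * Z j * M i j * ((y i)\<^sup>2 / 2)) =
      (\<Sum>j\<in>V. \<Sum>i\<in>V. Z i * Z j * M i j * ((y j)\<^sup>2 / 2))"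
    by (subst sum.swap) (simp add: M_sym mult_ac)
  also have "(\<Sum>j\<in>V. \<Sum>i\<in>V. Z i * Z j * M i j * ((y j)\<^sup>2 / 2)) + (\<Sum>j\<in>V. \<Sum>i\<in>V. Z i * Z j * M i j * ((y j)\<^sup>2 / 2))
      = (\<Sum>j\<in>V. Z j * (y j)\<^sup>2 * pr Z j)"
    by (simp add: sum.distrib [symmetric] pr_def sum_distrib_left mult_ac)
  also have "\<dots> \<le> (\<Sum>j\<in>V. - (Z j * (y j)\<^sup>2))"
  proof (rule sum_mono)
    fix j assume j: "j \<in> V"
    have "real_of_int (pr Z j) \<le> - 1"
      using Z_neg [OF j] unfolding pr_def by linarith
    moreover have "0 \<le> Z j * (y j)\<^sup>2" using Z_pos [OF j] by simp
    ultimately show "Z j * (y j)\<^sup>2 * pr Z j \<le> - (Z j * (y j)\<^sup>2)"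
      using mult_left_mono by fastforce
  qed
  also have "\<dots> = - (\<Sum>j\<in>V. (real_of_int (x j))\<^sup>2 / Z j)"
    unfolding sum_negf using Z_pos by (auto simp: y_def power2_eq_square intro!: sum.cong)
  finally show ?thesis by simp
qed

lemma finite_chi_sublevel: "finite {x \<in> lattice V. \<chi> x \<le> N}"
proof -
  \<comment> \<open>\<open>c j\<close> is the linear coefficient of \<open>2\<chi>\<close>.
    Completing squares adds the terms \<open>(c j)^2 * Z j / 4\<close> to the bound, and
    \<open>R\<close> bounds every coordinate at once.\<close>
  define c where "c j = real_of_int (M j j + 2 - 2 * \<rho> j)" for j
  define K where "K = 2 * N + (\<Sum>j\<in>V. (c j)\<^sup>2 * Z j / 4)"
  define R where "R = (\<Sum>j\<in>V. Z j * (\<bar>K\<bar> + 1 + \<bar>c j\<bar>))"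
  have bound: "\<bar>real_of_int (x j)\<bar> \<le> R" if x: "x \<in> lattice V" "\<chi> x \<le> N" and j: "j \<in> V" for x j
  proof -
    have "real_of_int (2 * \<chi> x) = (\<Sum>j\<in>V. x j * c j) - (\<Sum>j\<in>V. real_of_int (x j * pr x j))"
      unfolding chi_pr [OF x(1)] by (simp add: c_def sum_subtractf [symmetric] algebra_simps)
    with quadratic_bound [of x] x(2)
    have "(\<Sum>j\<in>V. x j * c j + (real_of_int (x j))\<^sup>2 / Z j) \<le> 2 * N"
      by (simp add: sum.distrib)
    then have "(\<Sum>j\<in>V. x j * c j + (real_of_int (x j))\<^sup>2 / Z j + (c j)\<^sup>2 * Z j / 4) \<le> K"
      by (simp add: K_def sum.distrib)
    moreover have "x j * c j + (real_of_int (x j))\<^sup>2 / Z j + (c j)\<^sup>2 * Z j / 4 = Z j * (x j / Z j + c j / 2)\<^sup>2"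
      if "j \<in> V" for j
      using Z_pos [OF that] by (simp add: power2_eq_square field_simps)
    ultimately have "(\<Sum>j\<in>V. Z j * (x j / Z j + c j / 2)\<^sup>2) \<le> K"
      by simp
    moreover have "Z j * (x j / Z j + c j / 2)\<^sup>2 \<le> (\<Sum>j\<in>V. Z j * (x j / Z j + c j / 2)\<^sup>2)"
      using finite_V j Z_pos by (intro member_le_sum) (force intro: mult_nonneg_nonneg)+
    moreover have "(x j / Z j + c j / 2)\<^sup>2 \<le> Z j * (x j / Z j + c j / 2)\<^sup>2"
      using Z_pos [OF j] mult_right_mono [of 1 "real_of_int (Z j)" "(x j / Z j + c j / 2)\<^sup>2"] by simp
    ultimately have "(x j / Z j + c j / 2)\<^sup>2 \<le> \<bar>K\<bar>" by linarith
    \<comment> \<open>The extra 1 turns the bound into a square without taking roots.\<close>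
    also have "\<dots> \<le> (\<bar>K\<bar> + 1)\<^sup>2" by (simp add: power2_eq_square algebra_simps)
    finally have "\<bar>x j / Z j + c j / 2\<bar> \<le> \<bar>K\<bar> + 1"
      using power2_le_iff_abs_le [of "\<bar>K\<bar> + 1"] by simp
    then have "\<bar>x j / Z j\<bar> \<le> \<bar>K\<bar> + 1 + \<bar>c j\<bar>" by linarith
    moreover have "\<bar>real_of_int (x j)\<bar> = Z j * \<bar>x j / Z j\<bar>"
      using Z_pos [OF j] by (simp add: abs_divide)
    moreover have "0 \<le> real_of_int (Z j)" using Z_pos [OF j] by simp
    ultimately have "\<bar>real_of_int (x j)\<bar> \<le> Z j * (\<bar>K\<bar> + 1 + \<bar>c j\<bar>)"
      by (simp only: mult_left_mono)
    also have "\<dots> \<le> R"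
      unfolding R_def using finite_V j Z_pos by (intro member_le_sum) (force intro: mult_nonneg_nonneg)+
    finally show ?thesis .
  qed
  have "x j \<in> {- \<lceil>R\<rceil>..\<lceil>R\<rceil>}" if "x \<in> lattice V" "\<chi> x \<le> N" "j \<in> V" for x j
    using bound [OF that] le_of_int_ceiling [of R] by (simp only: atLeastAtMost_iff) linarith
  then have "{x \<in> lattice V. \<chi> x \<le> N} \<subseteq>
      {x. \<forall>j. (j \<in> V \<longrightarrow> x j \<in> {- \<lceil>R\<rceil>..\<lceil>R\<rceil>}) \<and> (j \<notin> V \<longrightarrow> x j = 0)}"
    by (auto simp: lattice_def)
  then show ?thesis
    by (rule finite_subset) (intro finite_set_of_finite_funs finite_V finite_atLeastAtMost_int)
qed

end

section \<open>Elimination of all vertices outside \<open>B\<close>\<close>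

context rational_weight
begin

lemma quadrant_iso:
  assumes "B \<subseteq> A" "A \<subseteq> V"
  shows "graded_module_iso (lattice_cohomology (quadrant A) (wt A) q)
    (lattice_cohomology (quadrant V) (wt V) q)"
  using finite_Diff [OF finite_V, of A] assms
proof (induction "V - A" arbitrary: A rule: finite_induct)
  case empty
  then have "A = V" by auto
  then show ?case by (simp add: graded_module_iso_refl)
next
  case (insert v C)
  then have v: "v \<in> V" "v \<notin> A" by auto
  have "C = V - insert v A" using insert by auto
  moreover have "B \<subseteq> insert v A" "insert v A \<subseteq> V" using insert.prems v by auto
  ultimately have "graded_module_iso (lattice_cohomology (quadrant (insert v A)) (wt (insert v A)) q)
      (lattice_cohomology (quadrant V) (wt V) q)"
    by (rule insert.hyps(3))
  moreover interpret elimination V M \<rho> \<chi> Z B A v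
    using insert.prems v by unfold_locales auto
  note elimination_iso
  ultimately show ?case using graded_module_iso_trans by blast
qed

text \<open>A free direction at \<open>l\<close> stays free after raising other coordinates, because
  \<open>pr l j\<close> only grows.\<close>

lemma chi_direction:
  assumes "l \<in> lattice V" "l \<notin> quadrant V"
  obtains j where "j \<in> V" "\<And>K. K \<subseteq> V - {j} \<Longrightarrow> \<chi> (l + unit_vec j + cube_vec K) \<le> \<chi> (l + cube_vec K)"
proof -
  have "\<not> 0 \<le> l" using assms by (auto simp: quadrant_def le_fun_def)
  from negative_direction [OF assms(1) this] obtain j where j: "j \<in> V" "1 \<le> pr l j + \<rho> j" .
  have "\<chi> (l + unit_vec j + cube_vec K) \<le> \<chi> (l + cube_vec K)" if K: "K \<subseteq> V - {j}" for K
  proof -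
    have lK: "l + cube_vec K \<in> lattice V"
      using assms(1) K by (auto simp: lattice_def cube_vec_def)
    have "pr l j \<le> pr (l + cube_vec K) j"
      using K by (intro pr_mono) (auto simp: cube_vec_def)
    then have "\<chi> (l + cube_vec K + unit_vec j) \<le> \<chi> (l + cube_vec K)"
      using chi_step [OF lK j(1)] j(2) by simp
    then show ?thesis by (simp add: add.assoc add.commute [of "cube_vec K"])
  qed
  with j(1) that show ?thesis by blast
qed

lemma reduction:
  "graded_module_iso (lattice_cohomology (lattice V) \<chi> q) (lattice_cohomology (quadrant B) (wt B) q)"
proof -
  have "\<exists>j. l \<in> lattice V \<longrightarrow> l \<notin> quadrant V \<longrightarrow> j \<in> V \<and>
      (\<forall>K\<subseteq>V - {j}. \<chi> (l + unit_vec j + cube_vec K) \<le> \<chi> (l + cube_vec K))" for l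
    using chi_direction [of l] by metis
  then obtain dir where dir: "\<And>l. l \<in> lattice V \<Longrightarrow> l \<notin> quadrant V \<Longrightarrow> dir l \<in> V \<and>
      (\<forall>K\<subseteq>V - {dir l}. \<chi> (l + unit_vec (dir l) + cube_vec K) \<le> \<chi> (l + cube_vec K))"
    by metis
  interpret outward_matching V \<chi> dir
    by unfold_locales (use finite_V finite_chi_sublevel dir in auto)
  \<comment> \<open>With all coordinates prescribed the fibre is a single cycle, so its weight is
    \<open>\<chi>\<close> itself.\<close>
  have "lattice_cohomology (quadrant V) \<chi> q = lattice_cohomology (quadrant V) (wt V) q"
    by (rule lattice_cohomology_cong) (simp add: wt_def xs_all quadrant_def)
  with lattice_quadrant_iso [of q]
  have "graded_module_iso (lattice_cohomology (lattice V) \<chi> q) (lattice_cohomology (quadrant V) (wt V) q)"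
    by simp
  moreover have "graded_module_iso (lattice_cohomology (quadrant V) (wt V) q)
      (lattice_cohomology (quadrant B) (wt B) q)"
    by (rule lattice_cohomology_iso_sym [OF quadrant_iso [OF order_refl B_subset]])
  ultimately show ?thesis by (rule graded_module_iso_trans)
qed

end

section \<open>The form of a plumbing graph\<close>

lemma common_denominator:
  fixes x :: "'v \<Rightarrow> rat"
  assumes "finite V"
  shows "\<exists>N>0. \<forall>i\<in>V. of_int N * x i \<in> \<int>"
  using assms
proof (induction V rule: finite_induct)
  case empty
  then show ?case by (auto intro: exI [of _ 1])
next
  case (insert v V)
  then obtain N where N: "N > 0" "\<forall>i\<in>V. of_int N * x i \<in> \<int>" by blast
  obtain a b where ab: "quotient_of (x v) = (a, b)" by force
  then have b: "b > 0" "x v = of_int a / of_int b"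
    by (auto simp: quotient_of_denom_pos quotient_of_div)
  have "of_int (N * b) * x i \<in> \<int>" if "i \<in> insert v V" for i
  proof (cases "i = v")
    case True
    then have "of_int (N * b) * x i = of_int (N * a)" using b by simp
    then show ?thesis by (simp only: Ints_of_int)
  next
    case False
    then have "of_int N * x i \<in> \<int>" using N that by auto
    then have "of_int b * (of_int N * x i) \<in> \<int>" by (rule Ints_mult [OF Ints_of_int])
    then show ?thesis by (simp add: mult_ac)
  qed
  with N b show ?case by (intro exI [of _ "N * b"]) simp
qed

locale negative_plumbing =
  fixes G :: "'v::linorder plumbing_graph"
  assumes tree: "plumbing_tree G" and neg: "negative_definite G"
begin

abbreviation V :: "'v set" where "V \<equiv> verts G"
abbreviation M :: "'v \<Rightarrow> 'v \<Rightarrow> int" where "M \<equiv> intersection_number G"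

definition dot :: "('v \<Rightarrow> rat) \<Rightarrow> 'v \<Rightarrow> rat" where
  "dot x j = (\<Sum>i\<in>V. x i * of_int (M i j))"

lemma finite_V: "finite V"
  using tree by (simp add: plumbing_tree_def)

lemma M_sym: "M i j = M j i"
  using tree by (auto simp: plumbing_tree_def intersection_number_def sym_def)

lemma M_nonneg: "i \<noteq> j \<Longrightarrow> 0 \<le> M i j"
  by (simp add: intersection_number_def)

lemma form_dot: "form G x y = (\<Sum>j\<in>V. y j * dot x j)"
  unfolding form_def dot_def sum_distrib_left by (subst sum.swap) (simp add: mult_ac)

lemma form_unit_vec: "j \<in> V \<Longrightarrow> form G x (unit_vec j) = dot x j"
  using finite_V
  by (simp add: form_dot unit_vec_def if_distrib [of "\<lambda>a. a * _"] cong: if_cong)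

lemma form_comm: "form G x y = form G y x"
  using tree by (intro form_commute) (simp add: plumbing_tree_def)

lemma dot_add: "dot (x + y) j = dot x j + dot y j"
  by (simp add: dot_def distrib_right sum.distrib)

lemma dot_diff: "dot (x - y) j = dot x j - dot y j"
  by (simp add: dot_def left_diff_distrib sum_subtractf)

lemma dot_scale: "dot (\<lambda>i. c * x i) j = c * dot x j"
  by (simp add: dot_def sum_distrib_left mult.assoc)

lemma dot_unit_vec: "i \<in> V \<Longrightarrow> dot (unit_vec i) j = of_int (M i j)"
  using finite_V by (simp add: dot_def unit_vec_def if_distrib [of "\<lambda>a. a * _"] cong: if_cong)

lemma dot_rat_cycle: "dot (rat_cycle x) j = of_int (\<Sum>i\<in>V. x i * M i j)"
  by (simp add: dot_def rat_cycle_def)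

lemma dot_nonneg:
  assumes "\<And>i. i \<in> V \<Longrightarrow> 0 \<le> x i" "x j = 0"
  shows "0 \<le> dot x j"
  unfolding dot_def
proof (rule sum_nonneg)
  fix i assume "i \<in> V"
  then show "0 \<le> x i * of_int (M i j)"
    using assms M_nonneg [of i j] by (cases "i = j") auto
qed

text \<open>Negative definiteness is given on integral cycles; clearing denominators multiplies the
  form by a positive square.\<close>

lemma form_neg:
  assumes "x \<in> rational_cycles G" "x \<noteq> 0"
  shows "form G x x < 0"
proof -
  obtain N where N: "N > 0" "\<forall>i\<in>V. of_int N * x i \<in> \<int>"
    using common_denominator [OF finite_V] by blast
  define l where "l = (\<lambda>i. \<lfloor>of_int N * x i\<rfloor>)"
  have rat_l: "rat_cycle l i = of_int N * x i" for i
    using N(2) assms(1) by (cases "i \<in> V") (auto simp: rat_cycle_def l_def rational_cycles_def elim: Ints_cases)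
  then have rat_l': "rat_cycle l = (\<lambda>i. of_int N * x i)" by auto
  have "l \<in> cycle_lattice G"
    using assms(1) by (auto simp: lattice_def l_def rational_cycles_def)
  moreover have "l \<noteq> 0"
  proof
    assume "l = 0"
    then have "x i = 0" for i using rat_l [of i] N(1) by (simp add: rat_cycle_def)
    with assms(2) show False by auto
  qed
  ultimately have "form G (rat_cycle l) (rat_cycle l) < 0"
    using neg by (simp add: negative_definite_def)
  also have "form G (rat_cycle l) (rat_cycle l) = (of_int N)\<^sup>2 * form G x x"
    unfolding rat_l' form_dot dot_scale by (simp add: sum_distrib_left power2_eq_square mult_ac)
  finally show ?thesis by (simp add: mult_less_0_iff)
qed

text \<open>Orthogonalisation: a cycle \<open>z = E_v + y\<close> orthogonal to all of
  \<open>D\<close> satisfies \<open>(z, z) = (z, E_v)\<close>, which is negative. A multiple of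
  \<open>z\<close> thus adjusts the value at \<open>v\<close> and leaves those on \<open>D\<close>
  alone.\<close>

lemma ex_dot_eq_on:
  assumes "finite D" "D \<subseteq> V"
  shows "\<exists>x. (\<forall>i. i \<notin> D \<longrightarrow> x i = 0) \<and> (\<forall>j\<in>D. dot x j = b j)"
  using assms
proof (induction D arbitrary: b rule: finite_induct)
  case empty
  then show ?case by (auto intro: exI [of _ "\<lambda>_. 0"])
next
  case (insert v D)
  then have IH: "\<exists>x. (\<forall>i. i \<notin> D \<longrightarrow> x i = 0) \<and> (\<forall>j\<in>D. dot x j = b j)" for b by blast
  obtain y where y: "\<And>i. i \<notin> D \<Longrightarrow> y i = 0" "\<And>j. j \<in> D \<Longrightarrow> dot y j = - dot (unit_vec v) j"
    using IH [of "\<lambda>j. - dot (unit_vec v) j"] by blast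
  obtain x where x: "\<And>i. i \<notin> D \<Longrightarrow> x i = 0" "\<And>j. j \<in> D \<Longrightarrow> dot x j = b j"
    using IH [of b] by blast
  define z where "z = unit_vec v + y"
  have z_D: "dot z j = 0" if "j \<in> D" for j
    using y(2) [OF that] by (simp add: z_def dot_add)
  have z_v: "z v = 1" using y(1) insert.hyps by (simp add: z_def unit_vec_def)
  have z_out: "z i = 0" if "i \<notin> insert v D" for i
    using that y(1) by (simp add: z_def unit_vec_def)
  have "form G z z = (\<Sum>j\<in>V. if j = v then dot z v else 0)"
    unfolding form_dot using z_D z_v z_out by (intro sum.cong) auto
  then have "form G z z = dot z v"
    using finite_V insert.prems by simp
  moreover have "form G z z < 0"
  proof (rule form_neg)
    show "z \<in> rational_cycles G"
      using insert.prems by (auto simp: rational_cycles_def intro!: z_out)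
    show "z \<noteq> 0" using z_v by auto
  qed
  ultimately have dz: "dot z v \<noteq> 0" by simp
  define c where "c = (b v - dot x v) / dot z v"
  have "dot (x + (\<lambda>i. c * z i)) j = b j" if "j \<in> insert v D" for j
  proof -
    have "c * dot z v = b v - dot x v" using dz by (simp add: c_def)
    then show ?thesis
      using that x(2) z_D by (auto simp only: dot_add dot_scale insert_iff)
  qed
  moreover have "(x + (\<lambda>i. c * z i)) i = 0" if "i \<notin> insert v D" for i
    using that x(1) z_out by simp
  ultimately show ?case by blast
qed

lemma ex_dot_eq:
  obtains x where "x \<in> rational_cycles G" "\<And>j. j \<in> V \<Longrightarrow> dot x j = b j"
  using ex_dot_eq_on [OF finite_V order_refl, of b] that by (auto simp: rational_cycles_def)

lemma dot_inject:
  assumes "x \<in> rational_cycles G" "y \<in> rational_cycles G" "\<And>j. j \<in> V \<Longrightarrow> dot x j = dot y j"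
  shows "x = y"
proof (rule ccontr)
  assume "x \<noteq> y"
  then have "form G (x - y) (x - y) < 0"
    using assms by (intro form_neg) (auto simp: rational_cycles_def)
  with assms(3) show False by (simp add: form_dot dot_diff)
qed

lemma dual_latticeI:
  assumes "x \<in> rational_cycles G" "\<And>j. j \<in> V \<Longrightarrow> dot x j \<in> \<int>"
  shows "x \<in> dual_lattice G"
  using assms by (auto simp: dual_lattice_def form_dot rat_cycle_def intro!: Ints_sum Ints_mult)

lemma unit_vec_in_lattice: "j \<in> V \<Longrightarrow> unit_vec j \<in> cycle_lattice G"
  by (auto simp: lattice_def unit_vec_def)

lemma rat_cycle_unit_vec: "rat_cycle (unit_vec j) = unit_vec j"
  by (auto simp: rat_cycle_def unit_vec_def)

lemma k_can: "k_can G \<in> rational_cycles G" "j \<in> V \<Longrightarrow> dot (k_can G) j = - of_int (M j j) - 2"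
proof -
  let ?P = "\<lambda>k. k \<in> dual_lattice G \<and>
    (\<forall>j\<in>V. form G k (unit_vec j) = - form G (unit_vec j) (unit_vec j) - 2)"
  obtain k where k: "k \<in> rational_cycles G" "\<And>j. j \<in> V \<Longrightarrow> dot k j = - of_int (M j j) - 2"
    using ex_dot_eq [of "\<lambda>j. - of_int (M j j) - 2"] by blast
  have "?P k"
    using k by (auto simp: form_unit_vec dot_unit_vec intro!: dual_latticeI)
  moreover have "k' = k" if "?P k'" for k'
    using that k by (intro dot_inject) (auto simp: dual_lattice_def form_unit_vec dot_unit_vec)
  ultimately have "?P (k_can G)"
    unfolding k_can_def by (rule theI)
  then show "k_can G \<in> rational_cycles G" "j \<in> V \<Longrightarrow> dot (k_can G) j = - of_int (M j j) - 2"
    by (auto simp: dual_lattice_def form_unit_vec dot_unit_vec)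
qed

text \<open>The negative part \<open>m\<close> satisfies \<open>m j * (m, E_j) \<ge> 0\<close> at
  every \<open>j\<close>, so \<open>(m, m) \<ge> 0\<close> and \<open>m = 0\<close>.\<close>

lemma anti_nef_nonneg:
  assumes "x \<in> rational_cycles G" "\<And>j. j \<in> V \<Longrightarrow> dot x j \<le> 0"
  shows "0 \<le> x i"
proof -
  define m where "m = (\<lambda>j. max (- x j) 0)"
  have "0 \<le> m j * dot m j" if "j \<in> V" for j
  proof (cases "x j < 0")
    case True
    then have "0 \<le> dot (x + m) j" by (intro dot_nonneg) (auto simp: m_def)
    then have "0 \<le> dot m j" using assms(2) [OF that] by (simp add: dot_add)
    then show ?thesis by (simp add: m_def)
  next
    case False
    then show ?thesis by (simp add: m_def)
  qed
  then have "0 \<le> form G m m" unfolding form_dot by (rule sum_nonneg)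
  moreover have "m \<in> rational_cycles G" using assms(1) by (auto simp: rational_cycles_def m_def)
  ultimately have "m = 0" using form_neg [of m] by force
  then have "m i = 0" by simp
  then show ?thesis by (simp add: m_def split: if_splits)
qed

text \<open>Clear denominators in the solution of \<open>(z, E_j) = -1\<close>. It is nonnegative,
  and a zero coordinate would meet \<open>E_j\<close> nonnegatively.\<close>

lemma ex_strictly_anti_nef:
  "\<exists>Z. \<forall>j\<in>V. 1 \<le> Z j \<and> (\<Sum>i\<in>V. Z i * M i j) \<le> - 1"
proof -
  obtain z where z: "z \<in> rational_cycles G" "\<And>j. j \<in> V \<Longrightarrow> dot z j = - 1"
    using ex_dot_eq [of "\<lambda>_. - 1"] by blast
  obtain N where N: "N > 0" "\<forall>i\<in>V. of_int N * z i \<in> \<int>"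
    using common_denominator [OF finite_V] by blast
  define Z where "Z = (\<lambda>i. \<lfloor>of_int N * z i\<rfloor>)"
  have Z: "of_int (Z i) = of_int N * z i" if "i \<in> V" for i
    using N(2) that by (auto simp: Z_def elim: Ints_cases)
  have "1 \<le> Z j" if j: "j \<in> V" for j
  proof -
    have nonneg: "0 \<le> z i" for i using z by (intro anti_nef_nonneg) auto
    have "z j \<noteq> 0"
      using dot_nonneg [of z j] nonneg z(2) [OF j] by auto
    then have "(0::rat) < of_int (Z j)"
      using nonneg [of j] N(1) Z [OF j] by simp
    then show ?thesis by simp
  qed
  moreover have "(\<Sum>i\<in>V. Z i * M i j) \<le> - 1" if j: "j \<in> V" for j
  proof -
    have "of_int (\<Sum>i\<in>V. Z i * M i j) = of_int N * dot z j"
      by (simp add: Z dot_def sum_distrib_left mult.assoc)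
    also have "\<dots> = of_int (- N)" using z(2) [OF j] by simp
    finally have "(\<Sum>i\<in>V. Z i * M i j) = - N" by (simp only: of_int_eq_iff)
    with N(1) show ?thesis by simp
  qed
  ultimately show ?thesis by blast
qed

lemma chi_formula:
  assumes "\<And>j. j \<in> V \<Longrightarrow> dot k j = - of_int (M j j) - 2 + 2 * of_int (r j)"
  shows "2 * chi G k l = of_int (\<Sum>j\<in>V. l j * (M j j + 2 - 2 * r j - (\<Sum>i\<in>V. l i * M i j)))"
proof -
  have "2 * chi G k l = - form G (rat_cycle l + k) (rat_cycle l)"
    by (simp add: chi_def form_comm)
  also have "\<dots> = (\<Sum>j\<in>V. - (rat_cycle l j * (dot (rat_cycle l) j + dot k j)))"
    by (simp add: form_dot dot_add sum_negf)
  also have "\<dots> = (\<Sum>j\<in>V. of_int (l j * (M j j + 2 - 2 * r j - (\<Sum>i\<in>V. l i * M i j))))"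
    by (intro sum.cong refl, simp add: dot_rat_cycle assms) (simp add: rat_cycle_def algebra_simps)
  finally show ?thesis by (simp only: of_int_sum)
qed

lemma integral_weight_chi:
  assumes "k \<in> characteristic_elements G"
    and "\<And>j. j \<in> V \<Longrightarrow> dot k j = - of_int (M j j) - 2 + 2 * of_int (r j)"
    and "\<And>j. j \<in> V \<Longrightarrow> 1 \<le> Z j" "\<And>j. j \<in> V \<Longrightarrow> (\<Sum>i\<in>V. Z i * M i j) \<le> - 1"
  shows "integral_weight V M r (chi_weight G k) Z"
proof
  fix x assume "x \<in> lattice V"
  then have "(of_int (2 * chi_weight G k x) :: rat) = 2 * chi G k x"
    using of_int_chi_weight [OF tree assms(1)] by simp
  also note chi_formula [OF assms(2)]
  finally show "2 * chi_weight G k x = (\<Sum>j\<in>V. x j * (M j j + 2 - 2 * r j - (\<Sum>i\<in>V. x i * M i j)))"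
    by (simp only: of_int_eq_iff)
qed (use finite_V M_sym M_nonneg assms(3,4) in auto)

end

section \<open>The Reduction Theorem\<close>

theorem theorem3p3p3:
  fixes G :: "'v::linorder plumbing_graph"
    and k :: "'v \<Rightarrow> rat"
    and B :: "'v set"
  assumes "plumbing_tree G"
    and "negative_definite G"
    and "k \<in> characteristic_elements G"
    and "bad_vertices G B"
  shows "\<forall>q. graded_module_iso (HH G (dist_rep G k) q) (HH_reduced G k B q)"
proof -
  interpret negative_plumbing G
    using assms(1,2) by unfold_locales
  obtain Z where Z: "\<And>j. j \<in> V \<Longrightarrow> 1 \<le> Z j" "\<And>j. j \<in> V \<Longrightarrow> (\<Sum>i\<in>V. Z i * M i j) \<le> - 1"
    using ex_strictly_anti_nef by blast
  have k_cyc: "k \<in> rational_cycles G"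
    using assms(3) by (simp add: characteristic_elements_def dual_lattice_def)
  define l' where "l' = (\<lambda>v. (k v - k_can G v) / 2)"
  \<comment> \<open>Parity of \<open>k\<close> on \<open>E_j\<close> makes \<open>l'\<close>
    integral there; the \<open>n + 1\<close> below absorbs the 2 in the defining equation of
    \<open>k_can\<close>.\<close>
  have "\<exists>n. dot l' j = of_int n" if j: "j \<in> V" for j
  proof -
    obtain n :: int where "form G k (unit_vec j) + form G (unit_vec j) (unit_vec j) = of_int (2 * n)"
      using assms(3) unit_vec_in_lattice [OF j]
      by (auto simp: characteristic_elements_def rat_cycle_unit_vec dest!: bspec [of _ _ "unit_vec j"])
    then have n: "dot k j + of_int (M j j) = of_int (2 * n)"
      by (simp only: form_unit_vec [OF j] dot_unit_vec [OF j])
    have "l' = (\<lambda>v. (1 / 2) * (k - k_can G) v)"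
      by (simp add: l'_def fun_eq_iff)
    then have "dot l' j = (dot k j - dot (k_can G) j) / 2"
      by (simp only: dot_scale dot_diff)
    also have "\<dots> = of_int (n + 1)"
      using n k_can(2) [OF j] by simp
    finally show ?thesis by blast
  qed
  then obtain r' where r': "\<And>j. j \<in> V \<Longrightarrow> dot l' j = of_int (r' j)" by metis
  have k_l': "k = k_can G + (\<lambda>v. 2 * l' v)"
    by (simp add: l'_def fun_eq_iff diff_divide_distrib)
  have "dot k j = - of_int (M j j) - 2 + 2 * of_int (r' j)" if "j \<in> V" for j
    using that by (simp add: k_l' dot_add dot_scale k_can r')
  then interpret W': integral_weight V M r' "chi_weight G k" Z
    using assms(3) Z by (intro integral_weight_chi)
  \<comment> \<open>With no coordinate prescribed, feasibility of \<open>x\<close> says that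
    \<open>l' + x\<close> is anti-nef, so the least feasible cycle yields the minimal element of the
    class.\<close>
  define x0 where "x0 = W'.xs {} 0"
  have x0: "x0 \<in> lattice V" "\<And>j. j \<in> V \<Longrightarrow> W'.pr x0 j + r' j \<le> 0"
    by (simp_all add: x0_def W'.xs_in_lattice W'.xs_anti_nef)
  have l'_cyc: "l' \<in> rational_cycles G"
    using k_cyc k_can(1) by (auto simp: rational_cycles_def l'_def)
  have coset_cyc: "l' + rat_cycle x \<in> rational_cycles G" if "x \<in> lattice V" for x
    using l'_cyc that by (auto simp: rational_cycles_def lattice_def rat_cycle_def)
  have coset_dot: "dot (l' + rat_cycle x) j = of_int (W'.pr x j + r' j)" if "j \<in> V" for x j
    using that by (simp add: dot_add dot_rat_cycle r' W'.pr_def)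
  have l_class: "l_class G k = l' + rat_cycle x0"
    unfolding l_class_def Let_def l'_def [symmetric]
  proof (rule the_minimal_eq)
    show "l' + rat_cycle x0 \<in> (l' +o rat_cycle ` cycle_lattice G) \<inter> anti_nef_cone G"
    proof
      show "l' + rat_cycle x0 \<in> anti_nef_cone G"
        using x0 coset_cyc [OF x0(1)]
        by (auto simp: anti_nef_cone_def form_unit_vec coset_dot simp del: of_int_add intro!: dual_latticeI)
    qed (use x0 in \<open>auto intro: set_plus_intro2\<close>)
  next
    fix y assume "y \<in> (l' +o rat_cycle ` cycle_lattice G) \<inter> anti_nef_cone G"
    then obtain x where x: "x \<in> lattice V" "y = l' + rat_cycle x" "y \<in> anti_nef_cone G"
      by (auto simp: elt_set_plus_def)
    have "W'.pr x j + r' j \<le> 0" if "j \<in> V" for j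
      using x(3) that by (simp add: x(2) anti_nef_cone_def form_unit_vec coset_dot del: of_int_add)
    then have "x \<in> W'.feasible {} 0" using x(1) by (simp add: W'.feasible_def)
    then have "x0 \<le> x" unfolding x0_def by (rule W'.xs_le [rotated]) simp
    then show "l' + rat_cycle x0 \<le> y" by (simp add: x(2) le_fun_def rat_cycle_def)
  qed
  define r where "r j = W'.pr x0 j + r' j" for j
  have r: "dot (l_class G k) j = of_int (r j)" if "j \<in> V" for j
    using coset_dot [OF that] by (simp only: l_class r_def)
  have dist_rep: "dist_rep G k = k_can G + (\<lambda>v. 2 * l_class G k v)"
    by (simp add: dist_rep_def fun_eq_iff)
  have dist_dot: "dot (dist_rep G k) j = - of_int (M j j) - 2 + 2 * of_int (r j)" if "j \<in> V" for j
    using that by (simp add: dist_rep dot_add dot_scale k_can r)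
  have dist_char: "dist_rep G k \<in> characteristic_elements G"
  proof -
    have "dist_rep G k \<in> rational_cycles G"
      using k_can(1) coset_cyc [OF x0(1)] by (auto simp: dist_rep l_class rational_cycles_def)
    then have "dist_rep G k \<in> dual_lattice G"
      by (rule dual_latticeI) (simp add: dist_dot)
    moreover have "\<exists>n::int. form G (dist_rep G k) (rat_cycle l) + form G (rat_cycle l) (rat_cycle l) = of_int (2 * n)"
      if l: "l \<in> cycle_lattice G" for l
    proof -
      obtain n :: int where n: "form G k (rat_cycle l) + form G (rat_cycle l) (rat_cycle l) = of_int (2 * n)"
        using assms(3) l by (auto simp: characteristic_elements_def)
      \<comment> \<open>The representative differs from \<open>k\<close> by twice an integral cycle,
        hence has the same parity.\<close>
      have eq: "dist_rep G k = k + (\<lambda>v. 2 * rat_cycle x0 v)"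
      proof
        fix v
        show "dist_rep G k v = (k + (\<lambda>v. 2 * rat_cycle x0 v)) v"
          using fun_cong [OF k_l', of v] by (simp add: dist_rep l_class)
      qed
      define m where "m = (\<Sum>j\<in>V. l j * W'.pr x0 j)"
      have "dot (rat_cycle x0) j = of_int (W'.pr x0 j)" for j
        by (simp only: dot_rat_cycle W'.pr_def)
      moreover have "rat_cycle l j = of_int (l j)" for j
        by (simp add: rat_cycle_def)
      ultimately have "form G (dist_rep G k) (rat_cycle l) = form G k (rat_cycle l) + 2 * of_int m"
        by (simp add: eq form_dot dot_add dot_scale m_def
            distrib_left sum.distrib sum_distrib_left mult.left_commute)
      with n show ?thesis by (intro exI [of _ "n + m"]) simp
    qed
    ultimately show ?thesis by (simp add: characteristic_elements_def)
  qed
  interpret W: integral_weight V M r "chi_weight G (dist_rep G k)" Z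
    using dist_char dist_dot Z by (intro integral_weight_chi)
  obtain e' where e': "B \<subseteq> V" "\<And>j. j \<notin> B \<Longrightarrow> e' j = euler G j" "rational_graph (G\<lparr>euler := e'\<rparr>)"
    using assms(4) by (auto simp: bad_vertices_def)
  interpret R: rational_weight V M r "chi_weight G (dist_rep G k)" Z B
  proof
    show "B \<subseteq> V" by (rule e'(1))
    show "r j \<le> 0" if "j \<in> V" for j
      using x0(2) [OF that] by (simp add: r_def)
    show "\<exists>j\<in>V. 1 \<le> r j - (\<Sum>i\<in>V. m i * M i j)" if m: "m \<in> lattice V" "0 < m" for m
    proof (rule ccontr)
      \<comment> \<open>Otherwise \<open>l_class G k\<close> minus \<open>m\<close> would still be
        anti-nef, against minimality.\<close>
      assume "\<not> ?thesis"
      then have "x0 - m \<in> W'.feasible {} 0"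
        using x0(1) m(1)
        by (auto simp: W'.feasible_def W'.diff_in_lattice W'.pr_diff r_def W'.pr_def [symmetric] not_le)
      then have "x0 \<le> x0 - m" unfolding x0_def by (rule W'.xs_le [rotated]) simp
      then have "m \<le> 0" by (simp add: le_fun_def)
      with m(2) show False by simp
    qed
    fix l assume l: "l \<in> lattice V" "0 < l" "\<And>j. j \<in> B \<Longrightarrow> l j \<le> 1"
    let ?G = "G\<lparr>euler := e'\<rparr>"
    interpret G': negative_plumbing ?G
      using e'(3) by unfold_locales (simp_all add: rational_graph_def)
    let ?M = "intersection_number ?G"
    have "0 < 2 * chi ?G (k_can ?G) l"
      using e'(3) l(1,2) by (simp add: rational_graph_def)
    also have "\<dots> = of_int (\<Sum>j\<in>V. l j * (?M j j + 2 - (\<Sum>i\<in>V. l i * ?M i j)))"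
      using G'.chi_formula [of "k_can ?G" "\<lambda>_. 0" l] by (simp add: G'.k_can)
    finally have pos: "0 < (\<Sum>j\<in>V. l j * (?M j j + 2 - (\<Sum>i\<in>V. l i * ?M i j)))"
      by (simp only: of_int_0_less_iff)
    have "l j * (?M j j + 2 - (\<Sum>i\<in>V. l i * ?M i j)) = l j * (M j j + 2 - (\<Sum>i\<in>V. l i * M i j))"
      if j: "j \<in> V" for j
    proof -
      have split: "(\<Sum>i\<in>V. l i * N i j) = l j * N j j + (\<Sum>i\<in>V - {j}. l i * N i j)" for N :: "'v \<Rightarrow> 'v \<Rightarrow> int"
        using finite_V j by (simp add: sum.remove)
      have "(\<Sum>i\<in>V - {j}. l i * ?M i j) = (\<Sum>i\<in>V - {j}. l i * M i j)"
        by (intro sum.cong) (auto simp: intersection_number_def)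
      \<comment> \<open>The decoration enters through \<open>l j - (l j)^2\<close>, which vanishes
        for coefficients 0 and 1; outside \<open>B\<close> the decorations agree.\<close>
      moreover have "l j * (?M j j - l j * ?M j j) = l j * (M j j - l j * M j j)"
      proof (cases "j \<in> B")
        case True
        have "0 \<le> l j" using less_imp_le [OF l(2)] by (simp add: le_fun_def)
        then have "l j = 0 \<or> l j = 1" using l(3) [OF True] by linarith
        then show ?thesis by auto
      next
        case False
        then show ?thesis by (simp add: intersection_number_def e'(2))
      qed
      ultimately show ?thesis
        unfolding split [of ?M] split [of M] by (simp add: algebra_simps)
    qed
    with pos show "0 < (\<Sum>j\<in>V. l j * (M j j + 2 - (\<Sum>i\<in>V. l i * M i j)))"
      by simp
  qed
  have "x_cycle G k B = W.xs B"
  proof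
    fix i
    have "dot (rat_cycle x + l_class G k) j = of_int (W.pr x j + r j)" if "j \<in> V" for x j
      using that by (simp add: dot_add dot_rat_cycle r W.pr_def)
    then show "x_cycle G k B i = W.xs B i"
      unfolding x_cycle_def W.xs_def W.feasible_def
      by (intro arg_cong [where f = the_minimal] Collect_cong)
        (auto simp: form_unit_vec simp del: of_int_add)
  qed
  then have "reduced_weight G k B i = W.wt B i" for i
    by (simp only: reduced_weight_def W.wt_def)
  then have "reduced_weight G k B = W.wt B" by (rule ext)
  then show ?thesis
    using R.reduction by (simp add: HH_def HH_reduced_def)
qed

end
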